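(* Let $G$ be a finite non-nilpotent group. Then every non-nilpotent maximal subgroup of $G$ is normal in $G$ if and only if $G=(P_1\times\cdots\times P_{s-1})\times(P_s \rtimes(Q_1\times\cdots\times Q_t))$, where $P_1,\ldots,P_s$ are normal Sylow subgroups of $G$ for $s\geq 1$, $Q_1,\ldots,Q_t$ are non-normal Sylow subgroups of $G$ for $t\geq 1$, and there exists a subgroup $E$ of $P_s$ such that $E$ is normal in $G$ and $E(Q_1\times\cdots\times Q_t)$ is a nilpotent maximal subgroup of $P_s(Q_1\times\cdots\times Q_t)$.
   Context: All groups are finite. The direct and semidirect products are internal products of subgroups of $G$; when $s=1$ the factor $P_1\times\cdots\times P_{s-1}$ is trivial. *)

theory Defs
  imports "HOL-Algebra.Algebra"
begin

text \<open>All predicates below take the ambient group as an argument. A subgroup \<open>H\<close> of \<open>G\<close> is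
  viewed as a group in its own right through \<open>G\<lparr>carrier := H\<rparr>\<close>.\<close>

definition commutator_subgroup :: "('a, 'b) monoid_scheme \<Rightarrow> 'a set \<Rightarrow> 'a set \<Rightarrow> 'a set" where
  "commutator_subgroup G H K =
     generate G (\<Union>h \<in> H. \<Union>k \<in> K. {h \<otimes>\<^bsub>G\<^esub> k \<otimes>\<^bsub>G\<^esub> inv\<^bsub>G\<^esub> h \<otimes>\<^bsub>G\<^esub> inv\<^bsub>G\<^esub> k})"

fun lower_central_series :: "('a, 'b) monoid_scheme \<Rightarrow> nat \<Rightarrow> 'a set" where
  "lower_central_series G 0 = carrier G"
| "lower_central_series G (Suc n) =
     commutator_subgroup G (lower_central_series G n) (carrier G)"

definition nilpotent_group :: "('a, 'b) monoid_scheme \<Rightarrow> bool" where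
  "nilpotent_group G \<longleftrightarrow> group G \<and> (\<exists>n. lower_central_series G n = {\<one>\<^bsub>G\<^esub>})"

definition maximal_subgroup :: "'a set \<Rightarrow> ('a, 'b) monoid_scheme \<Rightarrow> bool" where
  "maximal_subgroup M G \<longleftrightarrow>
     subgroup M G \<and> M \<noteq> carrier G \<and>
     (\<forall>K. subgroup K G \<longrightarrow> M \<subseteq> K \<longrightarrow> K = M \<or> K = carrier G)"

text \<open>Only primes dividing the group order are considered, so a Sylow subgroup is never trivial.\<close>

definition sylow_subgroup :: "'a set \<Rightarrow> ('a, 'b) monoid_scheme \<Rightarrow> bool" where
  "sylow_subgroup P G \<longleftrightarrow>
     subgroup P G \<and>
     (\<exists>p::nat. Factorial_Ring.prime p \<and> p dvd order G \<and> card P = p ^ multiplicity p (order G))"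

text \<open>\<open>K\<close> is the internal direct product of the finite family \<open>(H i)\<close>, \<open>i \<in> I\<close>, of subgroups of
  \<open>G\<close>. The factors are normal in \<open>K\<close> but need not be normal in \<open>G\<close>. The product over the empty
  family is the trivial subgroup.\<close>

definition internal_direct_product ::
    "('a, 'b) monoid_scheme \<Rightarrow> 'i set \<Rightarrow> ('i \<Rightarrow> 'a set) \<Rightarrow> 'a set \<Rightarrow> bool" where
  "internal_direct_product G I H K \<longleftrightarrow>
     finite I \<and> subgroup K G \<and>
     (\<forall>i \<in> I. H i \<lhd> G\<lparr>carrier := K\<rparr>) \<and>
     K = generate G (\<Union>i \<in> I. H i) \<and>
     (\<forall>i \<in> I. H i \<inter> generate G (\<Union>j \<in> I - {i}. H j) = {\<one>\<^bsub>G\<^esub>})"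

definition internal_direct_product2 ::
    "('a, 'b) monoid_scheme \<Rightarrow> 'a set \<Rightarrow> 'a set \<Rightarrow> 'a set \<Rightarrow> bool" where
  "internal_direct_product2 G A B K \<longleftrightarrow>
     subgroup K G \<and> A \<lhd> G\<lparr>carrier := K\<rparr> \<and> B \<lhd> G\<lparr>carrier := K\<rparr> \<and>
     K = A <#>\<^bsub>G\<^esub> B \<and> A \<inter> B = {\<one>\<^bsub>G\<^esub>}"

text \<open>\<open>K\<close> is the internal semidirect product of its normal subgroup \<open>N\<close> by the complement \<open>B\<close>.\<close>

definition internal_semidirect_product ::
    "('a, 'b) monoid_scheme \<Rightarrow> 'a set \<Rightarrow> 'a set \<Rightarrow> 'a set \<Rightarrow> bool" where
  "internal_semidirect_product G N B K \<longleftrightarrow>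
     subgroup K G \<and> N \<lhd> G\<lparr>carrier := K\<rparr> \<and> subgroup B (G\<lparr>carrier := K\<rparr>) \<and>
     K = N <#>\<^bsub>G\<^esub> B \<and> N \<inter> B = {\<one>\<^bsub>G\<^esub>}"

end

theory Submission
  imports Defs
begin

text \<open>
  A finite group is nilpotent exactly when all its Sylow subgroups are normal
  (\<open>nilpotent_iff_sylow\<close>). Everything below is therefore expressed by Sylow subgroups and
  normalizers of subgroups of one fixed group \<open>G\<close>; even statements about a quotient \<open>G/N\<close> are made
  about subgroups of \<open>G\<close> containing \<open>N\<close>.

  Suppose that every maximal subgroup is nilpotent or normal. If a Sylow subgroup \<open>S\<close> is not normal,
  then a maximal subgroup above its normalizer is self-normalizing by the Frattini argument, hence
  nilpotent, hence equal to the normalizer of \<open>S\<close>. The decisive fact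
  (\<open>exists_normal_sylow_modulo\<close>) is that for every proper normal subgroup \<open>N\<close> there is a Sylow
  subgroup \<open>S\<close> of \<open>G\<close>, not inside \<open>N\<close>, for which \<open>NS\<close> is normal. This is shown by going up from
  \<open>N\<close> to larger normal subgroups. If that is not possible by adjoining a group of prime power order
  to \<open>N\<close>, then all maximal subgroups above \<open>N\<close> are nilpotent and self-normalizing and meet pairwise
  in \<open>N\<close>, and counting the elements of their conjugates, as in Schmidt's theorem on minimal
  non-nilpotent groups, gives a contradiction (\<open>no_trivially_intersecting_maximals\<close>).

  Apply this to the product \<open>F\<close> of all normal Sylow subgroups. The resulting \<open>S\<close> is not normal, so its
  normalizer \<open>M\<close> is a nilpotent maximal subgroup; by the Frattini argument \<open>M\<close> cannot contain \<open>F\<close>, so it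
  misses some normal Sylow \<open>p\<close>-subgroup \<open>P\<close>. As \<open>G = PM\<close>, for every prime other than \<open>p\<close> the Sylow
  subgroup of \<open>M\<close> is one of \<open>G\<close>. Sorting these by whether they are normal in \<open>G\<close> gives the products
  \<open>A\<close> and \<open>B\<close>, and \<open>E\<close> is the intersection of \<open>P\<close> and \<open>M\<close>
  (\<open>splitting_structure_of_nilpotent_maximal\<close>).

  Conversely, put \<open>C = AB\<close>, a nilpotent complement of \<open>P\<close> that centralizes \<open>E\<close>, and let \<open>M\<close> be a
  maximal subgroup that is not normal. It does not contain \<open>P\<close>, because \<open>G/P\<close> is nilpotent, and its
  intersection \<open>P\<^sub>1\<close> with \<open>P\<close> is normal in \<open>G\<close>, because normalizers grow in \<open>P\<close>. If \<open>M\<close> did not contain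
  \<open>E\<close>, then \<open>P = EP\<^sub>1\<close>, so \<open>P\<^sub>1C\<close> would be normal and would contain all Sylow subgroups of \<open>M\<close>, forcing
  \<open>M = P\<^sub>1C\<close>, which is not normal by assumption. So \<open>E\<close> lies in \<open>P\<^sub>1\<close>, and the maximality of \<open>EB\<close> in
  \<open>PB\<close> gives \<open>P\<^sub>1 = E\<close>. The other Sylow subgroups of \<open>M\<close> are conjugate to subgroups of \<open>C\<close>, so they
  centralize \<open>E\<close> and turn out to be normal in \<open>M\<close> (\<open>nonnormal_maximal_nilpotent\<close>).
\<close>

section \<open>Conjugation and normalizers\<close>

locale finite_group = group G for G (structure) +
  assumes fin: "finite (carrier G)"

context group
begin

definition conj_by :: "'a \<Rightarrow> 'a \<Rightarrow> 'a" where
  "conj_by g x = g \<otimes> x \<otimes> inv g"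

lemma inv_cancel_left [simp]:
  "x \<in> carrier G \<Longrightarrow> y \<in> carrier G \<Longrightarrow> inv x \<otimes> (x \<otimes> y) = y"
  "x \<in> carrier G \<Longrightarrow> y \<in> carrier G \<Longrightarrow> x \<otimes> (inv x \<otimes> y) = y"
  by (simp_all flip: m_assoc)

lemma conj_by_closed [simp]: "g \<in> carrier G \<Longrightarrow> x \<in> carrier G \<Longrightarrow> conj_by g x \<in> carrier G"
  by (simp add: conj_by_def)

lemma conj_by_mult:
  "g \<in> carrier G \<Longrightarrow> x \<in> carrier G \<Longrightarrow> y \<in> carrier G \<Longrightarrow> conj_by g (x \<otimes> y) = conj_by g x \<otimes> conj_by g y"
  by (simp add: conj_by_def m_assoc)

lemma conj_by_inv:
  "g \<in> carrier G \<Longrightarrow> x \<in> carrier G \<Longrightarrow> conj_by g (inv x) = inv (conj_by g x)"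
  by (simp add: conj_by_def m_assoc inv_mult_group)

lemma conj_by_one_right [simp]: "g \<in> carrier G \<Longrightarrow> conj_by g \<one> = \<one>"
  by (simp add: conj_by_def)

lemma conj_by_one_left [simp]: "x \<in> carrier G \<Longrightarrow> conj_by \<one> x = x"
  by (simp add: conj_by_def)

lemma conj_by_conj_by:
  "g \<in> carrier G \<Longrightarrow> h \<in> carrier G \<Longrightarrow> x \<in> carrier G \<Longrightarrow> conj_by g (conj_by h x) = conj_by (g \<otimes> h) x"
  by (simp add: conj_by_def m_assoc inv_mult_group)

lemma conj_by_cancel [simp]:
  "g \<in> carrier G \<Longrightarrow> x \<in> carrier G \<Longrightarrow> conj_by (inv g) (conj_by g x) = x"
  "g \<in> carrier G \<Longrightarrow> x \<in> carrier G \<Longrightarrow> conj_by g (conj_by (inv g) x) = x"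
  by (simp_all add: conj_by_conj_by)

lemma inj_on_conj_by: "g \<in> carrier G \<Longrightarrow> H \<subseteq> carrier G \<Longrightarrow> inj_on (conj_by g) H"
  by (rule inj_on_inverseI[where g = "conj_by (inv g)"]) auto

lemma card_conj_by: "g \<in> carrier G \<Longrightarrow> H \<subseteq> carrier G \<Longrightarrow> card (conj_by g ` H) = card H"
  by (simp add: card_image inj_on_conj_by)

lemma conj_by_image_cancel [simp]:
  assumes "g \<in> carrier G" "H \<subseteq> carrier G"
  shows "conj_by (inv g) ` conj_by g ` H = H" "conj_by g ` conj_by (inv g) ` H = H"
proof -
  have "conj_by (inv g) (conj_by g x) = x" "conj_by g (conj_by (inv g) x) = x" if "x \<in> H" for x
    using assms that by auto
  then show "conj_by (inv g) ` conj_by g ` H = H" "conj_by g ` conj_by (inv g) ` H = H"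
    by (auto simp: image_image)
qed

lemma conj_by_image_mult:
  assumes "g \<in> carrier G" "h \<in> carrier G" "H \<subseteq> carrier G"
  shows "conj_by g ` conj_by h ` H = conj_by (g \<otimes> h) ` H"
  using assms unfolding image_image by (intro image_cong refl) (auto simp: conj_by_conj_by)

lemma subgroup_conj_by:
  assumes g: "g \<in> carrier G" and H: "subgroup H G"
  shows "subgroup (conj_by g ` H) G"
proof (rule subgroupI)
  have sub: "H \<subseteq> carrier G" using H by (rule subgroup.subset)
  show "conj_by g ` H \<subseteq> carrier G" using g sub by auto
  show "conj_by g ` H \<noteq> {}" using subgroup.one_closed[OF H] by auto
  show "inv a \<in> conj_by g ` H" if "a \<in> conj_by g ` H" for a
    using that g sub subgroup.m_inv_closed[OF H] by (auto simp flip: conj_by_inv)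
  show "a \<otimes> b \<in> conj_by g ` H" if "a \<in> conj_by g ` H" "b \<in> conj_by g ` H" for a b
    using that g sub subgroup.m_closed[OF H] by (auto simp: subset_iff simp flip: conj_by_mult)
qed

lemma conj_by_subgroup_closed:
  assumes "subgroup H G" "g \<in> H" "x \<in> H"
  shows "conj_by g x \<in> H"
  using assms by (simp add: conj_by_def subgroup.m_closed subgroup.m_inv_closed)

end

context finite_group
begin

lemma finite_subgroup: "subgroup H G \<Longrightarrow> finite H"
  using fin finite_subset subgroup.subset by blast

lemma card_subgroup_pos: "subgroup H G \<Longrightarrow> card H > 0"
  using fin by (simp add: subgroup.finite_imp_card_positive)

lemma subgroup_eq_card: "subgroup H G \<Longrightarrow> K \<subseteq> H \<Longrightarrow> card H \<le> card K \<Longrightarrow> K = H"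
  by (simp add: finite_subgroup card_seteq)

lemma restrict_finite_group: "subgroup H G \<Longrightarrow> finite_group (G\<lparr>carrier := H\<rparr>)"
  by (simp add: finite_group_def finite_group_axioms_def finite_subgroup subgroup_imp_group)

lemma card_dvd:
  assumes "subgroup K G" "subgroup H G" "K \<subseteq> H"
  shows "card K dvd card H"
proof -
  interpret H: group "G\<lparr>carrier := H\<rparr>" using assms(2) by (rule subgroup_imp_group)
  have "subgroup K (G\<lparr>carrier := H\<rparr>)" using assms by (rule subgroup_incl)
  from H.lagrange[OF this] have "card H = card (rcosets\<^bsub>G\<lparr>carrier := H\<rparr>\<^esub> K) * card K"
    by (simp add: order_def)
  then show ?thesis by (rule ssubst) simp
qed

text \<open>
  By finiteness, a conjugate of \<open>H\<close> inside \<open>H\<close> is all of \<open>H\<close>, so one inclusion is enough.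
\<close>

lemma mem_normalizer_iff:
  assumes H: "subgroup H G"
  shows "g \<in> normalizer G H \<longleftrightarrow> g \<in> carrier G \<and> (\<forall>h\<in>H. conj_by g h \<in> H)"
proof -
  have sub: "H \<subseteq> carrier G" using H by (rule subgroup.subset)
  have img: "g <# H #> inv g = conj_by g ` H"
    by (auto simp: l_coset_def r_coset_def conj_by_def)
  have "conj_by g ` H = H \<longleftrightarrow> conj_by g ` H \<subseteq> H" if g: "g \<in> carrier G"
    using subgroup_eq_card[OF H, of "conj_by g ` H"] card_conj_by[OF g sub] by auto
  then show ?thesis
    using sub by (auto simp: normalizer_def stabilizer_def img)
qed

lemma subgroup_normalizer: "subgroup H G \<Longrightarrow> subgroup (normalizer G H) G"
  by (simp add: normalizer_imp_subgroup subgroup.subset)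

lemma subset_normalizer: "subgroup H G \<Longrightarrow> H \<subseteq> normalizer G H"
  by (auto simp: mem_normalizer_iff conj_by_subgroup_closed subgroup.mem_carrier)

lemma conj_by_normalizer:
  "subgroup H G \<Longrightarrow> g \<in> normalizer G H \<Longrightarrow> x \<in> H \<Longrightarrow> conj_by g x \<in> H"
  by (simp add: mem_normalizer_iff)

lemma conj_by_image_normalizer:
  "subgroup H G \<Longrightarrow> g \<in> normalizer G H \<Longrightarrow> conj_by g ` H = H"
  using subgroup_eq_card[of H "conj_by g ` H"] 
  by (metis card_conj_by image_subset_iff mem_normalizer_iff order_refl subgroup.subset)

lemma normal_iff_normalizer: "N \<lhd> G \<longleftrightarrow> subgroup N G \<and> normalizer G N = carrier G"
proof -
  have "normalizer G N = carrier G \<longleftrightarrow> (\<forall>x\<in>carrier G. \<forall>h\<in>N. x \<otimes> h \<otimes> inv x \<in> N)" if "subgroup N G"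
    using that by (auto simp: set_eq_iff mem_normalizer_iff conj_by_def)
  then show ?thesis by (auto simp: normal_inv_iff)
qed

lemma subgroup_restrict_iff:
  assumes K: "subgroup K G"
  shows "subgroup N (G\<lparr>carrier := K\<rparr>) \<longleftrightarrow> subgroup N G \<and> N \<subseteq> K"
proof
  assume N: "subgroup N (G\<lparr>carrier := K\<rparr>)"
  show "subgroup N G \<and> N \<subseteq> K" using incl_subgroup[OF K N] subgroup.subset[OF N] by simp
qed (simp add: K subgroup_incl)

lemma normal_in_iff_normalizer:
  assumes K: "subgroup K G"
  shows "N \<lhd> G\<lparr>carrier := K\<rparr> \<longleftrightarrow> subgroup N G \<and> N \<subseteq> K \<and> K \<subseteq> normalizer G N"
proof -
  interpret K: finite_group "G\<lparr>carrier := K\<rparr>" by (rule restrict_finite_group[OF K])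
  have sK: "K \<subseteq> carrier G" using K by (rule subgroup.subset)
  note 1 = subgroup_restrict_iff[OF K, of N]
  have "K \<subseteq> normalizer G N \<longleftrightarrow> (\<forall>x\<in>K. \<forall>h\<in>N. x \<otimes> h \<otimes> inv x \<in> N)" if "subgroup N G"
    using that sK by (auto simp: mem_normalizer_iff conj_by_def subset_iff)
  then show ?thesis using 1 K by (auto simp: K.normal_inv_iff)
qed

lemma subgroup_set_mult:
  assumes A: "subgroup A G" and B: "subgroup B G" and n: "B \<subseteq> normalizer G A"
  shows "subgroup (A <#> B) G"
proof -
  have sA: "A \<subseteq> carrier G" and sB: "B \<subseteq> carrier G" using A B by (auto dest: subgroup.subset)
  have mem: "x \<in> A <#> B \<longleftrightarrow> (\<exists>a\<in>A. \<exists>b\<in>B. x = a \<otimes> b)" for x by (auto simp: set_mult_def)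
  show ?thesis
  proof (rule subgroupI)
    show "A <#> B \<subseteq> carrier G" using sA sB by (simp add: setmult_subset_G)
    show "A <#> B \<noteq> {}" using subgroup.one_closed[OF A] subgroup.one_closed[OF B] by (auto simp: set_mult_def)
    show "inv x \<in> A <#> B" if x: "x \<in> A <#> B" for x
    proof -
      obtain a b where ab: "a \<in> A" "b \<in> B" "x = a \<otimes> b" using x mem by auto
      then have c: "a \<in> carrier G" "b \<in> carrier G" using sA sB by auto
      have "inv x = conj_by (inv b) (inv a) \<otimes> inv b" using ab(3) c
        by (simp add: conj_by_def inv_mult_group m_assoc)
      moreover have "conj_by (inv b) (inv a) \<in> A"
        using ab n A B by (meson conj_by_normalizer subgroup.m_inv_closed subsetD)
      moreover have "inv b \<in> B" using ab B by (auto intro!: subgroup.m_inv_closed)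
      ultimately show ?thesis using mem by auto
    qed
    show "x \<otimes> y \<in> A <#> B" if xy: "x \<in> A <#> B" "y \<in> A <#> B" for x y
    proof -
      obtain a b where ab: "a \<in> A" "b \<in> B" "x = a \<otimes> b" using xy mem by auto
      obtain a' b' where ab': "a' \<in> A" "b' \<in> B" "y = a' \<otimes> b'" using xy mem by auto
      have c: "a \<in> carrier G" "b \<in> carrier G" "a' \<in> carrier G" "b' \<in> carrier G"
        using ab ab' sA sB by auto
      have "x \<otimes> y = (a \<otimes> conj_by b a') \<otimes> (b \<otimes> b')" using ab(3) ab'(3) c
        by (simp add: conj_by_def m_assoc)
      moreover have "a \<otimes> conj_by b a' \<in> A"
        using ab ab' n A B by (meson conj_by_normalizer subgroup.m_closed subsetD)
      moreover have "b \<otimes> b' \<in> B" using ab ab' B by (auto intro!: subgroup.m_closed)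
      ultimately show ?thesis using mem by auto
    qed
  qed
qed

lemma subset_set_mult:
  assumes A: "subgroup A G" and B: "subgroup B G"
  shows "A \<subseteq> A <#> B" "B \<subseteq> A <#> B"
proof -
  show "A \<subseteq> A <#> B"
    using A B by (force simp: set_mult_def intro: subgroup.one_closed r_one[symmetric] subgroup.mem_carrier)
  show "B \<subseteq> A <#> B"
    using A B by (force simp: set_mult_def intro: subgroup.one_closed l_one[symmetric] subgroup.mem_carrier)
qed

lemma set_mult_subset:
  assumes "subgroup L G" "A \<subseteq> L" "B \<subseteq> L"
  shows "A <#> B \<subseteq> L"
  using assms by (auto simp: set_mult_def subgroup.m_closed subset_iff)

text \<open>
  The representations of one element as a product differ by an element of \<open>A \<inter> B\<close> moved from the
  first factor to the second.
\<close>

lemma card_set_mult: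
  assumes A: "subgroup A G" and B: "subgroup B G"
  shows "card (A <#> B) * card (A \<inter> B) = card A * card B"
proof -
  have sA: "A \<subseteq> carrier G" and sB: "B \<subseteq> carrier G" using A B by (auto dest: subgroup.subset)
  let ?f = "\<lambda>(a, b). a \<otimes> b"
  have fA: "finite A" "finite B" using A B by (auto simp: finite_subgroup)
  have img: "?f ` (A \<times> B) = A <#> B" by (auto simp: set_mult_def)
  have fibre: "card {z \<in> A \<times> B. ?f z = y} = card (A \<inter> B)" if y: "y \<in> A <#> B" for y
  proof -
    obtain a b where ab: "a \<in> A" "b \<in> B" "y = a \<otimes> b" using y by (auto simp: set_mult_def)
    have c: "a \<in> carrier G" "b \<in> carrier G" using ab sA sB by auto
    have k1: "inv (inv a \<otimes> a') \<otimes> b = b'" and k2: "inv a \<otimes> a' \<in> A \<inter> B"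
      if h: "a' \<in> A" "b' \<in> B" "a' \<otimes> b' = y" for a' b'
    proof -
      have c': "a' \<in> carrier G" "b' \<in> carrier G" using h sA sB by auto
      have e: "a \<otimes> b = a' \<otimes> b'" using h(3) ab(3) by simp
      show "inv (inv a \<otimes> a') \<otimes> b = b'" using c c' by (simp add: inv_mult_group m_assoc e)
      have "b = inv a \<otimes> (a' \<otimes> b')" using c by (simp flip: e)
      then have "b \<otimes> inv b' = inv a \<otimes> a'" using c c' by (simp add: m_assoc)
      then show "inv a \<otimes> a' \<in> A \<inter> B"
        using h ab A B by (metis IntI subgroup.m_closed subgroup.m_inv_closed)
    qed
    have "bij_betw (\<lambda>d. (a \<otimes> d, inv d \<otimes> b)) (A \<inter> B) {z \<in> A \<times> B. ?f z = y}"
    proof (rule bij_betw_byWitness[where f' = "\<lambda>(a', b'). inv a \<otimes> a'"])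
      show "\<forall>d\<in>A \<inter> B. (case (a \<otimes> d, inv d \<otimes> b) of (a', b') \<Rightarrow> inv a \<otimes> a') = d"
        using c sA by auto
      show "\<forall>z\<in>{z \<in> A \<times> B. ?f z = y}.
         (a \<otimes> (case z of (a', b') \<Rightarrow> inv a \<otimes> a'), inv (case z of (a', b') \<Rightarrow> inv a \<otimes> a') \<otimes> b) = z"
        using c sA by (auto simp: k1 subset_iff)
      show "(\<lambda>d. (a \<otimes> d, inv d \<otimes> b)) ` (A \<inter> B) \<subseteq> {z \<in> A \<times> B. ?f z = y}"
        using ab c sA A B by (auto simp: m_assoc subgroup.m_closed subgroup.m_inv_closed subset_iff)
      show "(\<lambda>(a', b'). inv a \<otimes> a') ` {z \<in> A \<times> B. ?f z = y} \<subseteq> A \<inter> B"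
        using k2 by auto
    qed
    then show ?thesis by (simp add: bij_betw_same_card)
  qed
  have "card (A \<times> B) = (\<Sum>y\<in>A <#> B. card {z \<in> A \<times> B. ?f z = y})"
    using sum.group[of "A \<times> B" "A <#> B" ?f "\<lambda>_. 1::nat"] fA
    by (simp add: img[symmetric])
  also have "\<dots> = card (A <#> B) * card (A \<inter> B)" by (simp add: fibre)
  finally show ?thesis by (simp add: card_cartesian_product)
qed

end

section \<open>Sylow subgroups of subgroups\<close>

text \<open>
  The length of an orbit divides the order of the group. Without a fixed point every orbit of a
  \<open>p\<close>-group, and with it the whole set, has size divisible by \<open>p\<close>.
\<close>

lemma (in group) p_group_fixed_point:
  fixes f :: "'a \<Rightarrow> 'x \<Rightarrow> 'x"
  assumes R: "subgroup R G" and p: "Factorial_Ring.prime p" and cR: "card R = p ^ k" and fX: "finite \<Omega>"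
    and cl: "\<And>r x. r \<in> R \<Longrightarrow> x \<in> \<Omega> \<Longrightarrow> f r x \<in> \<Omega>"
    and one: "\<And>x. x \<in> \<Omega> \<Longrightarrow> f \<one> x = x"
    and mult: "\<And>r s x. r \<in> R \<Longrightarrow> s \<in> R \<Longrightarrow> x \<in> \<Omega> \<Longrightarrow> f (r \<otimes> s) x = f r (f s x)"
    and nd: "\<not> p dvd card \<Omega>"
  shows "\<exists>x\<in>\<Omega>. \<forall>r\<in>R. f r x = x"
proof (rule ccontr)
  assume contra: "\<not> ?thesis"
  define \<phi> where "\<phi> r = (\<lambda>x\<in>\<Omega>. f r x)" for r
  let ?R = "G\<lparr>carrier := R\<rparr>"
  have inv: "f (inv r) (f r x) = x" "f r (f (inv r) x) = x" if "r \<in> R" "x \<in> \<Omega>" for r x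
    using that R one mult[of "inv r" r x] mult[of r "inv r" x]
    by (simp_all add: subgroup.m_inv_closed subgroup.mem_carrier)
  have bij: "\<phi> r \<in> Bij \<Omega>" if "r \<in> R" for r
  proof -
    have "bij_betw (f r) \<Omega> \<Omega>"
      using that inv cl R by (intro bij_betw_byWitness[where f' = "f (inv r)"]) (auto simp: subgroup.m_inv_closed)
    then have "bij_betw (\<phi> r) \<Omega> \<Omega>" unfolding \<phi>_def by (subst bij_betw_cong[where g = "f r"]) auto
    then show ?thesis by (simp add: Bij_def \<phi>_def)
  qed
  have "group_hom ?R (BijGroup \<Omega>) \<phi>"
  proof (rule group_hom.intro)
    show "group ?R" using R by (rule subgroup_imp_group)
    show "group (BijGroup \<Omega>)" by (rule group_BijGroup)
    show "group_hom_axioms ?R (BijGroup \<Omega>) \<phi>"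
    proof
      show "\<phi> \<in> hom ?R (BijGroup \<Omega>)"
      proof (rule homI)
        show "\<phi> r \<in> carrier (BijGroup \<Omega>)" if "r \<in> carrier ?R" for r
          using that bij by (simp add: BijGroup_def)
        show "\<phi> (r \<otimes>\<^bsub>?R\<^esub> s) = \<phi> r \<otimes>\<^bsub>BijGroup \<Omega>\<^esub> \<phi> s" if "r \<in> carrier ?R" "s \<in> carrier ?R" for r s
          using that bij cl mult by (auto simp: BijGroup_def \<phi>_def compose_def restrict_def fun_eq_iff)
      qed
    qed
  qed
  then interpret act: group_action ?R \<Omega> \<phi> by (rule group_action.intro)
  have orbit_div: "p dvd card W" if W: "W \<in> orbits ?R \<Omega> \<phi>" for W
  proof -
    obtain x where x: "x \<in> \<Omega>" "W = orbit ?R \<phi> x" using W by (auto simp: orbits_def)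
    have "card W * card (stabilizer ?R \<phi> x) = p ^ k"
      using act.orbit_stabilizer_theorem[OF x(1)] x(2) cR by (simp add: order_def)
    then have "card W dvd p ^ k" by (metis dvd_triv_left)
    then obtain i where i: "card W = p ^ i" using p divides_primepow_nat by blast
    have "i \<noteq> 0"
    proof
      assume "i = 0"
      then have "card W = 1" using i by simp
      moreover have "x \<in> W" using x one R by (auto simp: orbit_def \<phi>_def intro!: exI[of _ \<one>] subgroup.one_closed)
      ultimately have "W = {x}" by (metis card_1_singletonE singletonD)
      then have "\<forall>r\<in>R. f r x = x" using x by (auto simp: orbit_def \<phi>_def)
      then show False using contra x by auto
    qed
    then show ?thesis using i by simp
  qed
  have "card \<Omega> = (\<Sum>W\<in>orbits ?R \<Omega> \<phi>. card W)"
    using act.disjoint_sum[OF fX, of "\<lambda>_. 1::nat"] by simp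
  then have "p dvd card \<Omega>" using orbit_div by (simp add: dvd_sum)
  then show False using nd by simp
qed

lemma multiplicity_split:
  fixes n :: nat
  assumes "Factorial_Ring.prime p" "n > 0"
  obtains m where "n = p ^ multiplicity p n * m" "\<not> p dvd m"
  using multiplicity_decompose'[of n p] assms by (metis mult.commute neq0_conv not_prime_unit)

lemma nat_dvdI_prime_powers:
  fixes a b :: nat
  assumes "a > 0" "b > 0" "\<And>p. Factorial_Ring.prime p \<Longrightarrow> p ^ multiplicity p a dvd b"
  shows "a dvd b"
proof (rule multiplicity_le_imp_dvd)
  show "multiplicity p a \<le> multiplicity p b" if "Factorial_Ring.prime p" for p
    using assms(2) assms(3)[OF that] that by (intro multiplicity_geI) auto
qed (use assms in auto)

lemma prime_power_dvd_of_dvd_mult: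
  fixes n m :: nat
  assumes p: "Factorial_Ring.prime p" and q: "Factorial_Ring.prime q" "q \<noteq> p" and d: "n dvd p ^ k * m"
  shows "q ^ multiplicity q n dvd m"
proof -
  have "q ^ multiplicity q n dvd p ^ k * m" using d multiplicity_dvd dvd_trans by blast
  moreover have "coprime (q ^ multiplicity q n) (p ^ k)" using p q by (simp add: primes_coprime)
  ultimately show ?thesis by (simp add: coprime_dvd_mult_right_iff)
qed

context finite_group
begin

text \<open>
  In contrast to \<^const>\<open>sylow_subgroup\<close>, the reference group is a subgroup \<open>H\<close> of \<open>G\<close>, the prime is
  visible, and it may fail to divide the order of \<open>H\<close>, in which case \<open>S\<close> is trivial. So one can
  quantify over all primes.
\<close>

definition p_sylow :: "nat \<Rightarrow> 'a set \<Rightarrow> 'a set \<Rightarrow> bool" where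
  "p_sylow p S H \<longleftrightarrow> subgroup S G \<and> S \<subseteq> H \<and> card S = p ^ multiplicity p (card H)"

lemma p_sylowD:
  assumes "p_sylow p S H"
  shows "subgroup S G" "S \<subseteq> H" "card S = p ^ multiplicity p (card H)"
  using assms by (auto simp: p_sylow_def)

lemma p_sylow_exists:
  assumes H: "subgroup H G" and p: "Factorial_Ring.prime p"
  shows "\<exists>S. p_sylow p S H"
proof -
  obtain m where m: "card H = p ^ multiplicity p (card H) * m"
    using multiplicity_split[OF p card_subgroup_pos[OF H]] by blast
  have "\<exists>S. subgroup S (G\<lparr>carrier := H\<rparr>) \<and> card S = p ^ multiplicity p (card H)"
    using p m H by (intro sylow_thm[of p _ _ m]) (auto simp: subgroup_imp_group order_def finite_subgroup)
  then show ?thesis using H by (auto simp: p_sylow_def subgroup_restrict_iff)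
qed

text \<open>
  Sylow's conjugacy theorem: the number of cosets \<open>Sh\<close> in \<open>H\<close> is prime to \<open>p\<close>, so \<open>R\<close>, acting by right
  multiplication, fixes one of them, and that \<open>h\<close> conjugates \<open>R\<close> into \<open>S\<close>.
\<close>

lemma p_subgroup_conj_into:
  assumes H: "subgroup H G" and p: "Factorial_Ring.prime p" and S: "p_sylow p S H"
    and R: "subgroup R G" "R \<subseteq> H" "card R = p ^ k"
  shows "\<exists>h\<in>H. conj_by h ` R \<subseteq> S"
proof -
  note sS = p_sylowD[OF S]
  have cH: "H \<subseteq> carrier G" and cS: "S \<subseteq> carrier G" and cR: "R \<subseteq> carrier G"
    using H sS(1) R(1) by (auto dest: subgroup.subset)
  interpret H: group "G\<lparr>carrier := H\<rparr>" using H by (rule subgroup_imp_group)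
  define \<Omega> where "\<Omega> = (\<lambda>h. S #> h) ` H"
  have SH: "subgroup S (G\<lparr>carrier := H\<rparr>)" using sS H by (simp add: subgroup_incl)
  have "rcosets\<^bsub>G\<lparr>carrier := H\<rparr>\<^esub> S = \<Omega>" by (auto simp: RCOSETS_def \<Omega>_def)
  then have cX: "card \<Omega> * card S = card H" using H.lagrange[OF SH] by (simp add: order_def)
  obtain m where m: "card H = card S * m" "\<not> p dvd m"
    using multiplicity_split[OF p card_subgroup_pos[OF H]] sS(3) by metis
  have "card \<Omega> = m" using cX m card_subgroup_pos[OF sS(1)] by (simp add: mult.commute)
  then have nd: "\<not> p dvd card \<Omega>" using m by simp
  have "\<exists>Y\<in>\<Omega>. \<forall>r\<in>R. Y #> inv r = Y"
  proof (rule p_group_fixed_point[OF R(1) p R(3) _ _ _ _ nd])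
    show "finite \<Omega>" using H by (simp add: \<Omega>_def finite_subgroup)
    have YC: "Y \<subseteq> carrier G" if "Y \<in> \<Omega>" for Y using that cS cH by (auto simp: \<Omega>_def r_coset_def)
    show "Y #> inv r \<in> \<Omega>" if rY: "r \<in> R" "Y \<in> \<Omega>" for r Y
    proof -
      obtain h where h: "h \<in> H" "Y = S #> h" using rY by (auto simp: \<Omega>_def)
      have "Y #> inv r = S #> (h \<otimes> inv r)" using h that cS cH cR by (simp add: coset_mult_assoc subset_iff)
      moreover have "h \<otimes> inv r \<in> H" using h that R(2) H by (meson subgroup.m_closed subgroup.m_inv_closed subsetD)
      ultimately show ?thesis by (auto simp: \<Omega>_def)
    qed
    show "Y #> inv \<one> = Y" if "Y \<in> \<Omega>" for Y using YC[OF that] by simp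
    show "Y #> inv (r \<otimes> s) = Y #> inv s #> inv r" if "r \<in> R" "s \<in> R" "Y \<in> \<Omega>" for r s Y
      using that YC[OF that(3)] cR by (simp add: coset_mult_assoc inv_mult_group subset_iff)
  qed
  then obtain h where h: "h \<in> H" "\<And>r. r \<in> R \<Longrightarrow> S #> h #> inv r = S #> h" by (auto simp: \<Omega>_def)
  have "conj_by h r \<in> S" if r: "r \<in> R" for r
  proof -
    have c: "h \<in> carrier G" "r \<in> carrier G" using h r cH cR by auto
    have "S #> h #> r = S #> h" using h(2)[of "inv r"] r R(1) c by (simp add: subgroup.m_inv_closed)
    then have "h \<otimes> r \<in> S #> h" using c cS rcos_self[OF _ sS(1), of "h \<otimes> r"] by (simp add: coset_mult_assoc)
    then obtain s where "s \<in> S" "h \<otimes> r = s \<otimes> h" by (auto simp: r_coset_def)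
    then show ?thesis using c cS by (auto simp: conj_by_def m_assoc subset_iff)
  qed
  then show ?thesis using h(1) by auto
qed

text \<open>
  The Frattini argument: an element normalizing \<open>K\<close> sends \<open>S\<close> to another Sylow subgroup of \<open>K\<close>, so up to
  a factor in \<open>K\<close> it normalizes \<open>S\<close>. Instead of a product of \<open>K\<close> with the normalizer of \<open>S\<close> there is a
  subgroup \<open>L\<close> above both: for \<open>L = K\<close> this says that \<open>K\<close> is self-normalizing, and for normal \<open>K\<close>
  that \<open>L\<close> is the whole group.
\<close>

lemma frattini:
  assumes K: "subgroup K G" and p: "Factorial_Ring.prime p" and S: "p_sylow p S K"
    and L: "subgroup L G" "K \<subseteq> L" "normalizer G S \<subseteq> L"
  shows "normalizer G K \<subseteq> L"
proof
  fix g assume g: "g \<in> normalizer G K"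
  note sS = p_sylowD[OF S]
  have cg: "g \<in> carrier G" using g K by (simp add: mem_normalizer_iff)
  have cS: "S \<subseteq> carrier G" using sS(1) by (rule subgroup.subset)
  have "conj_by g ` S \<subseteq> K" using g K sS(2) by (auto simp: mem_normalizer_iff)
  then obtain k where k: "k \<in> K" "conj_by k ` conj_by g ` S \<subseteq> S"
    using p_subgroup_conj_into[OF K p S subgroup_conj_by[OF cg sS(1)], of "multiplicity p (card K)"]
    by (auto simp: card_conj_by[OF cg cS] sS(3))
  have ck: "k \<in> carrier G" using k K by (simp add: subgroup.mem_carrier)
  have "conj_by (k \<otimes> g) ` S \<subseteq> S" using k(2) by (simp add: conj_by_image_mult ck cg cS)
  then have "k \<otimes> g \<in> normalizer G S" using ck cg sS(1) by (auto simp: mem_normalizer_iff)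
  then have "k \<otimes> g \<in> L" using L by auto
  moreover have "inv k \<in> L" using k L(1,2) by (auto intro: subgroup.m_inv_closed)
  ultimately have "inv k \<otimes> (k \<otimes> g) \<in> L" using L(1) by (simp add: subgroup.m_closed)
  then show "g \<in> L" using ck cg by simp
qed

lemma p_subgroup_subset_normal_sylow:
  assumes H: "subgroup H G" and p: "Factorial_Ring.prime p" and S: "p_sylow p S H" "H \<subseteq> normalizer G S"
    and R: "subgroup R G" "R \<subseteq> H" "card R = p ^ k"
  shows "R \<subseteq> S"
proof
  fix r assume r: "r \<in> R"
  obtain h where h: "h \<in> H" "conj_by h ` R \<subseteq> S" using p_subgroup_conj_into[OF H p S(1) R] by auto
  have "inv h \<in> normalizer G S" using h S(2) H by (auto intro: subgroup.m_inv_closed)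
  moreover have "conj_by h r \<in> S" using h r by auto
  ultimately have "conj_by (inv h) (conj_by h r) \<in> S"
    using p_sylowD(1)[OF S(1)] by (simp add: mem_normalizer_iff)
  then show "r \<in> S" using h r H R(1) by (simp add: subgroup.mem_carrier)
qed

lemma p_sylow_mono:
  assumes "subgroup H G" "subgroup K G" "H \<subseteq> K" "p_sylow p S K" "S \<subseteq> H" and p: "Factorial_Ring.prime p"
  shows "p_sylow p S H"
proof -
  have "multiplicity p (card H) \<le> multiplicity p (card K)"
    using assms by (intro dvd_imp_multiplicity_le card_dvd) (auto dest: card_subgroup_pos)
  moreover have "multiplicity p (card K) \<le> multiplicity p (card H)"
    using card_dvd[of S H] assms card_subgroup_pos[of H] by (intro multiplicity_geI) (auto simp: p_sylow_def)
  ultimately show ?thesis using assms by (simp add: p_sylow_def)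
qed

lemma p_subgroup_card:
  assumes p: "Factorial_Ring.prime p" and S: "subgroup S G" "card S = p ^ k" and R: "subgroup R G" "R \<subseteq> S"
  obtains i where "card R = p ^ i"
proof -
  have "card R dvd p ^ k" using card_dvd[OF R(1) S(1) R(2)] S(2) by simp
  then have "\<exists>i\<le>k. card R = p ^ i" using divides_primepow_nat[OF p] by blast
  then show thesis using that by blast
qed

lemma subgroup_eqI_prime_powers:
  assumes L: "subgroup L G" and H: "subgroup H G" "L \<subseteq> H"
    and d: "\<And>p. Factorial_Ring.prime p \<Longrightarrow> p ^ multiplicity p (card H) dvd card L"
  shows "L = H"
proof -
  have "card H dvd card L" by (rule nat_dvdI_prime_powers[OF card_subgroup_pos[OF H(1)] card_subgroup_pos[OF L] d])
  then have "card H \<le> card L" using L by (simp add: dvd_imp_le card_subgroup_pos)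
  then show ?thesis using H by (simp add: subgroup_eq_card)
qed

section \<open>Nilpotency means that the Sylow subgroups are normal\<close>

abbreviation nilpotent :: "'a set \<Rightarrow> bool" where
  "nilpotent H \<equiv> nilpotent_group (G\<lparr>carrier := H\<rparr>)"

lemma subgroup_lower_central_series: "subgroup (lower_central_series G n) G"
proof (induction n)
  case 0
  show ?case by (simp add: subgroup_self)
next
  case (Suc n)
  have "(\<Union>h\<in>lower_central_series G n. \<Union>k\<in>carrier G. {h \<otimes> k \<otimes> inv h \<otimes> inv k}) \<subseteq> carrier G"
    using subgroup.subset[OF Suc] by auto
  then show ?case by (simp add: commutator_subgroup_def generate_is_subgroup)
qed

lemma commutator_in_lower_central_series:
  assumes "h \<in> lower_central_series G n" "k \<in> carrier G"
  shows "h \<otimes> k \<otimes> inv h \<otimes> inv k \<in> lower_central_series G (Suc n)"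
  using assms unfolding lower_central_series.simps commutator_subgroup_def
  by (intro generate.incl) auto

text \<open>
  Let \<open>n\<close> be the first index at which the lower central series has entered \<open>K\<close>. The term before it does
  not lie in \<open>K\<close>, but its commutators with elements of \<open>K\<close> do, so it normalizes \<open>K\<close>.
\<close>

lemma nilpotent_normalizer_grows:
  assumes nil: "nilpotent_group G" and K: "subgroup K G" "K \<noteq> carrier G"
  shows "\<exists>x\<in>carrier G - K. x \<in> normalizer G K"
proof -
  have "\<exists>n. lower_central_series G n \<subseteq> K"
    using nil subgroup.one_closed[OF K(1)] by (metis nilpotent_group_def empty_subsetI insert_subset)
  define n where "n = (LEAST n. lower_central_series G n \<subseteq> K)"
  have n: "lower_central_series G n \<subseteq> K" unfolding n_def by (rule LeastI_ex) fact
  have "n \<noteq> 0" using n K subgroup.subset by fastforce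
  then obtain m where m: "n = Suc m" using not0_implies_Suc by blast
  have "\<not> lower_central_series G m \<subseteq> K" using m not_less_Least[of m "\<lambda>n. lower_central_series G n \<subseteq> K"] n_def by simp
  then obtain x where x: "x \<in> lower_central_series G m" "x \<notin> K" by auto
  have cx: "x \<in> carrier G" using x subgroup.mem_carrier[OF subgroup_lower_central_series] by blast
  have "conj_by x k \<in> K" if k: "k \<in> K" for k
  proof -
    have ck: "k \<in> carrier G" using k K by (meson subgroup.mem_carrier)
    have "x \<otimes> k \<otimes> inv x \<otimes> inv k \<in> K"
      using commutator_in_lower_central_series[OF x(1) ck] n m by auto
    then have "x \<otimes> k \<otimes> inv x \<otimes> inv k \<otimes> k \<in> K" using k by (rule subgroup.m_closed[OF K(1)])
    then show ?thesis using ck cx by (simp add: conj_by_def m_assoc)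
  qed
  then have "x \<in> normalizer G K" using cx K(1) by (simp add: mem_normalizer_iff)
  then show ?thesis using cx x by auto
qed

text \<open>
  By the Frattini argument the normalizer of a Sylow subgroup is self-normalizing, which in a
  nilpotent group only the whole group is.
\<close>

lemma nilpotent_imp_sylow_normal:
  assumes nil: "nilpotent_group G" and p: "Factorial_Ring.prime p" and S: "p_sylow p S (carrier G)"
  shows "normalizer G S = carrier G"
proof (rule ccontr)
  let ?N = "normalizer G S"
  assume "?N \<noteq> carrier G"
  moreover note sS = p_sylowD[OF S]
  have N: "subgroup ?N G" by (rule subgroup_normalizer[OF sS(1)])
  ultimately obtain x where x: "x \<notin> ?N" "x \<in> normalizer G ?N"
    using nilpotent_normalizer_grows[OF nil N] by auto
  have "p_sylow p S ?N"
    using p_sylow_mono[OF N subgroup_self _ S _ p] subgroup.subset[OF N] subset_normalizer[OF sS(1)] by auto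
  then have "normalizer G ?N \<subseteq> ?N" by (rule frattini[OF N p]) (auto simp: N)
  then show False using x by auto
qed

lemma commute_if_normalize:
  assumes A: "subgroup A G" and B: "subgroup B G" and n: "A \<subseteq> normalizer G B" "B \<subseteq> normalizer G A"
    and AB: "A \<inter> B = {\<one>}" and ab: "a \<in> A" "b \<in> B"
  shows "conj_by a b = b"
proof -
  have c: "a \<in> carrier G" "b \<in> carrier G" using ab A B by (auto intro: subgroup.mem_carrier)
  have "conj_by a b \<otimes> inv b \<in> B" using ab n A B
    by (meson conj_by_normalizer subgroup.m_closed subgroup.m_inv_closed subsetD)
  moreover have "a \<otimes> conj_by b (inv a) \<in> A" using ab n A B
    by (meson conj_by_normalizer subgroup.m_closed subgroup.m_inv_closed subsetD)
  moreover have "a \<otimes> conj_by b (inv a) = conj_by a b \<otimes> inv b" using c by (simp add: conj_by_def m_assoc)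
  ultimately have "conj_by a b \<otimes> inv b = \<one>" using AB by (metis IntI singletonD)
  then show ?thesis using c by (metis conj_by_closed inv_equality inv_inv inv_closed)
qed

lemma coprime_Int:
  assumes A: "subgroup A G" and B: "subgroup B G" and c: "coprime (card A) (card B)"
  shows "A \<inter> B = {\<one>}"
proof -
  have AB: "subgroup (A \<inter> B) G" using A B by (rule subgroups_Inter_pair)
  have "card (A \<inter> B) dvd card A" "card (A \<inter> B) dvd card B"
    using AB A B by (auto intro: card_dvd)
  then have "card (A \<inter> B) = 1" using c by (metis coprime_common_divisor_nat coprime_def nat_dvd_1_iff_1)
  then show ?thesis using subgroup.one_closed[OF AB] by (metis card_1_singletonE singletonD)
qed

text \<open>
  This is the preimage in \<open>G\<close> of the centralizer of the coset of \<open>x\<close> in \<open>G/M\<close>. For trivial \<open>M\<close> it is the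
  centralizer of \<open>x\<close>.
\<close>

lemma subgroup_commuting_modulo:
  assumes M: "subgroup M G" "normalizer G M = carrier G" and x: "x \<in> carrier G"
  shows "subgroup {g \<in> carrier G. conj_by g x \<otimes> inv x \<in> M} G" (is "subgroup ?C G")
proof (rule subgroupI)
  have Mn: "conj_by g m \<in> M" if "g \<in> carrier G" "m \<in> M" for g m
    using that M by (auto intro: conj_by_normalizer)
  show "?C \<subseteq> carrier G" by auto
  have "\<one> \<in> ?C" using x M by (simp add: subgroup.one_closed)
  then show "?C \<noteq> {}" by blast
  show "inv g \<in> ?C" if "g \<in> ?C" for g
  proof -
    have g: "g \<in> carrier G" "conj_by g x \<otimes> inv x \<in> M" using that by auto
    have "conj_by (inv g) (inv (conj_by g x \<otimes> inv x)) \<in> M"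
      using g M(1) by (intro Mn subgroup.m_inv_closed[OF M(1)]) auto
    moreover have "conj_by (inv g) (inv (conj_by g x \<otimes> inv x)) = conj_by (inv g) x \<otimes> inv x"
      using g x by (simp add: conj_by_def inv_mult_group m_assoc)
    ultimately show ?thesis using g by simp
  qed
  show "g \<otimes> h \<in> ?C" if "g \<in> ?C" "h \<in> ?C" for g h
  proof -
    have g: "g \<in> carrier G" "conj_by g x \<otimes> inv x \<in> M" and h: "h \<in> carrier G" "conj_by h x \<otimes> inv x \<in> M"
      using that by auto
    have "conj_by g (conj_by h x \<otimes> inv x) \<otimes> (conj_by g x \<otimes> inv x) \<in> M"
      using g h by - (rule subgroup.m_closed[OF M(1) Mn], auto)
    moreover have "conj_by g (conj_by h x \<otimes> inv x) \<otimes> (conj_by g x \<otimes> inv x) = conj_by (g \<otimes> h) x \<otimes> inv x"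
      using g h x by (simp add: conj_by_def inv_mult_group m_assoc)
    ultimately show ?thesis using g h by simp
  qed
qed

text \<open>
  \<open>C\<close> is the preimage in \<open>G\<close> of the centre of \<open>G/M\<close>.
\<close>

lemma subgroup_central_modulo:
  assumes M: "subgroup M G" "normalizer G M = carrier G"
  defines "C \<equiv> {x \<in> carrier G. \<forall>g\<in>carrier G. conj_by g x \<otimes> inv x \<in> M}"
  shows "subgroup C G" "normalizer G C = carrier G" "M \<subseteq> C"
proof -
  have Mn: "conj_by g m \<in> M" if "g \<in> carrier G" "m \<in> M" for g m
    using that M by (auto intro: conj_by_normalizer)
  have Mc: "m \<in> carrier G" if "m \<in> M" for m using that M by (auto intro: subgroup.mem_carrier)
  show C: "subgroup C G"
  proof (rule subgroupI)
    show "C \<subseteq> carrier G" by (auto simp: C_def)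
    have "\<one> \<in> C" using M by (simp add: C_def subgroup.one_closed)
    then show "C \<noteq> {}" by blast
    show "inv x \<in> C" if "x \<in> C" for x
    proof -
      have x: "x \<in> carrier G" using that by (auto simp: C_def)
      have "conj_by g (inv x) \<otimes> inv (inv x) \<in> M" if g: "g \<in> carrier G" for g
      proof -
        have "conj_by (inv x) (inv (conj_by g x \<otimes> inv x)) \<in> M"
          using g x \<open>x \<in> C\<close> by (intro Mn subgroup.m_inv_closed[OF M(1)]) (auto simp: C_def)
        moreover have "conj_by (inv x) (inv (conj_by g x \<otimes> inv x)) = conj_by g (inv x) \<otimes> inv (inv x)"
          using g x by (simp add: conj_by_def inv_mult_group m_assoc)
        ultimately show ?thesis by simp
      qed
      then show ?thesis using x by (simp add: C_def)
    qed
    show "x \<otimes> y \<in> C" if xy: "x \<in> C" "y \<in> C" for x y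
    proof -
      have x: "x \<in> carrier G" "y \<in> carrier G" using xy by (auto simp: C_def)
      have "conj_by g (x \<otimes> y) \<otimes> inv (x \<otimes> y) \<in> M" if g: "g \<in> carrier G" for g
      proof -
        have "(conj_by g x \<otimes> inv x) \<otimes> conj_by x (conj_by g y \<otimes> inv y) \<in> M"
          using g x xy by - (rule subgroup.m_closed[OF M(1) _ Mn], auto simp: C_def)
        moreover have "(conj_by g x \<otimes> inv x) \<otimes> conj_by x (conj_by g y \<otimes> inv y) = conj_by g (x \<otimes> y) \<otimes> inv (x \<otimes> y)"
          using g x by (simp add: conj_by_def inv_mult_group m_assoc)
        ultimately show ?thesis by simp
      qed
      then show ?thesis using x by (simp add: C_def)
    qed
  qed
  have "conj_by h x \<in> C" if h: "h \<in> carrier G" and x: "x \<in> C" for h x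
  proof -
    have cx: "x \<in> carrier G" using x by (auto simp: C_def)
    have "conj_by g (conj_by h x) \<otimes> inv (conj_by h x) \<in> M" if g: "g \<in> carrier G" for g
    proof -
      have "(conj_by (g \<otimes> h) x \<otimes> inv x) \<otimes> inv (conj_by h x \<otimes> inv x) \<in> M"
        using g h x by - (rule subgroup.m_closed[OF M(1) _ subgroup.m_inv_closed[OF M(1)]], auto simp: C_def)
      moreover have "(conj_by (g \<otimes> h) x \<otimes> inv x) \<otimes> inv (conj_by h x \<otimes> inv x) =
          conj_by g (conj_by h x) \<otimes> inv (conj_by h x)"
        using g h cx by (simp add: conj_by_def inv_mult_group m_assoc)
      ultimately show ?thesis by simp
    qed
    then show ?thesis using h cx by (simp add: C_def)
  qed
  then show "normalizer G C = carrier G" using C by (auto simp: mem_normalizer_iff)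
  show "M \<subseteq> C" using M Mc Mn by (auto simp: C_def subgroup.m_closed subgroup.m_inv_closed)
qed


text \<open>
  The centre of \<open>G/M\<close> is not trivial. Choose a prime \<open>p\<close> dividing the index of \<open>M\<close>, with Sylow subgroup
  \<open>P\<close>. The number of cosets of \<open>M\<close> in \<open>MP\<close> is a power of \<open>p\<close> greater than 1, so the number of cosets other
  than \<open>M\<close> is prime to \<open>p\<close>, and \<open>P\<close> fixes one of these under conjugation. It commutes modulo \<open>M\<close> with
  \<open>P\<close>, and with the other Sylow subgroups because, being normal of coprime order, they centralize \<open>P\<close>.
\<close>

lemma exists_central_modulo:
  assumes syl: "\<And>p S. Factorial_Ring.prime p \<Longrightarrow> p_sylow p S (carrier G) \<Longrightarrow> normalizer G S = carrier G"
    and M: "subgroup M G" "normalizer G M = carrier G" "M \<noteq> carrier G"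
  shows "\<exists>x\<in>carrier G - M. \<forall>g\<in>carrier G. conj_by g x \<otimes> inv x \<in> M"
proof -
  note cM = subgroup.subset[OF M(1)]
  have Mn: "conj_by g m \<in> M" if "g \<in> carrier G" "m \<in> M" for g m
    using that M by (auto intro: conj_by_normalizer)
  obtain p where p: "Factorial_Ring.prime p" "\<not> p ^ multiplicity p (order G) dvd card M"
    using subgroup_eqI_prime_powers[OF M(1) subgroup_self cM] M(3) by (auto simp: order_def)
  obtain P where P: "p_sylow p P (carrier G)" using p_sylow_exists[OF subgroup_self p(1)] by auto
  note sP = p_sylowD[OF P] and nP = syl[OF p(1) P]
  have PM: "\<not> P \<subseteq> M" using p(2) sP card_dvd[OF sP(1) M(1)] by (auto simp: order_def)
  have MP: "subgroup (M <#> P) G" using subgroup_set_mult[OF M(1) sP(1)] M(2) sP(2) by simp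
  define \<Omega>0 where "\<Omega>0 = (\<lambda>x. M #> x) ` P"
  define \<Omega> where "\<Omega> = \<Omega>0 - {M}"
  have fin0: "finite \<Omega>0" using sP(1) by (simp add: \<Omega>0_def finite_subgroup)
  interpret MP: group "G\<lparr>carrier := M <#> P\<rparr>" using MP by (rule subgroup_imp_group)
  have "rcosets\<^bsub>G\<lparr>carrier := M <#> P\<rparr>\<^esub> M = \<Omega>0"
  proof -
    have "M #> (m \<otimes> x) = M #> x" if "m \<in> M" "x \<in> P" for m x
    proof -
      have "m \<in> carrier G" "x \<in> carrier G" using that cM sP(2) by auto
      then show ?thesis using that M(1) cM by (metis coset_join2 coset_mult_assoc)
    qed
    moreover have "x \<in> M <#> P" if "x \<in> P" for x using subset_set_mult[OF M(1) sP(1)] that by auto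
    ultimately show ?thesis by (auto simp: RCOSETS_def \<Omega>0_def set_mult_def)
  qed
  moreover have "subgroup M (G\<lparr>carrier := M <#> P\<rparr>)"
    using M(1) MP subset_set_mult[OF M(1) sP(1)] by (simp add: subgroup_incl)
  ultimately have "card \<Omega>0 * card M = card (M <#> P)" using MP.lagrange[of M] by (simp add: order_def)
  then have "card \<Omega>0 * card M * card (M \<inter> P) = card M * card P"
    using card_set_mult[OF M(1) sP(1)] by simp
  then have "card M * (card \<Omega>0 * card (M \<inter> P)) = card M * card P" by (simp only: mult_ac)
  then have "card \<Omega>0 * card (M \<inter> P) = p ^ multiplicity p (order G)"
    using card_subgroup_pos[OF M(1)] sP(3) by (simp add: order_def)
  then have "card \<Omega>0 dvd p ^ multiplicity p (order G)" by (metis dvd_triv_left)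
  then obtain i where i: "card \<Omega>0 = p ^ i" using divides_primepow_nat[OF p(1)] by blast
  have M0: "M \<in> \<Omega>0" using sP(1) cM by (auto simp: \<Omega>0_def subgroup.one_closed intro!: image_eqI[of _ _ \<one>])
  obtain x0 where x0: "x0 \<in> P" "x0 \<notin> M" using PM by auto
  have "M #> x0 \<noteq> M" using x0 sP(2) rcos_self[OF _ M(1), of x0] by auto
  then have "{M, M #> x0} \<subseteq> \<Omega>0" "card {M, M #> x0} = 2" using M0 x0 by (auto simp: \<Omega>0_def)
  then have "card \<Omega>0 \<ge> 2" using card_mono[OF fin0] by metis
  then have "i \<noteq> 0" using i by (metis power_0 one_le_numeral numeral_le_one_iff semiring_norm(69))
  then have "p dvd card \<Omega>0" using i by simp
  moreover have "card \<Omega>0 = Suc (card \<Omega>)" unfolding \<Omega>_def using M0 fin0 by (rule card.remove[rotated])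
  ultimately have nd: "\<not> p dvd card \<Omega>" using p(1)
    by (metis Suc_eq_plus1 dvd_add_right_iff not_prime_unit)
  have conjc: "conj_by g ` (M #> x) = M #> conj_by g x" if g: "g \<in> carrier G" and x: "x \<in> carrier G" for g x
  proof -
    have gM: "conj_by g ` M = M" using conj_by_image_normalizer[OF M(1)] M(2) g by auto
    have "conj_by g ` (M #> x) = (\<lambda>m. conj_by g m \<otimes> conj_by g x) ` M"
      using g x cM by (auto simp: r_coset_def conj_by_mult image_iff subset_iff)
    also have "\<dots> = (\<lambda>m. m \<otimes> conj_by g x) ` (conj_by g ` M)" by (simp add: image_image)
    also have "\<dots> = M #> conj_by g x" unfolding gM by (auto simp: r_coset_def)
    finally show ?thesis .
  qed
  have "\<exists>Y\<in>\<Omega>. \<forall>g\<in>P. conj_by g ` Y = Y"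
  proof (rule p_group_fixed_point[OF sP(1) p(1) sP(3) _ _ _ _ nd])
    show "finite \<Omega>" using fin0 by (simp add: \<Omega>_def)
    have YC: "Y \<subseteq> carrier G" if "Y \<in> \<Omega>" for Y
      using that cM sP(2) by (auto simp: \<Omega>_def \<Omega>0_def r_coset_def)
    show "conj_by g ` Y \<in> \<Omega>" if gY: "g \<in> P" "Y \<in> \<Omega>" for g Y
    proof -
      obtain x where x: "x \<in> P" "Y = M #> x" using gY by (auto simp: \<Omega>_def \<Omega>0_def)
      have g: "g \<in> carrier G" using gY sP(2) by auto
      have "conj_by g ` Y = M #> conj_by g x" using conjc g x sP(2) by auto
      moreover have "conj_by g x \<in> P" using gY x sP(1) by (simp add: conj_by_subgroup_closed)
      moreover have "conj_by g ` Y \<noteq> M"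
      proof
        assume "conj_by g ` Y = M"
        then have "conj_by (inv g) ` conj_by g ` Y = M"
          using conj_by_image_normalizer[OF M(1), of "inv g"] M(2) g by auto
        then have "Y = M" using g YC[OF gY(2)] by simp
        then show False using gY by (simp add: \<Omega>_def)
      qed
      ultimately show ?thesis by (auto simp: \<Omega>_def \<Omega>0_def)
    qed
    show "conj_by \<one> ` Y = Y" if "Y \<in> \<Omega>" for Y using YC[OF that] by (auto simp: subset_iff image_iff)
    show "conj_by (g \<otimes> h) ` Y = conj_by g ` conj_by h ` Y" if "g \<in> P" "h \<in> P" "Y \<in> \<Omega>" for g h Y
      using that YC[OF that(3)] sP(2) by (auto simp: conj_by_image_mult subset_iff)
  qed
  then obtain x where x: "x \<in> P" "M #> x \<noteq> M" "\<And>g. g \<in> P \<Longrightarrow> conj_by g ` (M #> x) = M #> x"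
    by (auto simp: \<Omega>_def \<Omega>0_def)
  have cx: "x \<in> carrier G" using x(1) sP(2) by auto
  let ?C = "{g \<in> carrier G. conj_by g x \<otimes> inv x \<in> M}"
  have C: "subgroup ?C G" by (rule subgroup_commuting_modulo[OF M(1,2) cx])
  have PC: "P \<subseteq> ?C"
  proof
    fix g assume g: "g \<in> P"
    then have cg: "g \<in> carrier G" using sP(2) by auto
    have "conj_by g x \<in> M #> x" using x(3)[OF g] conjc[OF cg cx] rcos_self[OF _ M(1), of "conj_by g x"] cg cx by simp
    then obtain m where "m \<in> M" "conj_by g x = m \<otimes> x" by (auto simp: r_coset_def)
    then show "g \<in> ?C" using cg cx cM by (auto simp: m_assoc subset_iff)
  qed
  have QC: "Q \<subseteq> ?C" if q: "Factorial_Ring.prime q" "q \<noteq> p" and Q: "p_sylow q Q (carrier G)" for q Q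
  proof
    note sQ = p_sylowD[OF Q] and nQ = syl[OF q(1) Q]
    fix g assume g: "g \<in> Q"
    have "coprime (card Q) (card P)" using sQ(3) sP(3) q p(1) by (simp add: primes_coprime)
    then have "conj_by g x = x"
      using commute_if_normalize[OF sQ(1) sP(1) _ _ coprime_Int[OF sQ(1) sP(1)] g x(1)] nP nQ sP(2) sQ(2) by auto
    then show "g \<in> ?C" using g sQ(2) cx M(1) by (auto simp: subgroup.one_closed)
  qed
  have "?C = carrier G"
  proof (rule subgroup_eqI_prime_powers[OF C subgroup_self])
    fix q :: nat assume q: "Factorial_Ring.prime q"
    obtain Q where Q: "p_sylow q Q (carrier G)" using p_sylow_exists[OF subgroup_self q] by auto
    have "\<exists>Q. p_sylow q Q (carrier G) \<and> Q \<subseteq> ?C"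
    proof (cases "q = p")
      case True
      then show ?thesis using P PC by blast
    next
      case False
      then show ?thesis using Q QC[OF q False Q] by blast
    qed
    then obtain Q where Q: "p_sylow q Q (carrier G)" "Q \<subseteq> ?C" by blast
    then show "q ^ multiplicity q (card (carrier G)) dvd card ?C"
      using card_dvd[OF p_sylowD(1)[OF Q(1)] C Q(2)] p_sylowD(3)[OF Q(1)] by simp
  qed auto
  moreover have "x \<notin> M" using x(2) coset_join2[OF cx M(1)] by blast
  ultimately show ?thesis using cx by blast
qed

text \<open>
  Passing from a normal subgroup \<open>M\<close> to the preimage of the centre of \<open>G/M\<close> costs one term of the lower
  central series, and by \<open>exists_central_modulo\<close> it is a proper step up as long as \<open>M\<close> is not \<open>G\<close>.
\<close>

lemma sylow_normal_imp_nilpotent: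
  assumes syl: "\<And>p S. Factorial_Ring.prime p \<Longrightarrow> p_sylow p S (carrier G) \<Longrightarrow> normalizer G S = carrier G"
  shows "nilpotent_group G"
proof -
  have "\<exists>n. lower_central_series G n \<subseteq> M" if "subgroup M G" "normalizer G M = carrier G" for M
    using that
  proof (induction "card (carrier G) - card M" arbitrary: M rule: less_induct)
    case less
    show ?case
    proof (cases "M = carrier G")
      case True
      then show ?thesis by (auto intro: exI[of _ 0])
    next
      case False
      define C where "C = {x \<in> carrier G. \<forall>g\<in>carrier G. conj_by g x \<otimes> inv x \<in> M}"
      note C = subgroup_central_modulo[OF less.prems, folded C_def]
      have "\<exists>x\<in>carrier G - M. \<forall>g\<in>carrier G. conj_by g x \<otimes> inv x \<in> M"
        by (rule exists_central_modulo[OF _ less.prems False]) (rule syl)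
      then obtain x where "x \<in> C" "x \<notin> M" by (auto simp: C_def)
      then have "M \<subset> C" using C(3) by auto
      then have "card M < card C" using C(1) finite_subgroup psubset_card_mono by blast
      moreover have "card C \<le> card (carrier G)" using C(1) fin card_mono subgroup.subset by blast
      ultimately have "card (carrier G) - card C < card (carrier G) - card M" by linarith
      then obtain n where n: "lower_central_series G n \<subseteq> C" using less.hyps C by blast
      have "h \<otimes> k \<otimes> inv h \<otimes> inv k \<in> M" if "h \<in> lower_central_series G n" "k \<in> carrier G" for h k
      proof -
        have h: "h \<in> carrier G" "conj_by k h \<otimes> inv h \<in> M" using that n by (auto simp: C_def)
        then have "inv (conj_by k h \<otimes> inv h) \<in> M" using less.prems by (simp add: subgroup.m_inv_closed)
        then show ?thesis using h that(2) by (simp add: conj_by_def inv_mult_group m_assoc)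
      qed
      then have "lower_central_series G (Suc n) \<subseteq> M"
        unfolding lower_central_series.simps commutator_subgroup_def
        by (intro generate_subgroup_incl[OF _ less.prems(1)]) auto
      then show ?thesis by blast
    qed
  qed
  from this[of "{\<one>}"] obtain n where "lower_central_series G n \<subseteq> {\<one>}"
    using triv_subgroup one_is_normal by (auto simp: normal_iff_normalizer)
  then have "lower_central_series G n = {\<one>}"
    using subgroup.one_closed[OF subgroup_lower_central_series[of n]] by auto
  then show ?thesis by (auto simp: nilpotent_group_def)
qed

lemma conj_by_restrict:
  "subgroup H G \<Longrightarrow> g \<in> H \<Longrightarrow> group.conj_by (G\<lparr>carrier := H\<rparr>) g x = conj_by g x"
  by (simp add: group.conj_by_def subgroup_imp_group conj_by_def)

lemma nilpotent_iff_sylow: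
  assumes H: "subgroup H G"
  shows "nilpotent H \<longleftrightarrow> (\<forall>p S. Factorial_Ring.prime p \<longrightarrow> p_sylow p S H \<longrightarrow> H \<subseteq> normalizer G S)"
proof -
  interpret H: finite_group "G\<lparr>carrier := H\<rparr>" by (rule restrict_finite_group[OF H])
  have syl: "H.p_sylow p S H \<longleftrightarrow> p_sylow p S H" for p S
    using H by (auto simp: H.p_sylow_def p_sylow_def subgroup_restrict_iff)
  have nrm: "normalizer (G\<lparr>carrier := H\<rparr>) S = H \<longleftrightarrow> H \<subseteq> normalizer G S" if "p_sylow p S H" for p S
    using that normal_in_iff_normalizer[OF H, of S] H.normal_iff_normalizer[of S]
    by (auto simp: p_sylow_def subgroup_restrict_iff H)
  show ?thesis
    using H.nilpotent_imp_sylow_normal H.sylow_normal_imp_nilpotent by (simp add: syl) (metis nrm)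
qed

lemma nilpotent_normalizer_grows_in:
  assumes H: "subgroup H G" and nil: "nilpotent H" and K: "subgroup K G" "K \<subset> H"
  shows "\<exists>x\<in>H - K. x \<in> normalizer G K"
proof -
  interpret H: finite_group "G\<lparr>carrier := H\<rparr>" by (rule restrict_finite_group[OF H])
  have K': "subgroup K (G\<lparr>carrier := H\<rparr>)" using K H by (simp add: subgroup_incl)
  obtain x where x: "x \<in> H" "x \<notin> K" "x \<in> normalizer (G\<lparr>carrier := H\<rparr>) K"
    using H.nilpotent_normalizer_grows[OF nil K'] K by auto
  then have "\<forall>k\<in>K. conj_by x k \<in> K" by (simp add: H.mem_normalizer_iff[OF K'] conj_by_restrict[OF H])
  then show ?thesis using x K H by (auto simp: mem_normalizer_iff intro: subgroup.mem_carrier)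
qed

text \<open>
  A Sylow subgroup of \<open>K\<close> is the intersection of \<open>K\<close> with the normal Sylow subgroup of \<open>H\<close>.
\<close>

lemma nilpotent_subgroup:
  assumes H: "subgroup H G" and nil: "nilpotent H" and K: "subgroup K G" "K \<subseteq> H"
  shows "nilpotent K"
  unfolding nilpotent_iff_sylow[OF K(1)]
proof (intro allI impI)
  fix p :: nat and S assume p: "Factorial_Ring.prime p" and S: "p_sylow p S K"
  note sS = p_sylowD[OF S]
  obtain T where T: "p_sylow p T H" using p_sylow_exists[OF H p] by auto
  note sT = p_sylowD[OF T]
  have nT: "H \<subseteq> normalizer G T" using nil T p nilpotent_iff_sylow[OF H] by auto
  have "S \<subseteq> T" using p_subgroup_subset_normal_sylow[OF H p T nT sS(1) _ sS(3)] sS(2) K(2) by auto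
  have TK: "subgroup (T \<inter> K) G" using sT(1) K(1) by (rule subgroups_Inter_pair)
  obtain i where i: "card (T \<inter> K) = p ^ i" using p_subgroup_card[OF p sT(1,3) TK] by auto
  have "p ^ i dvd card K" using card_dvd[OF TK K(1)] i by auto
  then have "i \<le> multiplicity p (card K)"
    using p card_subgroup_pos[OF K(1)] by (intro multiplicity_geI) auto
  then have "card (T \<inter> K) \<le> card S" using i sS(3) p by (simp add: prime_gt_0_nat power_increasing Suc_leI)
  then have "S = T \<inter> K" using subgroup_eq_card[OF TK, of S] \<open>S \<subseteq> T\<close> sS(2) by auto
  then show "K \<subseteq> normalizer G S"
    using nT K sT(1) sS(1) by (auto simp: mem_normalizer_iff conj_by_subgroup_closed subset_iff)
qed

section \<open>Maximal subgroups and normalizers\<close>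

lemma exists_maximal_subgroup:
  assumes K: "subgroup K G" "K \<noteq> carrier G"
  obtains M where "maximal_subgroup M G" "K \<subseteq> M"
proof -
  let ?A = "{H. subgroup H G \<and> H \<noteq> carrier G}"
  have "finite ?A" using fin by (rule finite_subset[rotated, OF finite_Pow_iff[THEN iffD2]]) (auto dest: subgroup.subset)
  then obtain M where M: "M \<in> ?A" "K \<subseteq> M" "\<And>H. H \<in> ?A \<Longrightarrow> M \<subseteq> H \<Longrightarrow> M = H"
    using finite_has_maximal2[of ?A K] K by auto
  then have "maximal_subgroup M G" unfolding maximal_subgroup_def by blast
  then show thesis using that M by blast
qed

lemma maximal_subgroupD:
  assumes "maximal_subgroup M G"
  shows "subgroup M G" "M \<noteq> carrier G" "\<And>K. subgroup K G \<Longrightarrow> M \<subseteq> K \<Longrightarrow> K \<noteq> carrier G \<Longrightarrow> K = M"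
  using assms by (auto simp: maximal_subgroup_def)

lemma normalizer_subset_carrier: "subgroup H G \<Longrightarrow> normalizer G H \<subseteq> carrier G"
  by (rule subgroup.subset[OF subgroup_normalizer])

lemma maximal_normalizer:
  assumes "maximal_subgroup M G"
  shows "normalizer G M = M \<or> normalizer G M = carrier G"
  using maximal_subgroupD[OF assms] subgroup_normalizer subset_normalizer by blast

lemma normalizer_set_mult:
  assumes "subgroup A G" "subgroup B G" "subgroup (A <#> B) G"
  shows "normalizer G A \<inter> normalizer G B \<subseteq> normalizer G (A <#> B)"
proof
  fix g assume g: "g \<in> normalizer G A \<inter> normalizer G B"
  have cg: "g \<in> carrier G" using g assms by (simp add: mem_normalizer_iff)
  have "conj_by g x \<in> A <#> B" if "x \<in> A <#> B" for x
  proof -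
    obtain a b where ab: "a \<in> A" "b \<in> B" "x = a \<otimes> b" using \<open>x \<in> A <#> B\<close> by (auto simp: set_mult_def)
    have c: "a \<in> carrier G" "b \<in> carrier G" using ab assms by (auto intro: subgroup.mem_carrier)
    have "conj_by g x = conj_by g a \<otimes> conj_by g b" using ab(3) c cg by (simp add: conj_by_mult)
    moreover have "conj_by g a \<in> A" "conj_by g b \<in> B" using g ab assms(1,2) by (auto simp: mem_normalizer_iff)
    ultimately show ?thesis by (auto simp: set_mult_def)
  qed
  then show "g \<in> normalizer G (A <#> B)" using cg assms(3) by (simp add: mem_normalizer_iff)
qed

lemma normalizer_mult_normal:
  assumes N: "subgroup N G" "normalizer G N = carrier G" and T: "subgroup T G"
  shows "subgroup (N <#> T) G" "normalizer G T \<subseteq> normalizer G (N <#> T)"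
proof -
  show NT: "subgroup (N <#> T) G" using N T by (intro subgroup_set_mult) (auto dest: subgroup.subset)
  show "normalizer G T \<subseteq> normalizer G (N <#> T)"
    using normalizer_set_mult[OF N(1) T NT] N(2) normalizer_subset_carrier[OF T] by auto
qed

lemma conj_by_normalizer_image:
  assumes T: "subgroup T G" and g: "g \<in> carrier G" and x: "x \<in> normalizer G T"
  shows "conj_by g x \<in> normalizer G (conj_by g ` T)"
proof -
  have cx: "x \<in> carrier G" using x T by (simp add: mem_normalizer_iff)
  have "conj_by (conj_by g x) (conj_by g t) = conj_by g (conj_by x t)" if "t \<in> T" for t
    using g cx that T by (simp add: conj_by_def m_assoc inv_mult_group subgroup.mem_carrier[OF T])
  then show ?thesis using g cx x T subgroup_conj_by[OF g T] by (auto simp: mem_normalizer_iff)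
qed

lemma p_sylow_above:
  assumes p: "Factorial_Ring.prime p" and H: "subgroup H G" and T: "subgroup T G" "T \<subseteq> H" "card T = p ^ k"
  obtains S where "p_sylow p S H" "T \<subseteq> S"
proof -
  obtain S where S: "p_sylow p S H" using p_sylow_exists[OF H p] by auto
  note sS = p_sylowD[OF S]
  obtain h where h: "h \<in> H" "conj_by h ` T \<subseteq> S" using p_subgroup_conj_into[OF H p S T] by auto
  have ch: "h \<in> carrier G" and cS: "S \<subseteq> carrier G" and cT: "T \<subseteq> carrier G"
    using h H sS(1) T(1) by (auto dest: subgroup.subset)
  have hi: "inv h \<in> H" "inv h \<in> carrier G" using h H ch by (auto intro: subgroup.m_inv_closed)
  show thesis
  proof
    show "p_sylow p (conj_by (inv h) ` S) H"
      using subgroup_conj_by[OF hi(2) sS(1)] card_conj_by[OF hi(2) cS] sS hi H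
      by (auto simp: p_sylow_def intro!: conj_by_subgroup_closed)
    have "T = conj_by (inv h) ` conj_by h ` T" using ch cT by simp
    also have "\<dots> \<subseteq> conj_by (inv h) ` S" using h by (intro image_mono)
    finally show "T \<subseteq> conj_by (inv h) ` S" .
  qed
qed

text \<open>
  The index of \<open>A\<close> in \<open>W\<close> is a power of \<open>p\<close> by one hypothesis and prime to \<open>p\<close> by the other.
\<close>

lemma index_p_power_eq:
  assumes p: "Factorial_Ring.prime p" and A: "subgroup A G" and W: "subgroup W G" "A \<subseteq> W"
    and d: "card W dvd card A * p ^ k" and pp: "p ^ multiplicity p (card W) dvd card A"
  shows "A = W"
proof (rule subgroup_eqI_prime_powers[OF A W])
  fix q :: nat assume q: "Factorial_Ring.prime q"
  show "q ^ multiplicity q (card W) dvd card A"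
  proof (cases "q = p")
    case False
    then show ?thesis using prime_power_dvd_of_dvd_mult[OF p q] d by (simp add: mult.commute)
  qed (use pp in simp)
qed

lemma card_set_mult_dvd:
  assumes "subgroup A G" "subgroup B G"
  shows "card (A <#> B) dvd card A * card B"
  using card_set_mult[OF assms] by (metis dvd_triv_left)

lemma p_sylow_card_eqI:
  assumes p: "Factorial_Ring.prime p" and S: "p_sylow p S H" and T: "subgroup T G" "T \<subseteq> H" "S \<subseteq> T" and H: "subgroup H G"
    and c: "card T = p ^ k"
  shows "S = T"
proof -
  have "p ^ k dvd card H" using card_dvd[OF T(1) H T(2)] c by simp
  then have "k \<le> multiplicity p (card H)" using p card_subgroup_pos[OF H] by (intro multiplicity_geI) auto
  then have "card T \<le> card S" using c p_sylowD(3)[OF S] p by (simp add: prime_gt_0_nat power_increasing Suc_leI)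
  then show ?thesis using subgroup_eq_card[OF T(1) T(3)] by simp
qed

lemma p_group_nilpotent:
  assumes p: "Factorial_Ring.prime p" and S: "subgroup S G" "card S = p ^ k"
  shows "nilpotent S"
proof -
  have "S \<subseteq> normalizer G R" if R: "p_sylow q R S" and q: "Factorial_Ring.prime q" for q R
  proof (cases "q = p")
    case True
    have "R = S" by (rule p_sylow_card_eqI[OF p _ S(1) _ _ S]) (use R True p_sylowD[OF R] in auto)
    then show ?thesis using subset_normalizer[OF S(1)] by simp
  next
    case False
    have "\<not> q dvd p ^ k" using q p False by (metis prime_dvd_power primes_dvd_imp_eq)
    then have "multiplicity q (card S) = 0" using S(2) by (simp add: not_dvd_imp_multiplicity_0)
    then have "card R = 1" using p_sylowD(3)[OF R] by simp
    then have "R = {\<one>}" using subgroup.one_closed[OF p_sylowD(1)[OF R]] by (metis card_1_singletonE singletonD)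
    then show ?thesis using one_is_normal subgroup.subset[OF S(1)] by (simp add: normal_iff_normalizer)
  qed
  then show ?thesis using nilpotent_iff_sylow[OF S(1)] by blast
qed

text \<open>
  If \<open>T\<close> were smaller than a Sylow \<open>p\<close>-subgroup \<open>S\<close> of \<open>G\<close> above it, then an element of \<open>S\<close> outside \<open>T\<close> would
  normalize \<open>T\<close>, so would lie in \<open>M\<close> and contradict that \<open>T\<close> is a Sylow subgroup of \<open>M\<close>.
\<close>

lemma p_sylow_lift:
  assumes p: "Factorial_Ring.prime p" and M: "subgroup M G" and T: "p_sylow p T M" and n: "normalizer G T \<subseteq> M"
  shows "p_sylow p T (carrier G)"
proof -
  note sT = p_sylowD[OF T]
  obtain S where S: "p_sylow p S (carrier G)" "T \<subseteq> S"
    using p_sylow_above[OF p subgroup_self sT(1) _ sT(3)] subgroup.subset[OF sT(1)] by auto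
  note sS = p_sylowD[OF S(1)]
  have "T = S"
  proof (rule ccontr)
    assume "T \<noteq> S"
    have "nilpotent S" by (rule p_group_nilpotent[OF p sS(1,3)])
    then obtain x where x: "x \<in> S" "x \<notin> T" "x \<in> normalizer G T"
      using nilpotent_normalizer_grows_in[OF sS(1) _ sT(1)] S(2) \<open>T \<noteq> S\<close> by auto
    have SM: "subgroup (S \<inter> M) G" using sS(1) M by (rule subgroups_Inter_pair)
    obtain i where i: "card (S \<inter> M) = p ^ i" using p_subgroup_card[OF p sS(1,3) SM] by auto
    have "T = S \<inter> M" by (rule p_sylow_card_eqI[OF p T SM _ _ M i]) (use S(2) sT in auto)
    then show False using x n by auto
  qed
  then show ?thesis using S by simp
qed

text \<open>
  A normal subgroup containing one Sylow \<open>p\<close>-subgroup contains all their conjugates, hence every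
  \<open>p\<close>-subgroup.
\<close>

lemma normal_sylow_contains:
  assumes p: "Factorial_Ring.prime p" and H: "subgroup H G" and K: "subgroup K G" "K \<subseteq> H" "H \<subseteq> normalizer G K"
    and S: "p_sylow p S H" "S \<subseteq> K" and T: "subgroup T G" "T \<subseteq> H" "card T = p ^ k"
  shows "T \<subseteq> K"
proof
  fix t assume t: "t \<in> T"
  obtain h where h: "h \<in> H" "conj_by h ` T \<subseteq> S" using p_subgroup_conj_into[OF H p S(1) T] by auto
  have "inv h \<in> normalizer G K" using h H K(3) by (auto intro: subgroup.m_inv_closed)
  moreover have "conj_by h t \<in> K" using h t S(2) by auto
  ultimately have "conj_by (inv h) (conj_by h t) \<in> K" using K(1) by (simp add: mem_normalizer_iff)
  then show "t \<in> K" using subgroup.mem_carrier[OF H h(1)] subgroup.mem_carrier[OF T(1) t] by simp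
qed

section \<open>A normal Sylow subgroup modulo a normal subgroup\<close>

definition maximals_nilpotent_or_normal :: bool where
  "maximals_nilpotent_or_normal \<longleftrightarrow>
     (\<forall>M. maximal_subgroup M G \<longrightarrow> nilpotent M \<or> normalizer G M = carrier G)"

lemma maximal_over_sylow_normalizer:
  assumes p: "Factorial_Ring.prime p" and S: "p_sylow p S (carrier G)"
    and M: "maximal_subgroup M G" "normalizer G S \<subseteq> M"
  shows "normalizer G M = M"
proof -
  note sM = maximal_subgroupD[OF M(1)] and sS = p_sylowD[OF S]
  have "S \<subseteq> M" using subset_normalizer[OF sS(1)] M(2) by auto
  then have "p_sylow p S M"
    using p_sylow_mono[OF sM(1) subgroup_self _ S _ p] subgroup.subset[OF sM(1)] by auto
  then have "normalizer G M \<subseteq> M" using frattini[OF sM(1) p _ sM(1) _ M(2)] by auto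
  then show ?thesis using subset_normalizer[OF sM(1)] by auto
qed

text \<open>
  A maximal subgroup \<open>M\<close> above the normalizer of \<open>S\<close> is self-normalizing by the Frattini argument, so it
  is nilpotent; then \<open>S\<close> is normal in \<open>M\<close>, so \<open>M\<close> is that normalizer.
\<close>

lemma sylow_normalizer_maximal:
  assumes star: "maximals_nilpotent_or_normal"
    and p: "Factorial_Ring.prime p" and S: "p_sylow p S (carrier G)" and n: "normalizer G S \<noteq> carrier G"
  shows "maximal_subgroup (normalizer G S) G" "nilpotent (normalizer G S)"
proof -
  note sS = p_sylowD[OF S]
  obtain M where M: "maximal_subgroup M G" "normalizer G S \<subseteq> M"
    using exists_maximal_subgroup[OF subgroup_normalizer[OF sS(1)] n] by auto
  note sM = maximal_subgroupD[OF M(1)]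
  have "nilpotent M"
    using star M(1) maximal_over_sylow_normalizer[OF p S M] sM(2) by (auto simp: maximals_nilpotent_or_normal_def)
  have "S \<subseteq> M" using subset_normalizer[OF sS(1)] M(2) by auto
  then have "p_sylow p S M"
    using p_sylow_mono[OF sM(1) subgroup_self _ S _ p] subgroup.subset[OF sM(1)] by auto
  then have "M \<subseteq> normalizer G S" using \<open>nilpotent M\<close> nilpotent_iff_sylow[OF sM(1)] p by auto
  then have "normalizer G S = M" using M(2) by auto
  then show "maximal_subgroup (normalizer G S) G" "nilpotent (normalizer G S)" using M \<open>nilpotent M\<close> by auto
qed

lemma maximal_set_mult:
  assumes N: "subgroup N G" "normalizer G N = carrier G" and M: "maximal_subgroup M G" and NM: "\<not> N \<subseteq> M"
  shows "N <#> M = carrier G"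
proof -
  note sM = maximal_subgroupD[OF M]
  have "subgroup (N <#> M) G" by (rule normalizer_mult_normal[OF N sM(1)])
  then show ?thesis using sM(3)[of "N <#> M"] subset_set_mult[OF N(1) sM(1)] NM by blast
qed

text \<open>
  Suppose that adjoining an \<open>r\<close>-group to \<open>N\<close> gives a larger normal subgroup \<open>R\<close>, and that \<open>RS\<close> is normal
  for a Sylow \<open>s\<close>-subgroup \<open>S\<close>. If \<open>s = r\<close>, then \<open>RS = NS\<close> by comparing orders. If \<open>S\<close> is itself normal,
  then so is \<open>NS\<close>. Otherwise its normalizer \<open>M\<close> is nilpotent, and \<open>G = RM\<close> by the Frattini argument.
  For the Sylow \<open>r\<close>-subgroup \<open>U\<close> of \<open>M\<close>, which is normal in \<open>M\<close>, the product \<open>RU\<close> is then normal in \<open>G\<close> and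
  contains a Sylow \<open>r\<close>-subgroup \<open>V\<close> of \<open>G\<close>; again by orders, \<open>RU = NV\<close>.
\<close>

lemma exists_normal_sylow_modulo_step:
  assumes star: "maximals_nilpotent_or_normal"
    and N: "subgroup N G" "normalizer G N = carrier G"
    and r: "Factorial_Ring.prime r" and T: "subgroup T G" "card T = r ^ k" "\<not> T \<subseteq> N"
    and R: "R = N <#> T" "normalizer G R = carrier G"
    and s: "Factorial_Ring.prime s" and S: "p_sylow s S (carrier G)" "\<not> S \<subseteq> R"
    and RS: "normalizer G (R <#> S) = carrier G"
  shows "\<exists>p S. Factorial_Ring.prime p \<and> p_sylow p S (carrier G) \<and> \<not> S \<subseteq> N \<and> normalizer G (N <#> S) = carrier G"
proof -
  note sS = p_sylowD[OF S(1)]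
  have R': "subgroup R G" using normalizer_mult_normal[OF N T(1)] R by simp
  have NR: "N \<subseteq> R" "T \<subseteq> R" using subset_set_mult[OF N(1) T(1)] R by auto
  have NRc: "card R dvd card N * r ^ k" using card_set_mult_dvd[OF N(1) T(1)] T(2) R by simp
  have RSs: "subgroup (R <#> S) G" by (rule normalizer_mult_normal[OF R' R(2) sS(1)])
  \<comment> \<open>the index of \<open>N\<close> in \<open>W\<close> is a power of \<open>r\<close>, and \<open>U\<close> is a Sylow \<open>r\<close>-subgroup of \<open>W\<close>\<close>
  have key: "N <#> U = W" if U: "p_sylow r U (carrier G)" and W: "subgroup W G" "R \<subseteq> W" "U \<subseteq> W" "card W dvd card R * r ^ l"
    for U W l
  proof (rule index_p_power_eq[OF r _ W(1)])
    note sU = p_sylowD[OF U]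
    show NU: "subgroup (N <#> U) G" by (rule normalizer_mult_normal[OF N sU(1)])
    show "N <#> U \<subseteq> W" using set_mult_subset[OF W(1)] NR W by blast
    have NUc: "card N dvd card (N <#> U)" "card U dvd card (N <#> U)"
      using subset_set_mult[OF N(1) sU(1)] by (auto intro!: card_dvd N(1) sU(1) NU)
    have "card R * r ^ l dvd card N * r ^ k * r ^ l" using NRc by (rule mult_dvd_mono) simp
    then show "card W dvd card (N <#> U) * r ^ (k + l)"
      using W(4) NUc(1) by (metis (no_types, lifting) dvd_trans dvd_refl mult.assoc mult_dvd_mono power_add)
    have "multiplicity r (card W) \<le> multiplicity r (card (carrier G))"
      using card_dvd[OF W(1) subgroup_self] subgroup.subset[OF W(1)] card_subgroup_pos[OF subgroup_self]
      by (intro dvd_imp_multiplicity_le) auto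
    then have "r ^ multiplicity r (card W) dvd card U" using sU(3) by (simp add: le_imp_power_dvd)
    then show "r ^ multiplicity r (card W) dvd card (N <#> U)" using NUc(2) dvd_trans by blast
  qed
  have fin: ?thesis if U: "p_sylow r U (carrier G)" and W: "N <#> U = W" "normalizer G W = carrier G" "R \<subseteq> W" for U W
  proof -
    have "\<not> U \<subseteq> N" using W(1,3) NR(2) T(3) set_mult_subset[OF N(1) order_refl, of U] by blast
    then show ?thesis using r U W by blast
  qed
  show ?thesis
  proof (cases "s = r")
    case True
    have "N <#> S = R <#> S"
      using key[OF _ RSs, of S "multiplicity r (card (carrier G))"] True S(1) subset_set_mult[OF R' sS(1)]
        card_set_mult_dvd[OF R' sS(1)] sS(3) by auto
    then show ?thesis using fin[of S "R <#> S"] True S(1) RS subset_set_mult[OF R' sS(1)] by auto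
  next
    case sr: False
    show ?thesis
    proof (cases "normalizer G S = carrier G")
      case True
      then have "normalizer G (N <#> S) = carrier G"
        using normalizer_mult_normal[OF N sS(1)] normalizer_subset_carrier by blast
      moreover have "\<not> S \<subseteq> N" using S(2) NR by auto
      ultimately show ?thesis using s S(1) by blast
    next
      case False
      let ?M = "normalizer G S"
      have M: "maximal_subgroup ?M G" "nilpotent ?M" by (rule sylow_normalizer_maximal[OF star s S(1) False])+
      note sM = maximal_subgroupD[OF M(1)]
      have RM: "subgroup (R <#> ?M) G" by (rule normalizer_mult_normal[OF R' R(2) sM(1)])
      have sub: "R \<subseteq> R <#> ?M" "?M \<subseteq> R <#> ?M" by (rule subset_set_mult[OF R' sM(1)])+
      have "S \<subseteq> R <#> ?M" using subset_normalizer[OF sS(1)] sub by auto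
      then have "R <#> S \<subseteq> R <#> ?M" using set_mult_subset[OF RM sub(1)] by auto
      moreover have "p_sylow s S (R <#> S)"
        using p_sylow_mono[OF RSs subgroup_self _ S(1) _ s] subset_set_mult[OF R' sS(1)] subgroup.subset[OF RSs] by auto
      ultimately have "normalizer G (R <#> S) \<subseteq> R <#> ?M" using frattini[OF RSs s _ RM] sub(2) by auto
      then have RMG: "R <#> ?M = carrier G" using RS subgroup.subset[OF RM] by auto
      obtain U where U: "p_sylow r U ?M" using p_sylow_exists[OF sM(1) r] by auto
      note sU = p_sylowD[OF U]
      let ?W = "R <#> U"
      have W: "subgroup ?W G" by (rule normalizer_mult_normal[OF R' R(2) sU(1)])
      have Wsub: "R \<subseteq> ?W" "U \<subseteq> ?W" by (rule subset_set_mult[OF R' sU(1)])+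
      have "?M \<subseteq> normalizer G U" using M(2) nilpotent_iff_sylow[OF sM(1)] U r by auto
      then have "?M \<subseteq> normalizer G ?W" using normalizer_mult_normal(2)[OF R' R(2) sU(1)] by auto
      then have "R <#> ?M \<subseteq> normalizer G ?W"
        using set_mult_subset[OF subgroup_normalizer[OF W]] Wsub(1) subset_normalizer[OF W] by blast
      then have nW: "normalizer G ?W = carrier G" using RMG normalizer_subset_carrier[OF W] by auto
      \<comment> \<open>the index of \<open>W = RU\<close> in \<open>G = RM\<close> divides that of \<open>U\<close> in \<open>M\<close>\<close>
      obtain m where m: "card ?M = card U * m" "\<not> r dvd m"
        using multiplicity_split[OF r card_subgroup_pos[OF sM(1)]] sU(3) by metis
      have RUs: "subgroup (R \<inter> U) G" and RMs: "subgroup (R \<inter> ?M) G"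
        using R' sU(1) sM(1) by (auto intro: subgroups_Inter_pair)
      have "card (R \<inter> U) dvd card (R \<inter> ?M)" using card_dvd[OF RUs RMs] sU(2) by auto
      then obtain c where c: "card (R \<inter> ?M) = card (R \<inter> U) * c" by blast
      have 1: "card (carrier G) * card (R \<inter> ?M) = card R * card ?M" using card_set_mult[OF R' sM(1)] RMG by simp
      have 2: "card ?W * card (R \<inter> U) = card R * card U" by (rule card_set_mult[OF R' sU(1)])
      have "card (R \<inter> U) * (card ?W * m) = card (R \<inter> U) * (card (carrier G) * c)"
        using 1 2 c m(1) by (metis mult.assoc mult.commute)
      then have "card ?W * m = card (carrier G) * c" using card_subgroup_pos[OF RUs] by simp
      then have "r ^ multiplicity r (card (carrier G)) dvd card ?W * m"
        using multiplicity_dvd[of r "card (carrier G)"] by (metis dvd_mult2)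
      moreover have "coprime (r ^ multiplicity r (card (carrier G))) m"
        using r m(2) by (simp add: prime_imp_coprime coprime_power_left_iff)
      ultimately have "r ^ multiplicity r (card (carrier G)) dvd card ?W" by (simp add: coprime_dvd_mult_left_iff)
      moreover obtain V where V: "p_sylow r V ?W" using p_sylow_exists[OF W r] by auto
      note sV = p_sylowD[OF V]
      have Wd: "card ?W dvd card (carrier G)" using card_dvd[OF W subgroup_self] subgroup.subset[OF W] by auto
      ultimately have "multiplicity r (card ?W) = multiplicity r (card (carrier G))"
        using r card_subgroup_pos[OF W] card_subgroup_pos[OF subgroup_self]
        by (intro antisym dvd_imp_multiplicity_le multiplicity_geI) auto
      then have V': "p_sylow r V (carrier G)" using sV subgroup.subset[OF sV(1)] by (simp add: p_sylow_def)
      have "N <#> V = ?W"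
        using key[OF V' W Wsub(1) sV(2), of "multiplicity r (card ?M)"] card_set_mult_dvd[OF R' sU(1)] sU(3) by simp
      then show ?thesis using fin[OF V' _ nW Wsub(1)] by auto
    qed
  qed
qed

lemma maximal_conj_by:
  assumes g: "g \<in> carrier G" and M: "maximal_subgroup M G"
  shows "maximal_subgroup (conj_by g ` M) G"
  unfolding maximal_subgroup_def
proof (intro conjI allI impI)
  note sM = maximal_subgroupD[OF M]
  have cM: "M \<subseteq> carrier G" by (rule subgroup.subset[OF sM(1)])
  show "subgroup (conj_by g ` M) G" by (rule subgroup_conj_by[OF g sM(1)])
  show "conj_by g ` M \<noteq> carrier G"
    using card_conj_by[OF g cM] subgroup_eq_card[OF subgroup_self cM] sM(2) by auto
  fix K assume K: "subgroup K G" "conj_by g ` M \<subseteq> K"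
  have cK: "K \<subseteq> carrier G" by (rule subgroup.subset[OF K(1)])
  have gi: "inv g \<in> carrier G" using g by simp
  have "M = conj_by (inv g) ` conj_by g ` M" using g cM by simp
  also have "\<dots> \<subseteq> conj_by (inv g) ` K" by (rule image_mono[OF K(2)])
  finally have sub: "M \<subseteq> conj_by (inv g) ` K" .
  have K2: "K = conj_by g ` conj_by (inv g) ` K" using g cK by simp
  show "K = conj_by g ` M \<or> K = carrier G"
  proof (cases "conj_by (inv g) ` K = carrier G")
    case True
    then have "card K = card (carrier G)" using card_conj_by[OF gi cK] by simp
    then show ?thesis using subgroup_eq_card[OF subgroup_self cK] by simp
  next
    case False
    then have "conj_by (inv g) ` K = M" using sM(3)[OF subgroup_conj_by[OF gi K(1)] sub] by simp
    then show ?thesis using K2 by simp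
  qed
qed

text \<open>
  Count the pairs of some \<open>g\<close> in \<open>G\<close> and some \<open>m\<close> in \<open>M\<close> outside \<open>N\<close> by the conjugate of \<open>m\<close> under \<open>g\<close>.
  Distinct conjugates of \<open>M\<close> share no element outside \<open>N\<close>, so the \<open>g\<close> that lead to the same element form
  one left coset of the normalizer of \<open>M\<close>, which is \<open>M\<close>.
\<close>

lemma card_conjugates_outside:
  assumes N: "subgroup N G" "normalizer G N = carrier G" "N \<subseteq> M"
    and M: "maximal_subgroup M G" "normalizer G M = M"
    and ti: "\<And>g. g \<in> carrier G \<Longrightarrow> conj_by g ` M \<noteq> M \<Longrightarrow> conj_by g ` M \<inter> M \<subseteq> N"
  shows "card ((\<Union>g\<in>carrier G. conj_by g ` M) - N) * card M = card (carrier G) * (card M - card N)"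
proof -
  note sM = maximal_subgroupD[OF M(1)]
  have cM: "M \<subseteq> carrier G" by (rule subgroup.subset[OF sM(1)])
  define U where "U = (\<Union>g\<in>carrier G. conj_by g ` M) - N"
  let ?f = "\<lambda>(g, m). conj_by g m"
  have Nn: "conj_by g n \<in> N \<longleftrightarrow> n \<in> N" if "g \<in> carrier G" "n \<in> carrier G" for g n
  proof
    assume "conj_by g n \<in> N"
    then have "conj_by (inv g) (conj_by g n) \<in> N" using that N(2) by - (rule conj_by_normalizer[OF N(1)], auto)
    then show "n \<in> N" using that by simp
  next
    assume "n \<in> N"
    then show "conj_by g n \<in> N" using that N by (intro conj_by_normalizer[OF N(1)]) auto
  qed
  have img: "?f ` (carrier G \<times> (M - N)) = U"
    using cM by (auto simp: U_def Nn subset_iff image_iff)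
  have fM: "finite M" and fU: "finite U" using finite_subgroup[OF sM(1)] fin unfolding U_def by auto
  have fibre: "card {z \<in> carrier G \<times> (M - N). ?f z = y} = card M" if y: "y \<in> U" for y
  proof -
    obtain g0 m0 where y0: "g0 \<in> carrier G" "m0 \<in> M" "y = conj_by g0 m0" using y by (auto simp: U_def)
    have cm0: "m0 \<in> carrier G" using y0 cM by auto
    have yN: "y \<notin> N" "y \<in> carrier G" using y y0 cm0 by (auto simp: U_def)
    have "bij_betw (\<lambda>x. (g0 \<otimes> x, conj_by (inv x) m0)) M {z \<in> carrier G \<times> (M - N). ?f z = y}"
    proof (rule bij_betw_byWitness[where f' = "\<lambda>(g, m). inv g0 \<otimes> g"])
      show "\<forall>x\<in>M. (case (g0 \<otimes> x, conj_by (inv x) m0) of (g, m) \<Rightarrow> inv g0 \<otimes> g) = x"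
        using y0 cM by auto
      have k: "(g0 \<otimes> (inv g0 \<otimes> g), conj_by (inv (inv g0 \<otimes> g)) m0) = (g, m)" "inv g0 \<otimes> g \<in> M"
        if z: "g \<in> carrier G" "m \<in> M - N" "conj_by g m = y" for g m
      proof -
        have cm: "m \<in> carrier G" using z cM by auto
        have gi: "inv g0 \<otimes> g \<in> carrier G" using y0 z by simp
        have e: "conj_by (inv g0 \<otimes> g) m = m0"
        proof -
          have "conj_by (inv g0 \<otimes> g) m = conj_by (inv g0) (conj_by g m)"
            using conj_by_conj_by[of "inv g0" g m] y0 z(1) cm by simp
          also have "\<dots> = m0" using z(3) y0 cm0 by simp
          finally show ?thesis .
        qed
        then have "conj_by (inv (inv g0 \<otimes> g)) m0 = m" using gi cm conj_by_cancel(1) by blast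
        then show "(g0 \<otimes> (inv g0 \<otimes> g), conj_by (inv (inv g0 \<otimes> g)) m0) = (g, m)" using y0 z by simp
        have "m0 \<in> conj_by (inv g0 \<otimes> g) ` M \<inter> M" using e z y0 by auto
        moreover have "m0 \<notin> N" using Nn[OF y0(1) cm0] y0(3) yN by simp
        ultimately have "conj_by (inv g0 \<otimes> g) ` M = M" using ti[OF gi] by auto
        then have "inv g0 \<otimes> g \<in> normalizer G M" using gi sM(1) by (auto simp: mem_normalizer_iff)
        then show "inv g0 \<otimes> g \<in> M" using M(2) by simp
      qed
      show "\<forall>z\<in>{z \<in> carrier G \<times> (M - N). ?f z = y}.
          (g0 \<otimes> (case z of (g, m) \<Rightarrow> inv g0 \<otimes> g), conj_by (inv (case z of (g, m) \<Rightarrow> inv g0 \<otimes> g)) m0) = z"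
        using k(1) by auto
      show "(\<lambda>(g, m). inv g0 \<otimes> g) ` {z \<in> carrier G \<times> (M - N). ?f z = y} \<subseteq> M" using k(2) by auto
      show "(\<lambda>x. (g0 \<otimes> x, conj_by (inv x) m0)) ` M \<subseteq> {z \<in> carrier G \<times> (M - N). ?f z = y}"
      proof (rule image_subsetI)
        fix x assume x: "x \<in> M"
        have cx: "x \<in> carrier G" using x cM by auto
        have "conj_by (inv x) m0 \<in> M"
          using x y0 sM(1) by (intro conj_by_subgroup_closed) (auto intro: subgroup.m_inv_closed)
        moreover have "conj_by (inv x) m0 \<notin> N" using Nn y0 yN cm0 cx by simp
        moreover have "conj_by (g0 \<otimes> x) (conj_by (inv x) m0) = y"
          using y0 cx cm0 by (simp add: conj_by_conj_by m_assoc)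
        ultimately show "(g0 \<otimes> x, conj_by (inv x) m0) \<in> {z \<in> carrier G \<times> (M - N). ?f z = y}"
          using y0 cx by simp
      qed
    qed
    then show ?thesis by (simp add: bij_betw_same_card)
  qed
  have "card (carrier G \<times> (M - N)) = (\<Sum>y\<in>U. card {z \<in> carrier G \<times> (M - N). ?f z = y})"
    using sum.group[of "carrier G \<times> (M - N)" U ?f "\<lambda>_. 1::nat"] fin fM fU by (simp add: img)
  also have "\<dots> = card U * card M" by (simp add: fibre)
  finally show ?thesis using card_Diff_subset[OF finite_subgroup[OF N(1)] N(3)]
    by (simp add: card_cartesian_product U_def)
qed

text \<open>
  The conjugates of a maximal subgroup \<open>M\<close> above \<open>N\<close> cover some of the elements outside \<open>N\<close>, at least
  half the order of \<open>G\<close> in number, but not all of them. An uncovered element \<open>x\<close> lies in another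
  maximal subgroup above \<open>N\<close>, and its conjugates cover again at least half the order of \<open>G\<close>, now in
  other elements; this is more than there are outside \<open>N\<close>. To find that subgroup, take one above the
  centralizer of \<open>x\<close> modulo \<open>N\<close>. The centralizer is proper, because otherwise \<open>x\<close> would normalize \<open>M\<close>,
  which is self-normalizing, and lie in it.
\<close>

lemma no_trivially_intersecting_maximals:
  assumes N: "subgroup N G" "normalizer G N = carrier G" "N \<noteq> carrier G"
    and self: "\<And>M. maximal_subgroup M G \<Longrightarrow> N \<subseteq> M \<Longrightarrow> normalizer G M = M"
    and ti: "\<And>M1 M2. maximal_subgroup M1 G \<Longrightarrow> maximal_subgroup M2 G \<Longrightarrow> N \<subseteq> M1 \<Longrightarrow> N \<subseteq> M2 \<Longrightarrow>
      M1 \<noteq> M2 \<Longrightarrow> M1 \<inter> M2 \<subseteq> N"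
  shows False
proof -
  define U where "U M = (\<Union>g\<in>carrier G. conj_by g ` M) - N" for M
  have cong_N: "N \<subseteq> conj_by g ` M" if "g \<in> carrier G" "N \<subseteq> M" for g M
  proof -
    have "N = conj_by g ` N" using conj_by_image_normalizer[OF N(1)] N(2) that(1) by auto
    then show ?thesis using image_mono[OF that(2)] by metis
  qed
  have card_U: "card (U M) * card M = card (carrier G) * (card M - card N)"
    if "maximal_subgroup M G" "N \<subseteq> M" for M
    unfolding U_def
  proof (rule card_conjugates_outside[OF N(1,2) that(2,1) self[OF that]])
    fix g assume g: "g \<in> carrier G" "conj_by g ` M \<noteq> M"
    show "conj_by g ` M \<inter> M \<subseteq> N"
      by (rule ti[OF maximal_conj_by[OF g(1) that(1)] that(1) cong_N[OF g(1) that(2)] that(2) g(2)])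
  qed
  have half: "2 * card (U M) \<ge> card (carrier G)" if M: "maximal_subgroup M G" "N \<subseteq> M" for M
  proof -
    note sM = maximal_subgroupD[OF M(1)]
    have "N \<noteq> M" using self[OF M] N(2) sM(2) by auto
    then have "card N < card M" using finite_subgroup[OF sM(1)] M(2) by (simp add: psubset_card_mono psubsetI)
    moreover obtain c where c: "card M = card N * c" using card_dvd[OF N(1) sM(1) M(2)] by blast
    ultimately have "c \<noteq> 0" "c \<noteq> 1" by auto
    then have "2 \<le> c" by simp
    then have "card N * 2 \<le> card M" unfolding c by (rule mult_le_mono2)
    then have "card M \<le> 2 * (card M - card N)" by linarith
    then have "card (carrier G) * card M \<le> card (carrier G) * (2 * (card M - card N))" by (rule mult_le_mono2)
    also have "\<dots> = 2 * card (U M) * card M" using card_U[OF M] by simp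
    finally show ?thesis using card_subgroup_pos[OF sM(1)] by simp
  qed
  obtain M1 where M1: "maximal_subgroup M1 G" "N \<subseteq> M1" using exists_maximal_subgroup[OF N(1,3)] by auto
  note sM1 = maximal_subgroupD[OF M1(1)]
  have cN: "N \<subseteq> carrier G" by (rule subgroup.subset[OF N(1)])
  have cM1: "M1 \<subseteq> carrier G" by (rule subgroup.subset[OF sM1(1)])
  have Usub: "U M \<subseteq> carrier G - N" if "maximal_subgroup M G" for M
    using subgroup.subset[OF maximal_subgroupD(1)[OF that]] by (auto simp: U_def)
  have "U M1 \<noteq> carrier G - N"
  proof
    assume e: "U M1 = carrier G - N"
    have "card (U M1) = card (carrier G) - card N" unfolding e
      by (rule card_Diff_subset[OF finite_subgroup[OF N(1)] cN])
    then have "(card (carrier G) - card N) * card M1 = card (carrier G) * (card M1 - card N)" using card_U[OF M1] by simp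
    moreover obtain a where a: "card M1 = card N + a"
      using card_mono[OF finite_subgroup[OF sM1(1)] M1(2)] le_Suc_ex by blast
    moreover obtain b where b: "card (carrier G) = card N + a + b"
      using card_mono[OF fin cM1] a le_Suc_ex by metis
    ultimately have "b * card N = 0" by (simp add: algebra_simps)
    then have "card M1 = card (carrier G)" using a b card_subgroup_pos[OF N(1)] by simp
    then show False using sM1(2) subgroup_eq_card[OF subgroup_self cM1] by simp
  qed
  then obtain x where x: "x \<in> carrier G" "x \<notin> N" "x \<notin> U M1" using Usub[OF M1(1)] by auto
  \<comment> \<open>the centralizer of \<open>x\<close> modulo \<open>N\<close>\<close>
  define Z where "Z = {g \<in> carrier G. conj_by g x \<otimes> inv x \<in> N}"
  have Z: "subgroup Z G" unfolding Z_def by (rule subgroup_commuting_modulo[OF N(1,2) x(1)])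
  have NZ: "N \<subseteq> Z"
  proof
    fix n assume n: "n \<in> N"
    have cn: "n \<in> carrier G" using n cN by auto
    have "n \<otimes> conj_by x (inv n) \<in> N"
      using n x(1) N by (intro subgroup.m_closed[OF N(1)] conj_by_normalizer[OF N(1)] subgroup.m_inv_closed[OF N(1)]) auto
    moreover have "n \<otimes> conj_by x (inv n) = conj_by n x \<otimes> inv x" using cn x(1) by (simp add: conj_by_def m_assoc)
    ultimately show "n \<in> Z" using cn by (simp add: Z_def)
  qed
  have xZ: "x \<in> Z" using x(1) N(1) by (simp add: Z_def conj_by_def m_assoc subgroup.one_closed)
  have xM1: "x \<notin> M1"
  proof
    assume "x \<in> M1"
    then have "x \<in> conj_by \<one> ` M1" using cM1 by (force simp: subset_iff image_iff)
    then show False using x by (auto simp: U_def)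
  qed
  have "Z \<noteq> carrier G"
  proof
    assume "Z = carrier G"
    have "conj_by x m \<in> M1" if m: "m \<in> M1" for m
    proof -
      have cm: "m \<in> carrier G" using m cM1 by auto
      then have "conj_by m x \<otimes> inv x \<in> N" using \<open>Z = carrier G\<close> by (auto simp: Z_def)
      then have "inv (conj_by m x \<otimes> inv x) \<otimes> m \<in> M1"
        using M1(2) m by - (rule subgroup.m_closed[OF sM1(1) subgroup.m_inv_closed[OF sM1(1)]], auto)
      moreover have "inv (conj_by m x \<otimes> inv x) \<otimes> m = conj_by x m"
        using cm x(1) by (simp add: conj_by_def m_assoc inv_mult_group)
      ultimately show ?thesis by simp
    qed
    then have "x \<in> normalizer G M1" using x(1) sM1(1) by (simp add: mem_normalizer_iff)
    then show False using self[OF M1] xM1 by simp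
  qed
  then obtain M2 where M2: "maximal_subgroup M2 G" "Z \<subseteq> M2" using exists_maximal_subgroup[OF Z] by auto
  have NM2: "N \<subseteq> M2" using M2 NZ by auto
  have cM2: "M2 \<subseteq> carrier G" by (rule subgroup.subset[OF maximal_subgroupD(1)[OF M2(1)]])
  have "U M1 \<inter> U M2 = {}"
  proof (rule ccontr)
    assume "U M1 \<inter> U M2 \<noteq> {}"
    then obtain y g1 g2 where y: "y \<notin> N" "g1 \<in> carrier G" "g2 \<in> carrier G"
      "y \<in> conj_by g1 ` M1 \<inter> conj_by g2 ` M2" by (auto simp: U_def)
    have "conj_by g1 ` M1 = conj_by g2 ` M2"
      using ti[OF maximal_conj_by[OF y(2) M1(1)] maximal_conj_by[OF y(3) M2(1)] cong_N[OF y(2) M1(2)] cong_N[OF y(3) NM2]] y(1,4) by auto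
    then have "M2 = conj_by (inv g2) ` conj_by g1 ` M1" using y(3) cM2 by simp
    also have "\<dots> = conj_by (inv g2 \<otimes> g1) ` M1" using y cM1 by (simp add: conj_by_image_mult)
    finally have "x \<in> conj_by (inv g2 \<otimes> g1) ` M1" using xZ M2(2) by auto
    then show False using x y(2,3) by (auto simp: U_def)
  qed
  moreover have "finite (U M1)" "finite (U M2)" using Usub M1(1) M2(1) fin by (meson finite_Diff finite_subset)+
  ultimately have "card (U M1) + card (U M2) = card (U M1 \<union> U M2)" by (simp add: card_Un_disjoint)
  also have "\<dots> \<le> card (carrier G - N)" using Usub M1(1) M2(1) fin by (intro card_mono) auto
  also have "\<dots> < card (carrier G)"
    using fin subgroup.one_closed[OF N(1)] by (intro psubset_card_mono) auto
  finally show False using half[OF M1] half[OF M2(1) NM2] by linarith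
qed

lemma exists_sylow_outside:
  assumes D: "subgroup D G" and N: "subgroup N G" "\<not> D \<subseteq> N"
  obtains p T where "Factorial_Ring.prime p" "p_sylow p T D" "\<not> T \<subseteq> N"
proof -
  have DN: "subgroup (D \<inter> N) G" using D N(1) by (rule subgroups_Inter_pair)
  have "D \<inter> N \<noteq> D" using N(2) by auto
  then obtain p where p: "Factorial_Ring.prime p" "\<not> p ^ multiplicity p (card D) dvd card (D \<inter> N)"
    using subgroup_eqI_prime_powers[OF DN D] by auto
  obtain T where T: "p_sylow p T D" using p_sylow_exists[OF D p(1)] by auto
  note sT = p_sylowD[OF T]
  have "\<not> T \<subseteq> N"
  proof
    assume "T \<subseteq> N"
    then have "card T dvd card (D \<inter> N)" using sT(2) by (intro card_dvd[OF sT(1) DN]) auto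
    then show False using p(2) sT(3) by simp
  qed
  then show thesis using that p(1) T by blast
qed

text \<open>
  The hypothesis \<open>no_p_normal\<close> says that \<open>G/N\<close> has no nontrivial normal subgroup of prime power order. Then every
  Sylow subgroup \<open>S\<close> outside \<open>N\<close> has a nilpotent maximal normalizer, which contains \<open>N\<close>.
  
  No maximal \<open>M\<close> above \<open>N\<close> is normal. Otherwise take a prime \<open>p\<close> dividing its index, with Sylow subgroup
  \<open>P\<close>; the index is then a power of \<open>p\<close>, so \<open>M\<close> contains the Sylow subgroups \<open>Q\<close> for the other
  primes. If \<open>Q\<close> is not inside \<open>N\<close>, the nilpotent normalizer \<open>L\<close> of \<open>Q\<close> is not inside \<open>M\<close> by the Frattini
  argument, so its Sylow \<open>p\<close>-subgroup \<open>T\<close> is not inside \<open>N\<close>. Since \<open>L\<close> is then the normalizer of \<open>T\<close>, the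
  group \<open>T\<close> is even a Sylow \<open>p\<close>-subgroup of \<open>G\<close>, and a conjugate of \<open>Q\<close> normalizes \<open>P\<close>. So the normalizer
  of \<open>P\<close> has order divisible by every prime power dividing that of \<open>G\<close>, although it is proper.
  
  So all maximal subgroups above \<open>N\<close> are nilpotent and self-normalizing. If two of them meet outside \<open>N\<close>,
  choose a pair \<open>A\<close>, \<open>B\<close> with largest intersection \<open>D\<close>. The normalizer of \<open>D\<close> is proper, since otherwise a
  Sylow subgroup of the nilpotent group \<open>D\<close> would contradict \<open>no_p_normal\<close>. It grows in both \<open>A\<close> and \<open>B\<close>, so a
  maximal subgroup above it meets \<open>A\<close> and \<open>B\<close> in more than \<open>D\<close> and must equal both.
\<close>

lemma no_normal_p_subgroups_impossible:
  assumes star: "maximals_nilpotent_or_normal"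
    and N: "subgroup N G" "normalizer G N = carrier G" "N \<noteq> carrier G"
    and no_p_normal: "\<And>r T k. Factorial_Ring.prime r \<Longrightarrow> subgroup T G \<Longrightarrow> card T = r ^ k \<Longrightarrow>
      normalizer G (N <#> T) = carrier G \<Longrightarrow> T \<subseteq> N"
  shows False
proof (rule no_trivially_intersecting_maximals[OF N])
  have cN: "N \<subseteq> carrier G" by (rule subgroup.subset[OF N(1)])
  have NT: "normalizer G (N <#> T) = L"
    if L: "maximal_subgroup L G" "L \<subseteq> normalizer G T" and T: "subgroup T G" "card T = r ^ k" "\<not> T \<subseteq> N"
      and r: "Factorial_Ring.prime r" for L T r k
  proof -
    note nm = normalizer_mult_normal[OF N(1,2) T(1)]
    have "normalizer G (N <#> T) \<noteq> carrier G" using no_p_normal[OF r T(1,2)] T(3) by auto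
    moreover have "L \<subseteq> normalizer G (N <#> T)" using L(2) nm(2) by auto
    ultimately show ?thesis using maximal_subgroupD(3)[OF L(1) subgroup_normalizer[OF nm(1)]] by auto
  qed
  have B1: "maximal_subgroup (normalizer G S) G" "nilpotent (normalizer G S)" "N \<subseteq> normalizer G S"
    if r: "Factorial_Ring.prime r" and S: "p_sylow r S (carrier G)" "\<not> S \<subseteq> N" for r S
  proof -
    note sS = p_sylowD[OF S(1)]
    note nm = normalizer_mult_normal[OF N(1,2) sS(1)]
    have "normalizer G (N <#> S) \<noteq> carrier G" using no_p_normal[OF r sS(1,3)] S(2) by auto
    then have "normalizer G S \<noteq> carrier G" using nm(2) normalizer_subset_carrier[OF nm(1)] by auto
    from sylow_normalizer_maximal[OF star r S(1) this]
    show m: "maximal_subgroup (normalizer G S) G" "nilpotent (normalizer G S)" .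
    have "normalizer G (N <#> S) = normalizer G S" by (rule NT[OF m(1) order_refl sS(1,3) S(2) r])
    then show "N \<subseteq> normalizer G S"
      using subset_set_mult[OF N(1) sS(1)] subset_normalizer[OF nm(1)] by auto
  qed
  have not_normal: False if M: "maximal_subgroup M G" "N \<subseteq> M" "normalizer G M = carrier G" for M
  proof -
    note sM = maximal_subgroupD[OF M(1)]
    have cM: "M \<subseteq> carrier G" by (rule subgroup.subset[OF sM(1)])
    have "\<not> carrier G \<subseteq> M" using sM(2) cM by auto
    then obtain p P where p: "Factorial_Ring.prime p" and P: "p_sylow p P (carrier G)" "\<not> P \<subseteq> M"
      using exists_sylow_outside[OF subgroup_self sM(1)] by metis
    note sP = p_sylowD[OF P(1)]
    have PN: "\<not> P \<subseteq> N" using P(2) M(2) by auto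
    note LP = B1[OF p P(1) PN]
    have "M <#> P = carrier G"
    proof -
      have "subgroup (M <#> P) G" by (rule normalizer_mult_normal[OF sM(1) M(3) sP(1)])
      then show ?thesis using sM(3)[of "M <#> P"] subset_set_mult[OF sM(1) sP(1)] P(2) by blast
    qed
    then have cMP: "card (carrier G) * card (M \<inter> P) = card M * card P" using card_set_mult[OF sM(1) sP(1)] by simp
    have "q ^ multiplicity q (card (carrier G)) dvd card (normalizer G P)" if q: "Factorial_Ring.prime q" for q
    proof (cases "q = p")
      case True
      then show ?thesis using card_dvd[OF sP(1) maximal_subgroupD(1)[OF LP(1)] subset_normalizer[OF sP(1)]] sP(3) by simp
    next
      case qp: False
      obtain Q where Q: "p_sylow q Q M" using p_sylow_exists[OF sM(1) q] by auto
      note sQ = p_sylowD[OF Q]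
      have "card (carrier G) dvd p ^ multiplicity p (card (carrier G)) * card M"
        using cMP sP(3) by (metis dvd_triv_left mult.commute)
      then have "q ^ multiplicity q (card (carrier G)) dvd card M" by (rule prime_power_dvd_of_dvd_mult[OF p q qp])
      then have "multiplicity q (card M) = multiplicity q (card (carrier G))"
        using q card_dvd[OF sM(1) subgroup_self cM] card_subgroup_pos[OF sM(1)] card_subgroup_pos[OF subgroup_self]
        by (intro antisym dvd_imp_multiplicity_le multiplicity_geI) auto
      then have Q': "p_sylow q Q (carrier G)" using sQ cM by (auto simp: p_sylow_def)
      note sQ' = p_sylowD[OF Q']
      show ?thesis
      proof (cases "Q \<subseteq> N")
        case True
        then have "Q \<subseteq> normalizer G P" using LP(3) by auto
        then show ?thesis using card_dvd[OF sQ(1) maximal_subgroupD(1)[OF LP(1)]] sQ'(3) by simp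
      next
        case False
        let ?L = "normalizer G Q"
        note LQ = B1[OF q Q' False]
        note sL = maximal_subgroupD[OF LQ(1)]
        have "\<not> ?L \<subseteq> M" using frattini[OF sM(1) q Q sM(1)] M(3) sM(2) cM by auto
        have MIL: "subgroup (M \<inter> ?L) G" using sM(1) sL(1) by (rule subgroups_Inter_pair)
        obtain T where T: "p_sylow p T ?L" using p_sylow_exists[OF sL(1) p] by auto
        note sT = p_sylowD[OF T]
        have "\<not> T \<subseteq> M"
        proof
          assume "T \<subseteq> M"
          have "\<not> M \<subseteq> ?L" using sM(3)[OF sL(1)] sL(2) \<open>\<not> ?L \<subseteq> M\<close> by auto
          then have "M <#> ?L = carrier G" by (rule maximal_set_mult[OF sM(1) M(3) LQ(1)])
          then have "card (carrier G) * card (M \<inter> ?L) = card M * card ?L" using card_set_mult[OF sM(1) sL(1)] by simp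
          then have "card M * card ?L * card (M \<inter> P) = card (carrier G) * card (M \<inter> ?L) * card (M \<inter> P)" by simp
          also have "\<dots> = card (carrier G) * card (M \<inter> P) * card (M \<inter> ?L)" by (simp only: mult_ac)
          also have "\<dots> = card M * card P * card (M \<inter> ?L)" by (simp only: cMP)
          finally have "card M * (card ?L * card (M \<inter> P)) = card M * (card (M \<inter> ?L) * card P)" by (simp only: mult_ac)
          then have "card ?L * card (M \<inter> P) = card (M \<inter> ?L) * card P" using card_subgroup_pos[OF sM(1)] by simp
          then have "card ?L dvd card (M \<inter> ?L) * p ^ multiplicity p (card (carrier G))" using sP(3) by (metis dvd_triv_left)
          moreover have "p ^ multiplicity p (card ?L) dvd card (M \<inter> ?L)"
            using card_dvd[OF sT(1) MIL] \<open>T \<subseteq> M\<close> sT by auto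
          ultimately have "M \<inter> ?L = ?L" using index_p_power_eq[OF p MIL sL(1)] by auto
          then show False using \<open>\<not> ?L \<subseteq> M\<close> by auto
        qed
        then have TN: "\<not> T \<subseteq> N" using M(2) by auto
        have LT: "?L \<subseteq> normalizer G T" using LQ(2) nilpotent_iff_sylow[OF sL(1)] T p by auto
        have "normalizer G (N <#> T) = ?L" by (rule NT[OF LQ(1) LT sT(1,3) TN p])
        then have "normalizer G T = ?L" using normalizer_mult_normal(2)[OF N(1,2) sT(1)] LT by auto
        then have T': "p_sylow p T (carrier G)" using p_sylow_lift[OF p sL(1) T] by auto
        note sT' = p_sylowD[OF T']
        obtain g where g: "g \<in> carrier G" "conj_by g ` T \<subseteq> P"
          using p_subgroup_conj_into[OF subgroup_self p P(1) sT'] by auto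
        have cT: "T \<subseteq> carrier G" and cQ: "Q \<subseteq> carrier G" using sT'(2) sQ'(2) by auto
        have "conj_by g ` T = P" using subgroup_eq_card[OF sP(1) g(2)] card_conj_by[OF g(1) cT] sT'(3) sP(3) by simp
        moreover have "Q \<subseteq> normalizer G T" using \<open>normalizer G T = ?L\<close> subset_normalizer[OF sQ(1)] by auto
        ultimately have "conj_by g ` Q \<subseteq> normalizer G P" using conj_by_normalizer_image[OF sT(1) g(1)] by auto
        then have "card (conj_by g ` Q) dvd card (normalizer G P)"
          by (rule card_dvd[OF subgroup_conj_by[OF g(1) sQ(1)] maximal_subgroupD(1)[OF LP(1)]])
        then show ?thesis using card_conj_by[OF g(1) cQ] sQ'(3) by simp
      qed
    qed
    then have "normalizer G P = carrier G"
      using subgroup_eqI_prime_powers[OF subgroup_normalizer[OF sP(1)] subgroup_self normalizer_subset_carrier[OF sP(1)]] by blast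
    then show False using maximal_subgroupD(2)[OF LP(1)] by simp
  qed
  show self: "normalizer G M = M" if "maximal_subgroup M G" "N \<subseteq> M" for M
    using maximal_normalizer[OF that(1)] not_normal[OF that] by auto
  have nil: "nilpotent M" if "maximal_subgroup M G" "N \<subseteq> M" for M
    using star that not_normal[OF that] by (auto simp: maximals_nilpotent_or_normal_def)
  show "M1 \<inter> M2 \<subseteq> N"
    if M12: "maximal_subgroup M1 G" "maximal_subgroup M2 G" "N \<subseteq> M1" "N \<subseteq> M2" "M1 \<noteq> M2" for M1 M2
  proof (rule ccontr)
    assume "\<not> M1 \<inter> M2 \<subseteq> N"
    let ?bad = "\<lambda>(A, B). maximal_subgroup A G \<and> maximal_subgroup B G \<and> N \<subseteq> A \<and> N \<subseteq> B \<and> A \<noteq> B \<and> \<not> A \<inter> B \<subseteq> N"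
    have "?bad (M1, M2)" using M12 \<open>\<not> M1 \<inter> M2 \<subseteq> N\<close> by auto
    moreover have "\<forall>z. ?bad z \<longrightarrow> card (fst z \<inter> snd z) < Suc (card (carrier G))"
    proof (intro allI impI)
      fix z assume "?bad z"
      then have "subgroup (fst z) G" using maximal_subgroupD(1) by (simp add: case_prod_beta)
      then have "fst z \<inter> snd z \<subseteq> carrier G" using subgroup.subset by blast
      then show "card (fst z \<inter> snd z) < Suc (card (carrier G))" using card_mono[OF fin] by (simp add: less_Suc_eq_le)
    qed
    ultimately have "\<exists>z. ?bad z \<and> (\<forall>y. ?bad y \<longrightarrow> card (fst y \<inter> snd y) \<le> card (fst z \<inter> snd z))"
      by (rule Lattices_Big.ex_has_greatest_nat)
    then obtain z where z: "?bad z \<and> (\<forall>y. ?bad y \<longrightarrow> card (fst y \<inter> snd y) \<le> card (fst z \<inter> snd z))" ..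
    obtain A B where AB: "z = (A, B)" by (cases z)
    have mA: "maximal_subgroup A G" "N \<subseteq> A" and mB: "maximal_subgroup B G" "N \<subseteq> B" and neq: "A \<noteq> B" and out: "\<not> A \<inter> B \<subseteq> N"
      using z AB by auto
    have max: "card (C \<inter> D) \<le> card (A \<inter> B)"
      if "maximal_subgroup C G" "maximal_subgroup D G" "N \<subseteq> C" "N \<subseteq> D" "C \<noteq> D" "\<not> C \<inter> D \<subseteq> N" for C D
      using conjunct2[OF z, rule_format, of "(C, D)"] that AB by simp
    note sA = maximal_subgroupD[OF mA(1)] and sB = maximal_subgroupD[OF mB(1)]
    have D: "subgroup (A \<inter> B) G" using sA(1) sB(1) by (rule subgroups_Inter_pair)
    have nD: "nilpotent (A \<inter> B)" using nilpotent_subgroup[OF sA(1) nil[OF mA] D] by auto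
    have "normalizer G (A \<inter> B) \<noteq> carrier G"
    proof
      assume n: "normalizer G (A \<inter> B) = carrier G"
      obtain p T where p: "Factorial_Ring.prime p" and T: "p_sylow p T (A \<inter> B)" "\<not> T \<subseteq> N"
        using exists_sylow_outside[OF D N(1) out] by metis
      note sT = p_sylowD[OF T(1)]
      have nT: "A \<inter> B \<subseteq> normalizer G T" using nD nilpotent_iff_sylow[OF D] p T(1) by auto
      have "conj_by g t \<in> T" if g: "g \<in> carrier G" and t: "t \<in> T" for g t
      proof -
        have cT: "T \<subseteq> carrier G" by (rule subgroup.subset[OF sT(1)])
        have "conj_by g ` T \<subseteq> A \<inter> B" using conj_by_normalizer[OF D, of g] n g sT(2) by blast
        then have "conj_by g ` T \<subseteq> T"
          using p_subgroup_subset_normal_sylow[OF D p T(1) nT subgroup_conj_by[OF g sT(1)]] card_conj_by[OF g cT] sT(3) by simp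
        then show ?thesis using t by auto
      qed
      then have "normalizer G T = carrier G" using sT(1) by (auto simp: mem_normalizer_iff)
      then have "normalizer G (N <#> T) = carrier G"
        using normalizer_mult_normal[OF N(1,2) sT(1)] normalizer_subset_carrier by blast
      then show False using no_p_normal[OF p sT(1,3)] T(2) by simp
    qed
    then obtain M3 where M3: "maximal_subgroup M3 G" "normalizer G (A \<inter> B) \<subseteq> M3"
      using exists_maximal_subgroup[OF subgroup_normalizer[OF D]] by auto
    have DM3: "A \<inter> B \<subseteq> M3" using subset_normalizer[OF D] M3(2) by auto
    have NM3: "N \<subseteq> M3" using DM3 mA(2) mB(2) by auto
    have same: "C = M3" if C: "maximal_subgroup C G" "N \<subseteq> C" "A \<inter> B \<subset> C" for C
    proof (rule ccontr)
      note sC = maximal_subgroupD[OF C(1)]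
      assume "C \<noteq> M3"
      then have le: "card (C \<inter> M3) \<le> card (A \<inter> B)"
        using max[OF C(1) M3(1) C(2) NM3] out C(3) DM3 by blast
      obtain x where x: "x \<in> C" "x \<notin> A \<inter> B" "x \<in> normalizer G (A \<inter> B)"
        using nilpotent_normalizer_grows_in[OF sC(1) nil[OF C(1,2)] D C(3)] by auto
      then have "A \<inter> B \<subset> C \<inter> M3" using C(3) DM3 M3(2) by auto
      then have "card (A \<inter> B) < card (C \<inter> M3)"
        using finite_subgroup[OF sC(1)] by (intro psubset_card_mono) auto
      then show False using le by simp
    qed
    have "A \<inter> B \<subset> A" "A \<inter> B \<subset> B" using neq sA sB by blast+
    from same[OF mA this(1)] same[OF mB this(2)] show False using neq by simp
  qed
qed

text \<open>
  Induction on the index of \<open>N\<close>: by \<open>no_normal_p_subgroups_impossible\<close> some group of prime power order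
  can be adjoined to \<open>N\<close>, and \<open>exists_normal_sylow_modulo_step\<close> carries the claim for the larger normal
  subgroup back to \<open>N\<close>.
\<close>

lemma exists_normal_sylow_modulo:
  assumes star: "maximals_nilpotent_or_normal"
    and N: "subgroup N G" "normalizer G N = carrier G" "N \<noteq> carrier G"
  shows "\<exists>p S. Factorial_Ring.prime p \<and> p_sylow p S (carrier G) \<and> \<not> S \<subseteq> N \<and> normalizer G (N <#> S) = carrier G"
  using N
proof (induction "card (carrier G) - card N" arbitrary: N rule: less_induct)
  case less
  note N = less.prems
  have "\<exists>r T k. Factorial_Ring.prime r \<and> subgroup T G \<and> card T = r ^ k \<and> normalizer G (N <#> T) = carrier G \<and> \<not> T \<subseteq> N"
    using no_normal_p_subgroups_impossible[OF star N] by blast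
  then obtain r T k where r: "Factorial_Ring.prime r" and T: "subgroup T G" "card T = r ^ k" "\<not> T \<subseteq> N"
    and R: "normalizer G (N <#> T) = carrier G" by blast
  have R': "subgroup (N <#> T) G" by (rule normalizer_mult_normal[OF N(1,2) T(1)])
  have NR: "N \<subset> N <#> T" using subset_set_mult[OF N(1) T(1)] T(3) by auto
  show ?case
  proof (cases "N <#> T = carrier G")
    case True
    obtain S where S: "p_sylow r S (carrier G)" "T \<subseteq> S"
      using p_sylow_above[OF r subgroup_self T(1) _ T(2)] subgroup.subset[OF T(1)] by auto
    note sS = p_sylowD[OF S(1)]
    have "N <#> T \<subseteq> N <#> S"
      using set_mult_subset[OF normalizer_mult_normal(1)[OF N(1,2) sS(1)]] subset_set_mult[OF N(1) sS(1)] S(2) by blast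
    then have "carrier G \<subseteq> N <#> S" using True by simp
    then have "N <#> S = carrier G" using subgroup.subset[OF normalizer_mult_normal(1)[OF N(1,2) sS(1)]] by auto
    then have "normalizer G (N <#> S) = carrier G" using subset_normalizer[OF subgroup_self] normalizer_subset_carrier[OF subgroup_self] by auto
    then show ?thesis using r S T(3) by blast
  next
    case False
    have "card N < card (N <#> T)" using NR finite_subgroup[OF R'] by (simp add: psubset_card_mono)
    moreover have "card (N <#> T) \<le> card (carrier G)" using subgroup.subset[OF R'] fin by (simp add: card_mono)
    ultimately have "card (carrier G) - card (N <#> T) < card (carrier G) - card N" by linarith
    from less.hyps[OF this R' R False]
    obtain s S where "Factorial_Ring.prime s" "p_sylow s S (carrier G)" "\<not> S \<subseteq> N <#> T"
      "normalizer G (N <#> T <#> S) = carrier G" by blast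
    then show ?thesis using exists_normal_sylow_modulo_step[OF star N(1,2) r T refl R] by blast
  qed
qed

section \<open>Products of Sylow subgroups\<close>

text \<open>
  Since the factors are normalized by a group containing all of them, the generated subgroup is their
  product, built up one factor at a time.
\<close>

lemma generate_normalized_family:
  assumes I: "finite I" and K: "subgroup K G"
    and R: "\<And>i. i \<in> I \<Longrightarrow> subgroup (R i) G" "\<And>i. i \<in> I \<Longrightarrow> R i \<subseteq> K" "\<And>i. i \<in> I \<Longrightarrow> K \<subseteq> normalizer G (R i)"
  shows "subgroup (generate G (\<Union>i\<in>I. R i)) G \<and> generate G (\<Union>i\<in>I. R i) \<subseteq> K \<and>
    K \<subseteq> normalizer G (generate G (\<Union>i\<in>I. R i)) \<and> card (generate G (\<Union>i\<in>I. R i)) dvd (\<Prod>i\<in>I. card (R i))"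
  using I R
proof (induction I)
  case empty
  have "normalizer G {\<one>} = carrier G" using one_is_normal normal_iff_normalizer by blast
  then show ?case using K by (auto simp: generate_empty triv_subgroup subgroup.one_closed dest: subgroup.subset)
next
  case (insert i I)
  let ?D = "generate G (\<Union>i\<in>I. R i)"
  have D: "subgroup ?D G" "?D \<subseteq> K" "K \<subseteq> normalizer G ?D" "card ?D dvd (\<Prod>i\<in>I. card (R i))"
    using insert.IH[OF insert.prems] by auto
  note Ri = insert.prems(1)[of i, simplified] insert.prems(2)[of i, simplified] insert.prems(3)[of i, simplified]
  have RD: "subgroup (R i <#> ?D) G" using subgroup_set_mult[OF Ri(1) D(1)] D(2) Ri(3) by auto
  note sub = subset_set_mult[OF Ri(1) D(1)]
  have "(\<Union>j\<in>I. R j) \<subseteq> carrier G" using insert.prems(1) by (auto dest: subgroup.subset)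
  then have inD: "(\<Union>j\<in>I. R j) \<subseteq> ?D" by (auto intro: generate.incl)
  have "generate G (\<Union>j\<in>insert i I. R j) = R i <#> ?D"
  proof
    show "generate G (\<Union>j\<in>insert i I. R j) \<subseteq> R i <#> ?D"
      using sub inD by (intro generate_subgroup_incl[OF _ RD]) auto
    have "(\<Union>j\<in>insert i I. R j) \<subseteq> carrier G" using insert.prems(1) by (auto dest: subgroup.subset)
    then have g: "subgroup (generate G (\<Union>j\<in>insert i I. R j)) G" by (rule generate_is_subgroup)
    have "?D \<subseteq> generate G (\<Union>j\<in>insert i I. R j)" by (rule mono_generate) auto
    moreover have "R i \<subseteq> generate G (\<Union>j\<in>insert i I. R j)" by (auto intro: generate.incl)
    ultimately show "R i <#> ?D \<subseteq> generate G (\<Union>j\<in>insert i I. R j)" using set_mult_subset[OF g] by blast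
  qed
  moreover have "R i <#> ?D \<subseteq> K" by (rule set_mult_subset[OF K Ri(2) D(2)])
  moreover have "K \<subseteq> normalizer G (R i <#> ?D)" using normalizer_set_mult[OF Ri(1) D(1) RD] Ri(3) D(3) by auto
  moreover have "card (R i <#> ?D) dvd card (R i) * (\<Prod>i\<in>I. card (R i))"
    using card_set_mult_dvd[OF Ri(1) D(1)] D(4) by (meson dvd_trans mult_dvd_mono dvd_refl)
  ultimately show ?case using RD insert.hyps by simp
qed

text \<open>
  As the primes are distinct, the order of a factor is coprime to that of the product of the others.
\<close>

lemma internal_direct_product_p_groups:
  assumes I: "finite I" and K: "subgroup K G"
    and R: "\<And>i. i \<in> I \<Longrightarrow> subgroup (R i) G" "\<And>i. i \<in> I \<Longrightarrow> R i \<subseteq> K" "\<And>i. i \<in> I \<Longrightarrow> K \<subseteq> normalizer G (R i)"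
    and p: "\<And>i. i \<in> I \<Longrightarrow> Factorial_Ring.prime (p i)" "inj_on p I"
    and c: "\<And>i. i \<in> I \<Longrightarrow> card (R i) = p i ^ e i"
  shows "internal_direct_product G I R (generate G (\<Union>i\<in>I. R i))"
proof -
  let ?D = "\<lambda>J. generate G (\<Union>i\<in>J. R i)"
  have D: "subgroup (?D J) G" "?D J \<subseteq> K" "K \<subseteq> normalizer G (?D J)" "card (?D J) dvd (\<Prod>i\<in>J. card (R i))"
    if "J \<subseteq> I" for J
  proof -
    have fJ: "finite J" using that I finite_subset by blast
    have "subgroup (?D J) G \<and> ?D J \<subseteq> K \<and> K \<subseteq> normalizer G (?D J) \<and> card (?D J) dvd (\<Prod>i\<in>J. card (R i))"
      by (rule generate_normalized_family[OF fJ K]) (rule R[OF subsetD[OF that]], assumption)+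
    then show "subgroup (?D J) G" "?D J \<subseteq> K" "K \<subseteq> normalizer G (?D J)" "card (?D J) dvd (\<Prod>i\<in>J. card (R i))" by auto
  qed
  have "R i \<lhd> G\<lparr>carrier := ?D I\<rparr>" if i: "i \<in> I" for i
    using R[OF i] D[of I] i by (auto simp: normal_in_iff_normalizer intro: generate.incl)
  moreover have "R i \<inter> ?D (I - {i}) = {\<one>}" if i: "i \<in> I" for i
  proof (rule coprime_Int[OF R(1)[OF i] D(1)])
    show "I - {i} \<subseteq> I" by auto
    have "coprime (card (R i)) (\<Prod>j\<in>I - {i}. card (R j))"
    proof (rule prod_coprime_right)
      fix j assume j: "j \<in> I - {i}"
      then have "p i \<noteq> p j" using p(2) i by (auto simp: inj_on_def)
      then have "coprime (p i) (p j)" using p(1) i j by (simp add: primes_coprime)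
      then show "coprime (card (R i)) (card (R j))" using c i j by simp
    qed
    moreover have "card (?D (I - {i})) dvd (\<Prod>j\<in>I - {i}. card (R j))" by (rule D(4)) auto
    ultimately show "coprime (card (R i)) (card (?D (I - {i})))" by (meson coprime_divisors dvd_refl)
  qed
  ultimately show ?thesis using I D(1)[of I] by (simp add: internal_direct_product_def)
qed

lemma prime_dvd_generate:
  assumes I: "finite I" and K: "subgroup K G"
    and R: "\<And>i. i \<in> I \<Longrightarrow> subgroup (R i) G" "\<And>i. i \<in> I \<Longrightarrow> R i \<subseteq> K" "\<And>i. i \<in> I \<Longrightarrow> K \<subseteq> normalizer G (R i)"
    and q: "Factorial_Ring.prime q" "q dvd card (generate G (\<Union>i\<in>I. R i))"
  obtains i where "i \<in> I" "q dvd card (R i)"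
proof -
  have "card (generate G (\<Union>i\<in>I. R i)) dvd (\<Prod>i\<in>I. card (R i))"
    using generate_normalized_family[OF I K, of R] R by auto
  then have "q dvd (\<Prod>i\<in>I. card (R i))" using q(2) dvd_trans by blast
  then have "\<exists>i\<in>I. q dvd card (R i)" using q(1) I by (simp add: prime_dvd_prod_iff)
  then show thesis using that by blast
qed

lemma sylow_subgroup_iff:
  "sylow_subgroup S G \<longleftrightarrow> (\<exists>p. Factorial_Ring.prime p \<and> p dvd card (carrier G) \<and> p_sylow p S (carrier G))"
  by (auto simp: sylow_subgroup_def p_sylow_def order_def dest: subgroup.subset)

lemma normal_sylow_unique:
  assumes p: "Factorial_Ring.prime p" and S: "p_sylow p S H" "H \<subseteq> normalizer G S" and H: "subgroup H G" and T: "p_sylow p T H"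
  shows "T = S"
proof -
  note sS = p_sylowD[OF S(1)] and sT = p_sylowD[OF T]
  have "T \<subseteq> S" by (rule p_subgroup_subset_normal_sylow[OF H p S sT])
  then show ?thesis using subgroup_eq_card[OF sS(1)] sS(3) sT(3) by simp
qed

lemma p_sylow_trivial:
  assumes "p_sylow p S H" "Factorial_Ring.prime p" "\<not> p dvd card H"
  shows "S = {\<one>}"
proof -
  have "card S = 1" using p_sylowD(3)[OF assms(1)] assms(3) by (simp add: not_dvd_imp_multiplicity_0)
  then show ?thesis using subgroup.one_closed[OF p_sylowD(1)[OF assms(1)]] by (metis card_1_singletonE singletonD)
qed

lemma p_sylow_index_coprime:
  assumes p: "Factorial_Ring.prime p" and M: "subgroup M G" "M \<subseteq> H" and H: "subgroup H G"
    and d: "p ^ multiplicity p (card H) dvd card M" and S: "p_sylow p S M"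
  shows "p_sylow p S H"
proof -
  have "multiplicity p (card M) = multiplicity p (card H)"
    using p card_dvd[OF M(1) H M(2)] card_subgroup_pos[OF M(1)] card_subgroup_pos[OF H] d
    by (intro antisym dvd_imp_multiplicity_le multiplicity_geI) auto
  then show ?thesis using p_sylowD[OF S] M(2) by (auto simp: p_sylow_def)
qed

section \<open>From maximal subgroups to the splitting\<close>

definition splitting_structure :: bool where
  "splitting_structure \<longleftrightarrow>
    (\<exists>(s::nat) (t::nat) (P :: nat \<Rightarrow> 'a set) (Q :: nat \<Rightarrow> 'a set) A B H.
       s \<ge> 1 \<and> t \<ge> 1 \<and>
       (\<forall>i \<in> {1..s}. sylow_subgroup (P i) G \<and> P i \<lhd> G) \<and>
       (\<forall>j \<in> {1..t}. sylow_subgroup (Q j) G \<and> \<not> Q j \<lhd> G) \<and>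
       internal_direct_product G {1..<s} P A \<and>
       internal_direct_product G {1..t} Q B \<and>
       internal_semidirect_product G (P s) B H \<and>
       internal_direct_product2 G A H (carrier G) \<and>
       (\<exists>E. subgroup E (G\<lparr>carrier := P s\<rparr>) \<and> E \<lhd> G \<and>
            nilpotent_group (G\<lparr>carrier := E <#>\<^bsub>G\<^esub> B\<rparr>) \<and>
            maximal_subgroup (E <#>\<^bsub>G\<^esub> B) (G\<lparr>carrier := P s <#>\<^bsub>G\<^esub> B\<rparr>)))"

text \<open>
  Let \<open>F\<close> be the product of the normal Sylow subgroups, and \<open>S\<close> a Sylow subgroup outside \<open>F\<close> with \<open>FS\<close>
  normal. Its normalizer \<open>M\<close> is the required maximal subgroup: if it contained \<open>F\<close>, it would contain the
  normal subgroup \<open>FS\<close> and, by the Frattini argument, all of \<open>G\<close>. So it misses some factor of \<open>F\<close>.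
\<close>

lemma exists_nilpotent_maximal:
  assumes star: "maximals_nilpotent_or_normal" and nonnil: "\<not> nilpotent_group G"
  obtains M p P where "maximal_subgroup M G" "nilpotent M"
    "Factorial_Ring.prime p" "p_sylow p P (carrier G)" "normalizer G P = carrier G" "\<not> P \<subseteq> M"
proof -
  define good where "good = {q. Factorial_Ring.prime q \<and> q dvd card (carrier G) \<and>
      (\<exists>S. p_sylow q S (carrier G) \<and> normalizer G S = carrier G)}"
  have fin_good: "finite good"
    using finite_divisors_nat[OF card_subgroup_pos[OF subgroup_self]] by (rule finite_subset[rotated]) (auto simp: good_def)
  define Sy where "Sy q = (SOME S. p_sylow q S (carrier G) \<and> normalizer G S = carrier G)" for q
  have Sy: "p_sylow q (Sy q) (carrier G)" "normalizer G (Sy q) = carrier G" if "q \<in> good" for q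
    using that someI_ex[of "\<lambda>S. p_sylow q S (carrier G) \<and> normalizer G S = carrier G"] by (auto simp: good_def Sy_def)
  define F where "F = generate G (\<Union>q\<in>good. Sy q)"
  have F: "subgroup F G" "F \<subseteq> carrier G" "carrier G \<subseteq> normalizer G F"
    using generate_normalized_family[OF fin_good subgroup_self p_sylowD(1)[OF Sy(1)] p_sylowD(2)[OF Sy(1)]] Sy(2)
    by (simp_all add: F_def)
  have nF: "normalizer G F = carrier G" using F(3) normalizer_subset_carrier[OF F(1)] by auto
  have F_ne: "F \<noteq> carrier G"
  proof
    assume FG: "F = carrier G"
    have "normalizer G S = carrier G" if q: "Factorial_Ring.prime q" and S: "p_sylow q S (carrier G)" for q S
    proof (cases "q dvd card (carrier G)")
      case True
      then have qF: "q dvd card (generate G (\<Union>i\<in>good. Sy i))" using FG by (simp add: F_def)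
      obtain r where r: "r \<in> good" "q dvd card (Sy r)"
        by (rule prime_dvd_generate[OF fin_good subgroup_self p_sylowD(1)[OF Sy(1)] p_sylowD(2)[OF Sy(1)] _ q qF])
          (simp_all add: Sy(2))
      have "q dvd r ^ multiplicity r (card (carrier G))" using r(2) p_sylowD(3)[OF Sy(1)[OF r(1)]] by simp
      then have "q = r" using q r(1) by (metis (no_types, lifting) good_def mem_Collect_eq prime_dvd_power primes_dvd_imp_eq)
      then have "S = Sy r" using normal_sylow_unique[OF q _ _ subgroup_self S, of "Sy r"] Sy[OF r(1)] by auto
      then show ?thesis using Sy(2)[OF r(1)] by simp
    next
      case False
      then have "S = {\<one>}" using p_sylow_trivial[OF S q] by simp
      then show ?thesis using one_is_normal by (simp add: normal_iff_normalizer)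
    qed
    then show False using sylow_normal_imp_nilpotent nonnil by blast
  qed
  obtain s S where s: "Factorial_Ring.prime s" and S: "p_sylow s S (carrier G)" "\<not> S \<subseteq> F"
    "normalizer G (F <#> S) = carrier G"
    using exists_normal_sylow_modulo[OF star F(1) nF F_ne] by blast
  note sS = p_sylowD[OF S(1)]
  have nS: "normalizer G S \<noteq> carrier G"
  proof
    assume n: "normalizer G S = carrier G"
    have "s dvd card (carrier G)"
      using p_sylow_trivial[OF S(1) s] S(2) subgroup.one_closed[OF F(1)] by auto
    then have "s \<in> good" using s S(1) n by (auto simp: good_def)
    then have "S = Sy s" using normal_sylow_unique[OF s _ _ subgroup_self S(1), of "Sy s"] Sy by auto
    then have "S \<subseteq> F" using \<open>s \<in> good\<close> by (auto simp: F_def intro: generate.incl)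
    then show False using S(2) by simp
  qed
  let ?M = "normalizer G S"
  have M: "maximal_subgroup ?M G" "nilpotent ?M" by (rule sylow_normalizer_maximal[OF star s S(1) nS])+
  note sM = maximal_subgroupD[OF M(1)]
  have "\<not> F \<subseteq> ?M"
  proof
    assume "F \<subseteq> ?M"
    have FS: "subgroup (F <#> S) G" by (rule normalizer_mult_normal[OF F(1) nF sS(1)])
    have "F <#> S \<subseteq> ?M" by (rule set_mult_subset[OF sM(1) \<open>F \<subseteq> ?M\<close> subset_normalizer[OF sS(1)]])
    moreover have "p_sylow s S (F <#> S)"
      using p_sylow_mono[OF FS subgroup_self _ S(1) _ s] subset_set_mult[OF F(1) sS(1)] subgroup.subset[OF FS] by auto
    ultimately have "normalizer G (F <#> S) \<subseteq> ?M" using frattini[OF FS s _ sM(1)] by auto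
    then show False using S(3) nS normalizer_subset_carrier[OF sS(1)] by auto
  qed
  then obtain p where p: "p \<in> good" "\<not> Sy p \<subseteq> ?M"
    using generate_subgroup_incl[OF _ sM(1), of "\<Union>q\<in>good. Sy q"] by (auto simp: F_def)
  show thesis by (rule that[OF M _ Sy[OF p(1)] p(2)]) (use p(1) in \<open>simp add: good_def\<close>)
qed

text \<open>
  The intersection is normalized by \<open>M\<close>, and by an element of \<open>P\<close> outside \<open>M\<close> because normalizers grow in
  \<open>P\<close>.
\<close>

lemma normal_p_subgroup_Int_maximal:
  assumes p: "Factorial_Ring.prime p" and P: "subgroup P G" "card P = p ^ k" "normalizer G P = carrier G"
    and M: "maximal_subgroup M G" "\<not> P \<subseteq> M"
  shows "normalizer G (P \<inter> M) = carrier G"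
proof (rule ccontr)
  assume n: "normalizer G (P \<inter> M) \<noteq> carrier G"
  note sM = maximal_subgroupD[OF M(1)]
  have D: "subgroup (P \<inter> M) G" using P(1) sM(1) by (rule subgroups_Inter_pair)
  have "M \<subseteq> normalizer G (P \<inter> M)"
  proof
    fix m assume m: "m \<in> M"
    then have cm: "m \<in> carrier G" using subgroup.mem_carrier[OF sM(1)] by blast
    have "conj_by m x \<in> P \<inter> M" if "x \<in> P \<inter> M" for x
      using that m cm P(3) conj_by_normalizer[OF P(1), of m x] conj_by_subgroup_closed[OF sM(1) m, of x] by auto
    then show "m \<in> normalizer G (P \<inter> M)" using cm D by (simp add: mem_normalizer_iff)
  qed
  then have "normalizer G (P \<inter> M) = M" using sM(3)[OF subgroup_normalizer[OF D]] n by auto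
  moreover obtain x where "x \<in> P" "x \<notin> P \<inter> M" "x \<in> normalizer G (P \<inter> M)"
    using nilpotent_normalizer_grows_in[OF P(1) p_group_nilpotent[OF p P(1,2)] D] M(2) by auto
  ultimately show False by simp
qed

lemma coprime_cardI:
  assumes "\<And>q. Factorial_Ring.prime q \<Longrightarrow> q dvd card A \<Longrightarrow> q dvd card B \<Longrightarrow> False"
  shows "coprime (card A) (card B)"
proof (rule ccontr)
  assume nc: "\<not> coprime (card A) (card B)"
  then have "gcd (card A) (card B) \<noteq> 1" by (simp add: coprime_iff_gcd_eq_1)
  then obtain q where "Factorial_Ring.prime q" "q dvd gcd (card A) (card B)" using prime_factor_nat by blast
  then show False using assms by auto
qed

text \<open>
  The order of \<open>G = PM\<close> shows that, for primes other than \<open>p\<close>, the Sylow subgroups of \<open>M\<close> are Sylow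
  subgroups of \<open>G\<close>, and they are all normalized by \<open>M\<close>. So every subgroup built from them is normalized by \<open>M\<close>; if it is
  also normalized by \<open>P\<close>, it is normal in \<open>G\<close>, which gives the normality of \<open>H = PB\<close>. A subgroup \<open>K\<close>
  between \<open>EB\<close> and \<open>PB\<close> gives a subgroup \<open>AK\<close> above \<open>M = AEB\<close>, which is \<open>M\<close> or \<open>G\<close>; the two cases mean
  \<open>K = EB\<close> and \<open>K = PB\<close>.
\<close>

lemma splitting_structure_of_nilpotent_maximal:
  assumes nonnil: "\<not> nilpotent_group G" and M: "maximal_subgroup M G" "nilpotent M"
    and p: "Factorial_Ring.prime p" and P: "p_sylow p P (carrier G)" "normalizer G P = carrier G" "\<not> P \<subseteq> M"
  shows splitting_structure
proof -
  note sM = maximal_subgroupD[OF M(1)] and sP = p_sylowD[OF P(1)]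
  have cM: "M \<subseteq> carrier G" by (rule subgroup.subset[OF sM(1)])
  have G0: "subgroup (carrier G) G" by (rule subgroup_self)
  have cPM: "card (carrier G) * card (P \<inter> M) = card P * card M"
    using card_set_mult[OF sP(1) sM(1)] maximal_set_mult[OF sP(1) P(2) M(1) P(3)] by simp
  have M_contains: "q ^ multiplicity q (card (carrier G)) dvd card M" if q: "Factorial_Ring.prime q" "q \<noteq> p" for q
  proof (rule prime_power_dvd_of_dvd_mult[OF p q])
    show "card (carrier G) dvd p ^ multiplicity p (card (carrier G)) * card M" using cPM sP(3) by (metis dvd_triv_left)
  qed
  define R where "R q = (SOME S. p_sylow q S M)" for q
  have RM: "p_sylow q (R q) M" if q: "Factorial_Ring.prime q" for q
    using someI_ex[OF p_sylow_exists[OF sM(1) q]] by (simp add: R_def)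
  have RG: "p_sylow q (R q) (carrier G)" if "Factorial_Ring.prime q" "q \<noteq> p" for q
    by (rule p_sylow_index_coprime[OF that(1) sM(1) cM G0 M_contains[OF that] RM[OF that(1)]])
  have RnM: "M \<subseteq> normalizer G (R q)" if q: "Factorial_Ring.prime q" for q
    using M(2) nilpotent_iff_sylow[OF sM(1)] RM[OF q] q by auto
  define good where "good = {q. Factorial_Ring.prime q \<and> q dvd card (carrier G) \<and> q \<noteq> p \<and> normalizer G (R q) = carrier G}"
  define bad where "bad = {q. Factorial_Ring.prime q \<and> q dvd card (carrier G) \<and> q \<noteq> p \<and> normalizer G (R q) \<noteq> carrier G}"
  have fin_div: "finite {q. q dvd card (carrier G)}" using finite_divisors_nat[OF card_subgroup_pos[OF G0]] .
  have fin_good: "finite good" and fin_bad: "finite bad"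
    by (rule finite_subset[OF _ fin_div]; auto simp: good_def bad_def)+
  have p_dvd: "p dvd card (carrier G)"
    using p_sylow_trivial[OF P(1) p] P(3) subgroup.one_closed[OF sM(1)] by auto
  have bad_ne: "bad \<noteq> {}"
  proof
    assume e: "bad = {}"
    have "normalizer G S = carrier G" if q: "Factorial_Ring.prime q" and S: "p_sylow q S (carrier G)" for q S
    proof (cases "q dvd card (carrier G)")
      case True
      show ?thesis
      proof (cases "q = p")
        case True
        then show ?thesis using normal_sylow_unique[OF q _ _ G0 S, of P] P by auto
      next
        case False
        then have "normalizer G (R q) = carrier G" using e q True by (auto simp: bad_def)
        then show ?thesis using normal_sylow_unique[OF q RG[OF q False] _ G0 S] by auto
      qed
    next
      case False
      then have "S = {\<one>}" using p_sylow_trivial[OF S q] by simp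
      then show ?thesis using one_is_normal by (simp add: normal_iff_normalizer)
    qed
    then show False using sylow_normal_imp_nilpotent nonnil by blast
  qed
  obtain g where g: "bij_betw g {1..card good} good" using ex_bij_betw_nat_finite_1[OF fin_good] by auto
  obtain b where b: "bij_betw b {1..card bad} bad" using ex_bij_betw_nat_finite_1[OF fin_bad] by auto
  define s where "s = Suc (card good)"
  define t where "t = card bad"
  have s1: "{1..<s} = {1..card good}" by (auto simp: s_def)
  have t1: "t \<ge> 1" using bad_ne fin_bad by (simp add: t_def Suc_leI card_gt_0_iff)
  \<comment> \<open>the normal Sylow \<open>p\<close>-subgroup has the last index, as the factor on which \<open>B\<close> acts\<close>
  define PP where "PP i = (if i = s then P else R (g i))" for i
  define QQ where "QQ j = R (b j)" for j
  have gi: "g i \<in> good" "PP i = R (g i)" if "i \<in> {1..<s}" for i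
    using that bij_betwE[OF g] by (auto simp: s1 PP_def s_def)
  have bj: "b j \<in> bad" if "j \<in> {1..t}" for j using that bij_betwE[OF b] by (auto simp: t_def)
  have g_inj: "inj_on g {1..<s}" unfolding s1 using g by (rule bij_betw_imp_inj_on)
  have b_inj: "inj_on b {1..t}" unfolding t_def using b by (rule bij_betw_imp_inj_on)
  have goodD: "Factorial_Ring.prime q" "q dvd card (carrier G)" "q \<noteq> p" "normalizer G (R q) = carrier G" if "q \<in> good" for q
    using that by (auto simp: good_def)
  have badD: "Factorial_Ring.prime q" "q dvd card (carrier G)" "q \<noteq> p" "normalizer G (R q) \<noteq> carrier G" if "q \<in> bad" for q
    using that by (auto simp: bad_def)
  define A where "A = generate G (\<Union>i\<in>{1..<s}. PP i)"
  define B where "B = generate G (\<Union>j\<in>{1..t}. QQ j)"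
  have PPi: "subgroup (PP i) G" "PP i \<subseteq> M" "M \<subseteq> normalizer G (PP i)" "carrier G \<subseteq> normalizer G (PP i)"
    "p_sylow (g i) (PP i) (carrier G)" if i: "i \<in> {1..<s}" for i
    using p_sylowD[OF RM[OF goodD(1)[OF gi(1)[OF i]]]] RnM[OF goodD(1)[OF gi(1)[OF i]]]
      goodD[OF gi(1)[OF i]] RG[OF goodD(1,3)[OF gi(1)[OF i]]] by (simp_all add: gi(2)[OF i])
  have QQj: "subgroup (QQ j) G" "QQ j \<subseteq> M" "M \<subseteq> normalizer G (QQ j)" "p_sylow (b j) (QQ j) (carrier G)"
    if j: "j \<in> {1..t}" for j
    using p_sylowD[OF RM[OF badD(1)[OF bj[OF j]]]] RnM[OF badD(1)[OF bj[OF j]]]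
      RG[OF badD(1,3)[OF bj[OF j]]] by (simp_all add: QQ_def)
  have A_prod: "internal_direct_product G {1..<s} PP A"
    unfolding A_def
    by (rule internal_direct_product_p_groups[where K = M and p = g, OF _ sM(1) PPi(1,2,3) goodD(1)[OF gi(1)] g_inj p_sylowD(3)[OF PPi(5)]]) auto
  have B_prod: "internal_direct_product G {1..t} QQ B"
    unfolding B_def
    by (rule internal_direct_product_p_groups[where K = M and p = b, OF _ sM(1) QQj(1,2,3) badD(1)[OF bj] b_inj p_sylowD(3)[OF QQj(4)]]) auto
  have A: "subgroup A G" "A \<subseteq> M" "M \<subseteq> normalizer G A"
    using generate_normalized_family[where R = PP, OF _ sM(1) PPi(1,2,3), of "{1..<s}"] by (auto simp: A_def)
  have nA: "normalizer G A = carrier G"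
    using generate_normalized_family[where R = PP, OF _ G0 PPi(1) p_sylowD(2)[OF PPi(5)] PPi(4), of "{1..<s}"]
      normalizer_subset_carrier[OF A(1)] by (auto simp: A_def)
  have B: "subgroup B G" "B \<subseteq> M" "M \<subseteq> normalizer G B"
    using generate_normalized_family[where R = QQ, OF _ sM(1) QQj(1,2,3), of "{1..t}"] by (auto simp: B_def)
  have prime_A: "q \<in> good" if q: "Factorial_Ring.prime q" "q dvd card A" for q
  proof -
    obtain i where i: "i \<in> {1..<s}" "q dvd card (PP i)"
      by (rule prime_dvd_generate[where R = PP and I = "{1..<s}" and q = q, OF _ sM(1) PPi(1,2,3)]) (use q in \<open>auto simp: A_def\<close>)
    then have "q dvd g i" using q(1) p_sylowD(3)[OF PPi(5)[OF i(1)]] prime_dvd_power by metis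
    then show ?thesis using q(1) goodD(1)[OF gi(1)[OF i(1)]] gi(1)[OF i(1)] primes_dvd_imp_eq by metis
  qed
  have prime_B: "q \<in> bad" if q: "Factorial_Ring.prime q" "q dvd card B" for q
  proof -
    obtain j where j: "j \<in> {1..t}" "q dvd card (QQ j)"
      by (rule prime_dvd_generate[where R = QQ and I = "{1..t}" and q = q, OF _ sM(1) QQj(1,2,3)]) (use q in \<open>auto simp: B_def\<close>)
    then have "q dvd b j" using q(1) p_sylowD(3)[OF QQj(4)[OF j(1)]] prime_dvd_power by metis
    then show ?thesis using q(1) badD(1)[OF bj[OF j(1)]] bj[OF j(1)] primes_dvd_imp_eq by metis
  qed
  have prime_P: "q = p" if "Factorial_Ring.prime q" "q dvd card P" for q
    using that p sP(3) by (metis prime_dvd_power primes_dvd_imp_eq)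
  have R_sub: "R q \<subseteq> A \<union> B" if q: "Factorial_Ring.prime q" "q \<noteq> p" for q
  proof (cases "q dvd card (carrier G)")
    case True
    then have "q \<in> good \<or> q \<in> bad" using q unfolding good_def bad_def by blast
    then consider "q \<in> good" | "q \<in> bad" by blast
    then show ?thesis
    proof cases
      case 1
      moreover have "g ` {1..<s} = good" unfolding s1 using g by (rule bij_betw_imp_surj_on)
      ultimately obtain i where i: "i \<in> {1..<s}" "g i = q" by blast
      have "PP i \<subseteq> A" unfolding A_def using i(1) by (blast intro: generate.incl)
      then have "R q \<subseteq> A" using gi(2)[OF i(1)] i(2) by simp
      then show ?thesis by auto
    next
      case 2
      moreover have "b ` {1..t} = bad" unfolding t_def using b by (rule bij_betw_imp_surj_on)
      ultimately obtain j where j: "j \<in> {1..t}" "b j = q" by blast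
      have "QQ j \<subseteq> B" unfolding B_def using j(1) by (blast intro: generate.incl)
      then have "R q \<subseteq> B" using j(2) by (simp add: QQ_def)
      then show ?thesis by auto
    qed
  next
    case False
    then show ?thesis using p_sylow_trivial[OF RG[OF q] q(1)] subgroup.one_closed[OF A(1)] by auto
  qed
  define H where "H = P <#> B"
  have H: "subgroup H G" and nBH: "normalizer G B \<subseteq> normalizer G H"
    using normalizer_mult_normal[OF sP(1) P(2) B(1)] by (simp_all add: H_def)
  have PH: "P \<subseteq> H" and BH: "B \<subseteq> H" using subset_set_mult[OF sP(1) B(1)] by (simp_all add: H_def)
  have nH: "normalizer G H = carrier G"
  proof (rule ccontr)
    assume n: "normalizer G H \<noteq> carrier G"
    have "M \<subseteq> normalizer G H" using B(3) nBH by auto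
    then have "normalizer G H = M" using sM(3)[OF subgroup_normalizer[OF H]] n by auto
    then show False using P(3) PH subset_normalizer[OF H] by auto
  qed
  have PB: "P \<inter> B = {\<one>}"
    by (rule coprime_Int[OF sP(1) B(1) coprime_cardI]) (use prime_P prime_B badD(3) in blast)
  have AH: "A \<inter> H = {\<one>}"
  proof (rule coprime_Int[OF A(1) H coprime_cardI])
    fix q assume q: "Factorial_Ring.prime q" "q dvd card A" "q dvd card H"
    have "q dvd card P * card B" using q(3) card_set_mult_dvd[OF sP(1) B(1)] dvd_trans by (auto simp: H_def)
    then have "q = p \<or> q \<in> bad" using q(1) prime_P prime_B by (auto simp: prime_dvd_mult_iff)
    then show False using prime_A[OF q(1,2)] goodD badD by blast
  qed
  have AHs: "subgroup (A <#> H) G" by (rule normalizer_mult_normal[OF A(1) nA H])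
  note AHsub = subset_set_mult[OF A(1) H]
  have AHG: "A <#> H = carrier G"
  proof (rule subgroup_eqI_prime_powers[OF AHs G0 subgroup.subset[OF AHs]])
    fix q :: nat assume q: "Factorial_Ring.prime q"
    show "q ^ multiplicity q (card (carrier G)) dvd card (A <#> H)"
    proof (cases "q = p")
      case True
      then show ?thesis using card_dvd[OF sP(1) AHs] PH AHsub sP(3) by auto
    next
      case False
      then have "R q \<subseteq> A <#> H" using R_sub[OF q False] AHsub BH by blast
      then show ?thesis using card_dvd[OF p_sylowD(1)[OF RM[OF q]] AHs] p_sylowD(3)[OF RG[OF q False]] by simp
    qed
  qed
  define E where "E = P \<inter> M"
  have E: "subgroup E G" "E \<subseteq> P" "E \<subseteq> M" using subgroups_Inter_pair[OF sP(1) sM(1)] by (auto simp: E_def)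
  have nE: "normalizer G E = carrier G"
    unfolding E_def by (rule normal_p_subgroup_Int_maximal[OF p sP(1,3) P(2) M(1) P(3)])
  have EB: "subgroup (E <#> B) G" by (rule normalizer_mult_normal[OF E(1) nE B(1)])
  have EBM: "E <#> B \<subseteq> M" by (rule set_mult_subset[OF sM(1) E(3) B(2)])
  note EBsub = subset_set_mult[OF E(1) B(1)]
  have EBH: "E <#> B \<subseteq> H" using set_mult_subset[OF H] E(2) PH BH by auto
  have max: "maximal_subgroup (E <#> B) (G\<lparr>carrier := H\<rparr>)"
    unfolding maximal_subgroup_def subgroup_restrict_iff[OF H]
  proof (intro conjI allI impI)
    show "subgroup (E <#> B) G" "E <#> B \<subseteq> H" by (rule EB, rule EBH)
    show "E <#> B \<noteq> carrier (G\<lparr>carrier := H\<rparr>)" using EBM P(3) PH by auto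
    fix K assume K: "subgroup K G \<and> K \<subseteq> H" "E <#> B \<subseteq> K"
    have AK: "subgroup (A <#> K) G" using normalizer_mult_normal[OF A(1) nA] K(1) by auto
    have AKsub: "A \<subseteq> A <#> K" "K \<subseteq> A <#> K" using subset_set_mult[OF A(1)] K(1) by auto
    have AKM: "subgroup (M \<inter> (A <#> K)) G" using sM(1) AK by (rule subgroups_Inter_pair)
    have "M \<inter> (A <#> K) = M"
    proof (rule subgroup_eqI_prime_powers[OF AKM sM(1)])
      fix q :: nat assume q: "Factorial_Ring.prime q"
      have "R q \<subseteq> A <#> K"
      proof (cases "q = p")
        case True
        have "R p \<subseteq> P"
          by (rule p_subgroup_subset_normal_sylow[OF G0 p P(1) _ p_sylowD(1)[OF RM[OF p]] _ p_sylowD(3)[OF RM[OF p]]])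
            (use P(2) p_sylowD(2)[OF RM[OF p]] cM in auto)
        then have "R p \<subseteq> E" using p_sylowD(2)[OF RM[OF p]] by (auto simp: E_def)
        then show ?thesis using True EBsub K(2) AKsub by blast
      next
        case False
        then show ?thesis using R_sub[OF q False] EBsub K(2) AKsub by blast
      qed
      then have "R q \<subseteq> M \<inter> (A <#> K)" using p_sylowD(2)[OF RM[OF q]] by auto
      then show "q ^ multiplicity q (card M) dvd card (M \<inter> (A <#> K))"
        using card_dvd[OF p_sylowD(1)[OF RM[OF q]] AKM] p_sylowD(3)[OF RM[OF q]] by simp
    qed auto
    then have "M \<subseteq> A <#> K" by auto
    then consider "A <#> K = carrier G" | "A <#> K = M" using sM(3)[OF AK] by auto
    then show "K = E <#> B \<or> K = carrier (G\<lparr>carrier := H\<rparr>)"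
    proof cases
      case 1
      have "H \<subseteq> K"
      proof
        fix x assume x: "x \<in> H"
        have cx: "x \<in> carrier G" using x H by (auto intro: subgroup.mem_carrier)
        then have "x \<in> A <#> K" using 1 by simp
        then obtain a k where ak: "a \<in> A" "k \<in> K" "x = a \<otimes> k" by (auto simp: set_mult_def)
        have c: "a \<in> carrier G" "k \<in> carrier G" using ak A(1) K(1) by (auto intro: subgroup.mem_carrier)
        have "x \<otimes> inv k \<in> H" using x ak(2) K(1) H by (meson subgroup.m_closed subgroup.m_inv_closed subsetD)
        moreover have "x \<otimes> inv k = a" using ak(3) c by (simp add: m_assoc)
        ultimately have "a = \<one>" using ak(1) AH by auto
        then show "x \<in> K" using ak c by simp
      qed
      then show ?thesis using K(1) by auto
    next
      case 2
      have "K \<subseteq> E <#> B"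
      proof
        fix x assume x: "x \<in> K"
        then have "x \<in> M" "x \<in> H" using 2 AKsub K(1) by auto
        then obtain y z where yz: "y \<in> P" "z \<in> B" "x = y \<otimes> z" by (auto simp: H_def set_mult_def)
        have c: "y \<in> carrier G" "z \<in> carrier G" using yz sP(1) B(1) by (auto intro: subgroup.mem_carrier)
        have "x \<otimes> inv z \<in> M" using \<open>x \<in> M\<close> yz(2) B(2) sM(1) by (meson subgroup.m_closed subgroup.m_inv_closed subsetD)
        then have "y \<in> M" using yz(3) c by (simp add: m_assoc)
        then show "x \<in> E <#> B" using yz by (auto simp: E_def set_mult_def)
      qed
      then show ?thesis using K(2) by auto
    qed
  qed
  have "sylow_subgroup (PP i) G \<and> PP i \<lhd> G" if i: "i \<in> {1..s}" for i
  proof (cases "i = s")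
    case True
    then show ?thesis using p p_dvd P sP(1) by (auto simp: PP_def sylow_subgroup_iff normal_iff_normalizer)
  next
    case False
    then have i': "i \<in> {1..<s}" using i by auto
    show ?thesis
      using PPi[OF i'] goodD[OF gi(1)[OF i']] gi(2)[OF i'] by (auto simp: sylow_subgroup_iff normal_iff_normalizer)
  qed
  moreover have "sylow_subgroup (QQ j) G \<and> \<not> QQ j \<lhd> G" if j: "j \<in> {1..t}" for j
    using QQj[OF j] badD[OF bj[OF j]] by (auto simp: sylow_subgroup_iff normal_iff_normalizer QQ_def)
  moreover have "PP s = P" by (simp add: PP_def)
  moreover have "internal_semidirect_product G P B H"
    using H PH BH PB P(2) sP(1) B(1) subgroup.subset[OF H]
    by (simp add: internal_semidirect_product_def normal_in_iff_normalizer subgroup_restrict_iff H_def[symmetric])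
  moreover have "internal_direct_product2 G A H (carrier G)"
    using AH AHG nA nH A(1) H by (simp add: internal_direct_product2_def subgroup_self normal_iff_normalizer)
  moreover have "subgroup E (G\<lparr>carrier := P\<rparr>) \<and> E \<lhd> G \<and> nilpotent (E <#> B) \<and>
      maximal_subgroup (E <#> B) (G\<lparr>carrier := P <#> B\<rparr>)"
    using E(1,2) nE max nilpotent_subgroup[OF sM(1) M(2) EB EBM] sP(1)
    by (simp add: subgroup_restrict_iff normal_iff_normalizer H_def)
  moreover have "s \<ge> 1" by (simp add: s_def)
  ultimately show ?thesis
    unfolding splitting_structure_def using t1 A_prod B_prod by metis
qed

section \<open>From the splitting to maximal subgroups\<close>

text \<open>
  Sylow subgroups of \<open>L\<close> for different primes are normal and meet trivially, so they commute. Hence the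
  centralizer of \<open>e\<close> contains every Sylow subgroup of \<open>B\<close>.
\<close>

lemma nilpotent_coprime_commute:
  assumes L: "subgroup L G" "nilpotent L" and p: "Factorial_Ring.prime p"
    and E: "subgroup E G" "E \<subseteq> L" "card E = p ^ k"
    and B: "subgroup B G" "B \<subseteq> L" "\<not> p dvd card B"
    and e: "e \<in> E" and b: "b \<in> B"
  shows "conj_by b e = e"
proof -
  have ce: "e \<in> carrier G" and cb: "b \<in> carrier G" using e b E(1) B(1) by (auto intro: subgroup.mem_carrier)
  obtain S where S: "p_sylow p S L" "E \<subseteq> S" using p_sylow_above[OF p L(1) E] by auto
  note sS = p_sylowD[OF S(1)]
  have nS: "L \<subseteq> normalizer G S" using L nilpotent_iff_sylow p S(1) by blast
  let ?Z = "{g \<in> carrier G. conj_by g e \<otimes> inv e \<in> {\<one>}}"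
  have "normalizer G {\<one>} = carrier G" using one_is_normal normal_iff_normalizer by blast
  then have Z: "subgroup ?Z G" by (rule subgroup_commuting_modulo[OF triv_subgroup _ ce])
  have BZ: "subgroup (B \<inter> ?Z) G" using B(1) Z by (rule subgroups_Inter_pair)
  have "B \<inter> ?Z = B"
  proof (rule subgroup_eqI_prime_powers[OF BZ B(1)])
    fix q :: nat assume q: "Factorial_Ring.prime q"
    obtain T where T: "p_sylow q T B" using p_sylow_exists[OF B(1) q] by auto
    note sT = p_sylowD[OF T]
    have "T \<subseteq> ?Z"
    proof (cases "q = p")
      case True
      then have "T = {\<one>}" using p_sylow_trivial[OF T q] B(3) by simp
      then show ?thesis using ce by simp
    next
      case False
      obtain T' where T': "p_sylow q T' L" "T \<subseteq> T'" using p_sylow_above[OF q L(1) sT(1) _ sT(3)] sT(2) B(2) by auto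
      note sT' = p_sylowD[OF T'(1)]
      have nT': "L \<subseteq> normalizer G T'" using L nilpotent_iff_sylow q T'(1) by blast
      have "coprime (card T') (card S)" using sT'(3) sS(3) p q False by (simp add: primes_coprime)
      then have "T' \<inter> S = {\<one>}" by (rule coprime_Int[OF sT'(1) sS(1)])
      then have "conj_by x e = e" if "x \<in> T" for x
        using commute_if_normalize[OF sT'(1) sS(1) _ _ _, of x e] that T'(2) e S(2) nS nT' sT'(2) sS(2) by blast
      then show ?thesis using ce subgroup.mem_carrier[OF sT(1)] by auto
    qed
    then have "T \<subseteq> B \<inter> ?Z" using sT(2) by blast
    then show "q ^ multiplicity q (card B) dvd card (B \<inter> ?Z)" using card_dvd[OF sT(1) BZ] sT(3) by simp
  qed auto
  then have "conj_by b e \<otimes> inv e = \<one>" using b by auto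
  then have "conj_by b e \<otimes> inv e \<otimes> e = e" using ce by simp
  then show ?thesis using ce cb by (simp add: m_assoc)
qed

lemma conj_by_eq_self_sym:
  assumes "a \<in> carrier G" "b \<in> carrier G" "conj_by a b = b"
  shows "conj_by b a = a"
proof -
  have "conj_by a b \<otimes> a = a \<otimes> b" using assms(1,2) by (simp add: conj_by_def m_assoc)
  then have "b \<otimes> a = a \<otimes> b" using assms(3) by simp
  then have "b \<otimes> a \<otimes> inv b = a \<otimes> b \<otimes> inv b" by simp
  then show ?thesis using assms(1,2) by (simp add: conj_by_def m_assoc)
qed

text \<open>
  Products of Sylow subgroups of \<open>A\<close> and \<open>B\<close> are Sylow subgroups of \<open>AB\<close>, and both \<open>A\<close> and \<open>B\<close> normalize
  them.
\<close>

lemma nilpotent_commuting_product: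
  assumes A: "subgroup A G" "nilpotent A" and B: "subgroup B G" "nilpotent B"
    and AB: "A \<inter> B = {\<one>}" and comm: "\<And>a b. a \<in> A \<Longrightarrow> b \<in> B \<Longrightarrow> conj_by a b = b"
  shows "subgroup (A <#> B) G" "nilpotent (A <#> B)"
proof -
  have comm': "conj_by b a = a" if "a \<in> A" "b \<in> B" for a b
    using that comm conj_by_eq_self_sym A(1) B(1) by (meson subgroup.mem_carrier)
  have BN: "B \<subseteq> normalizer G Y" if Y: "subgroup Y G" "Y \<subseteq> A" for Y
  proof
    fix b assume b: "b \<in> B"
    then have "\<forall>x\<in>Y. conj_by b x \<in> Y" using comm' Y(2) by auto
    then show "b \<in> normalizer G Y" using Y(1) subgroup.mem_carrier[OF B(1) b] by (simp add: mem_normalizer_iff)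
  qed
  have AN: "A \<subseteq> normalizer G Y" if Y: "subgroup Y G" "Y \<subseteq> B" for Y
  proof
    fix a assume a: "a \<in> A"
    then have "\<forall>x\<in>Y. conj_by a x \<in> Y" using comm Y(2) by auto
    then show "a \<in> normalizer G Y" using Y(1) subgroup.mem_carrier[OF A(1) a] by (simp add: mem_normalizer_iff)
  qed
  show C: "subgroup (A <#> B) G" by (rule subgroup_set_mult[OF A(1) B(1) BN[OF A(1) order_refl]])
  note Csub = subset_set_mult[OF A(1) B(1)]
  have cC: "card (A <#> B) = card A * card B" using card_set_mult[OF A(1) B(1)] AB by simp
  show "nilpotent (A <#> B)" unfolding nilpotent_iff_sylow[OF C]
  proof (intro allI impI)
    fix q :: nat and S assume q: "Factorial_Ring.prime q" and S: "p_sylow q S (A <#> B)"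
    obtain U where U: "p_sylow q U A" using p_sylow_exists[OF A(1) q] by auto
    obtain V where V: "p_sylow q V B" using p_sylow_exists[OF B(1) q] by auto
    note sU = p_sylowD[OF U] and sV = p_sylowD[OF V]
    have nU: "A \<subseteq> normalizer G U" using A nilpotent_iff_sylow q U by blast
    have nV: "B \<subseteq> normalizer G V" using B nilpotent_iff_sylow q V by blast
    have VU: "V \<subseteq> normalizer G U" using BN[OF sU(1,2)] sV(2) by auto
    have UV: "subgroup (U <#> V) G" by (rule subgroup_set_mult[OF sU(1) sV(1) VU])
    have UVsub: "U <#> V \<subseteq> A <#> B" using set_mult_subset[OF C] sU(2) sV(2) Csub by blast
    have "U \<inter> V \<subseteq> {\<one>}" using AB sU(2) sV(2) by auto
    then have "U \<inter> V = {\<one>}" using subgroup.one_closed[OF sU(1)] subgroup.one_closed[OF sV(1)] by auto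
    then have "card (U <#> V) = card U * card V" using card_set_mult[OF sU(1) sV(1)] by simp
    then have "card (U <#> V) = q ^ multiplicity q (card (A <#> B))"
      using sU(3) sV(3) cC q card_subgroup_pos[OF A(1)] card_subgroup_pos[OF B(1)]
      by (simp add: prime_elem_multiplicity_mult_distrib power_add)
    then have W: "p_sylow q (U <#> V) (A <#> B)" using UV UVsub by (simp add: p_sylow_def)
    have "A \<subseteq> normalizer G (U <#> V)" "B \<subseteq> normalizer G (U <#> V)"
      using normalizer_set_mult[OF sU(1) sV(1) UV] nU nV AN[OF sV(1,2)] BN[OF sU(1,2)] by blast+
    then have n: "A <#> B \<subseteq> normalizer G (U <#> V)" by (rule set_mult_subset[OF subgroup_normalizer[OF UV]])
    have "S = U <#> V" by (rule normal_sylow_unique[OF q W n C S])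
    then show "A <#> B \<subseteq> normalizer G S" using n by simp
  qed
qed

text \<open>
  A prime dividing the order of \<open>A\<close> belongs to one of the factors, and this factor is then the Sylow
  subgroup of \<open>A\<close> for that prime.
\<close>

lemma nilpotent_direct_product_of_sylows:
  assumes D: "internal_direct_product G I R A" and R: "\<And>i. i \<in> I \<Longrightarrow> sylow_subgroup (R i) G"
  shows "nilpotent A"
proof -
  have A: "subgroup A G" and I: "finite I" and gen: "A = generate G (\<Union>i\<in>I. R i)"
    using D by (auto simp: internal_direct_product_def)
  have Ri: "subgroup (R i) G" "R i \<subseteq> A" "A \<subseteq> normalizer G (R i)" if "i \<in> I" for i
    using D that normal_in_iff_normalizer[OF A, of "R i"] unfolding internal_direct_product_def by blast+
  have "A \<subseteq> normalizer G S" if q: "Factorial_Ring.prime q" and S: "p_sylow q S A" for q S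
  proof (cases "q dvd card A")
    case True
    then have qg: "q dvd card (generate G (\<Union>i\<in>I. R i))" using gen by simp
    obtain i where i: "i \<in> I" "q dvd card (R i)"
      by (rule prime_dvd_generate[where R = R, OF I A Ri q qg])
    obtain p where p: "Factorial_Ring.prime p" "p_sylow p (R i) (carrier G)"
      using R[OF i(1)] by (auto simp: sylow_subgroup_iff)
    have "q dvd p ^ multiplicity p (card (carrier G))" using i(2) p_sylowD(3)[OF p(2)] by simp
    then have "q = p" using q p(1) by (metis prime_dvd_power primes_dvd_imp_eq)
    then have "p_sylow q (R i) A"
      using p_sylow_mono[OF A subgroup_self subgroup.subset[OF A], of q "R i"] p(2) Ri(2)[OF i(1)] q by simp
    then have "S = R i" using normal_sylow_unique[OF q _ Ri(3)[OF i(1)] A S] by simp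
    then show ?thesis using Ri(3)[OF i(1)] by simp
  next
    case False
    then have "S = {\<one>}" using p_sylow_trivial[OF S q] by simp
    then show ?thesis using one_is_normal subgroup.subset[OF A] by (simp add: normal_iff_normalizer)
  qed
  then show ?thesis using nilpotent_iff_sylow[OF A] by blast
qed

text \<open>
  Here \<open>irred\<close> says that \<open>P/E\<close> has no proper nontrivial \<open>C\<close>-invariant subgroup. It replaces the
  maximality of \<open>EB\<close> in \<open>PB\<close>, so that \<open>C\<close> can be any nilpotent complement of \<open>P\<close> centralizing \<open>E\<close>.
\<close>

lemma nonnormal_maximal_nilpotent:
  assumes p: "Factorial_Ring.prime p" and P: "p_sylow p P (carrier G)" "normalizer G P = carrier G"
    and C: "subgroup C G" "nilpotent C" "\<not> p dvd card C" and PC: "P <#> C = carrier G"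
    and E: "subgroup E G" "E \<subseteq> P" "normalizer G E = carrier G"
    and cent: "\<And>c e. c \<in> C \<Longrightarrow> e \<in> E \<Longrightarrow> conj_by c e = e"
    and irred: "\<And>K. subgroup K G \<Longrightarrow> E \<subseteq> K \<Longrightarrow> K \<subseteq> P \<Longrightarrow> C \<subseteq> normalizer G K \<Longrightarrow> K = E \<or> K = P"
    and M: "maximal_subgroup M G" "normalizer G M \<noteq> carrier G"
  shows "nilpotent M"
proof -
  note sM = maximal_subgroupD[OF M(1)] and sP = p_sylowD[OF P(1)]
  have G0: "subgroup (carrier G) G" by (rule subgroup_self)
  have cM: "M \<subseteq> carrier G" and cC: "C \<subseteq> carrier G" and cE: "E \<subseteq> carrier G"
    using sM(1) C(1) E(1) by (auto dest: subgroup.subset)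
  have nM: "normalizer G M = M" using maximal_normalizer[OF M(1)] M(2) by auto
  have "coprime (card P) (card C)" using sP(3) C(3) p by (simp add: prime_imp_coprime coprime_power_left_iff)
  then have PiC: "P \<inter> C = {\<one>}" by (rule coprime_Int[OF sP(1) C(1)])
  \<comment> \<open>otherwise \<open>M = P(M \<inter> C)\<close>, and normalizers grow in \<open>C\<close>\<close>
  have PM: "\<not> P \<subseteq> M"
  proof
    assume PM: "P \<subseteq> M"
    have MC: "subgroup (M \<inter> C) G" using sM(1) C(1) by (rule subgroups_Inter_pair)
    have "M \<inter> C \<noteq> C"
    proof
      assume "M \<inter> C = C"
      then have "P <#> C \<subseteq> M" by (intro set_mult_subset[OF sM(1) PM]) auto
      then show False using PC cM sM(2) by auto
    qed
    then obtain x where x: "x \<in> C" "x \<notin> M" "x \<in> normalizer G (M \<inter> C)"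
      using nilpotent_normalizer_grows_in[OF C(1,2) MC] by auto
    have cx: "x \<in> carrier G" using x cC by auto
    have "conj_by x m \<in> M" if m: "m \<in> M" for m
    proof -
      have "m \<in> P <#> C" using m cM PC by auto
      then obtain y c where yc: "y \<in> P" "c \<in> C" "m = y \<otimes> c" by (auto simp: set_mult_def)
      have c: "y \<in> carrier G" "c \<in> carrier G" using yc sP(2) cC by auto
      have "inv y \<otimes> m \<in> M" using yc(1) PM m sM(1) by (meson subgroup.m_closed subgroup.m_inv_closed subsetD)
      then have "c \<in> M \<inter> C" using yc c by simp
      then have "conj_by x c \<in> M" using x(3) MC by (auto simp: mem_normalizer_iff)
      moreover have "conj_by x y \<in> M" using conj_by_normalizer[OF sP(1) _ yc(1), of x] P(2) cx PM by auto
      ultimately show ?thesis using yc(3) c cx sM(1) by (simp add: conj_by_mult subgroup.m_closed)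
    qed
    then have "x \<in> normalizer G M" using cx sM(1) by (simp add: mem_normalizer_iff)
    then show False using nM x by simp
  qed
  have p_in: "T \<subseteq> P \<inter> M" if T: "subgroup T G" "T \<subseteq> M" "card T = p ^ k" for T k
    using p_subgroup_subset_normal_sylow[OF G0 p P(1) _ T(1) _ T(3)] P(2) T(2) cM by auto
  have M_syl: "p_sylow q T (carrier G)" if q: "Factorial_Ring.prime q" "q \<noteq> p" and T: "p_sylow q T M" for q T
  proof (rule p_sylow_index_coprime[OF q(1) sM(1) cM G0 _ T], rule prime_power_dvd_of_dvd_mult[OF p q])
    have "card (carrier G) * card (P \<inter> M) = card P * card M"
      using card_set_mult[OF sP(1) sM(1)] maximal_set_mult[OF sP(1) P(2) M(1) PM] by simp
    then show "card (carrier G) dvd p ^ multiplicity p (card (carrier G)) * card M" using sP(3) by (metis dvd_triv_left)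
  qed
  have C_syl: "p_sylow q U (carrier G)" if q: "Factorial_Ring.prime q" "q \<noteq> p" and U: "p_sylow q U C" for q U
  proof (rule p_sylow_index_coprime[OF q(1) C(1) cC G0 _ U], rule prime_power_dvd_of_dvd_mult[OF p q])
    show "card (carrier G) dvd p ^ multiplicity p (card (carrier G)) * card C"
      using card_set_mult_dvd[OF sP(1) C(1)] PC sP(3) by simp
  qed
  define P1 where "P1 = P \<inter> M"
  have P1: "subgroup P1 G" using subgroups_Inter_pair[OF sP(1) sM(1)] by (simp add: P1_def)
  have nP1: "normalizer G P1 = carrier G"
    unfolding P1_def by (rule normal_p_subgroup_Int_maximal[OF p sP(1,3) P(2) M(1) PM])
  \<comment> \<open>otherwise \<open>M\<close> is the normal subgroup \<open>P1 C\<close>\<close>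
  have EM: "E \<subseteq> M"
  proof (rule ccontr)
    assume "\<not> E \<subseteq> M"
    then have EMG: "E <#> M = carrier G" by (rule maximal_set_mult[OF E(1,3) M(1)])
    let ?D = "P1 <#> C"
    have D: "subgroup ?D G" "normalizer G C \<subseteq> normalizer G ?D" by (rule normalizer_mult_normal[OF P1 nP1 C(1)])+
    note Dsub = subset_set_mult[OF P1 C(1)]
    have "E \<subseteq> normalizer G C"
    proof
      fix e assume e: "e \<in> E"
      have ce: "e \<in> carrier G" using e cE by auto
      have "conj_by e c = c" if "c \<in> C" for c using conj_by_eq_self_sym[OF _ ce cent[OF that e]] that cC by auto
      then show "e \<in> normalizer G C" using ce C(1) by (simp add: mem_normalizer_iff)
    qed
    then have E_D: "E \<subseteq> normalizer G ?D" using D(2) by auto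
    have P1_D: "P1 \<subseteq> normalizer G ?D" using Dsub(1) subset_normalizer[OF D(1)] by auto
    have "P \<subseteq> normalizer G ?D"
    proof
      fix y assume y: "y \<in> P"
      then have "y \<in> E <#> M" using EMG sP(2) by auto
      then obtain e m where em: "e \<in> E" "m \<in> M" "y = e \<otimes> m" by (auto simp: set_mult_def)
      have c: "e \<in> carrier G" "m \<in> carrier G" using em cE cM by auto
      have "inv e \<otimes> y \<in> P" using em(1) E(2) y sP(1) by (meson subgroup.m_closed subgroup.m_inv_closed subsetD)
      then have "m \<in> P1" using em(2,3) c by (simp add: P1_def)
      then show "y \<in> normalizer G ?D"
        unfolding em(3) using em(1) E_D P1_D by (intro subgroup.m_closed[OF subgroup_normalizer[OF D(1)]]) auto
    qed
    moreover have "C \<subseteq> normalizer G ?D" using Dsub(2) subset_normalizer[OF D(1)] by auto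
    ultimately have "P <#> C \<subseteq> normalizer G ?D" by (rule set_mult_subset[OF subgroup_normalizer[OF D(1)]])
    then have nD: "normalizer G ?D = carrier G" using PC normalizer_subset_carrier[OF D(1)] by auto
    have MD: "subgroup (M \<inter> ?D) G" using sM(1) D(1) by (rule subgroups_Inter_pair)
    have "M \<inter> ?D = M"
    proof (rule subgroup_eqI_prime_powers[OF MD sM(1)])
      fix q :: nat assume q: "Factorial_Ring.prime q"
      obtain T where T: "p_sylow q T M" using p_sylow_exists[OF sM(1) q] by auto
      note sT = p_sylowD[OF T]
      have "T \<subseteq> ?D"
      proof (cases "q = p")
        case True
        then show ?thesis using p_in[OF sT(1,2)] sT(3) Dsub(1) by (auto simp: P1_def)
      next
        case False
        obtain U where U: "p_sylow q U C" using p_sylow_exists[OF C(1) q] by auto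
        note sU = p_sylowD[OF U] and sT' = p_sylowD[OF M_syl[OF q False T]]
        show ?thesis
          by (rule normal_sylow_contains[OF q G0 D(1) _ _ C_syl[OF q False U] _ sT'])
            (use nD sU(2) Dsub(2) subgroup.subset[OF D(1)] in auto)
      qed
      then have "T \<subseteq> M \<inter> ?D" using sT(2) by auto
      then show "q ^ multiplicity q (card M) dvd card (M \<inter> ?D)" using card_dvd[OF sT(1) MD] sT(3) by simp
    qed auto
    then have "M \<subseteq> ?D" by auto
    moreover have "?D \<noteq> carrier G"
    proof
      assume DG: "?D = carrier G"
      have "P \<subseteq> M"
      proof
        fix y assume y: "y \<in> P"
        then have "y \<in> ?D" using DG sP(2) by auto
        then obtain x c where xc: "x \<in> P1" "c \<in> C" "y = x \<otimes> c" by (auto simp: set_mult_def)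
        have cc: "x \<in> carrier G" "c \<in> carrier G" using xc P1 cC by (auto intro: subgroup.mem_carrier)
        have "x \<in> P" using xc by (simp add: P1_def)
        then have "inv x \<otimes> y \<in> P" using y sP(1) by (meson subgroup.m_closed subgroup.m_inv_closed)
        then have "c \<in> P \<inter> C" using xc cc by simp
        then have "c = \<one>" using PiC by auto
        then show "y \<in> M" using xc cc by (simp add: P1_def)
      qed
      then show False using PM by simp
    qed
    ultimately have "?D = M" using sM(3)[OF D(1)] by simp
    then show False using nD M(2) by simp
  qed
  have "E \<subseteq> P1" using EM E(2) by (auto simp: P1_def)
  then have "P1 = E \<or> P1 = P" using irred[OF P1] nP1 cC by (auto simp: P1_def)
  then have PME: "P \<inter> M = E" using PM by (auto simp: P1_def)
  show "nilpotent M" unfolding nilpotent_iff_sylow[OF sM(1)]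
  proof (intro allI impI)
    fix q :: nat and T assume q: "Factorial_Ring.prime q" and T: "p_sylow q T M"
    note sT = p_sylowD[OF T]
    show "M \<subseteq> normalizer G T"
    proof (cases "q = p")
      case True
      obtain i where i: "card E = p ^ i" using p_subgroup_card[OF p sP(1,3) E(1,2)] by auto
      have "T \<subseteq> E" using p_in[OF sT(1,2)] sT(3) True PME by auto
      then have "T = E" using p_sylow_card_eqI[OF p _ E(1) EM _ sM(1) i] T True by auto
      then show ?thesis using E(3) cM by simp
    next
      case False
      have TG: "p_sylow q T (carrier G)" by (rule M_syl[OF q False T])
      note sTG = p_sylowD[OF TG]
      obtain U where U: "p_sylow q U C" using p_sylow_exists[OF C(1) q] by auto
      note sU = p_sylowD[OF U]
      have UG: "p_sylow q U (carrier G)" by (rule C_syl[OF q False U])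
      have nU: "C \<subseteq> normalizer G U" using C(2) nilpotent_iff_sylow[OF C(1)] q U by auto
      \<comment> \<open>\<open>PU\<close> is normal in \<open>G\<close> and meets \<open>M\<close> in \<open>ET\<close>, in which \<open>T\<close> is the only Sylow \<open>q\<close>-subgroup\<close>
      let ?W = "P <#> U"
      have W: "subgroup ?W G" "normalizer G U \<subseteq> normalizer G ?W" by (rule normalizer_mult_normal[OF sP(1) P(2) sU(1)])+
      note Wsub = subset_set_mult[OF sP(1) sU(1)]
      have "P <#> C \<subseteq> normalizer G ?W"
        using set_mult_subset[OF subgroup_normalizer[OF W(1)]] Wsub(1) subset_normalizer[OF W(1)] nU W(2) by blast
      then have nW: "carrier G \<subseteq> normalizer G ?W" using PC by simp
      have TW: "T \<subseteq> ?W"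
        by (rule normal_sylow_contains[OF q G0 W(1) subgroup.subset[OF W(1)] nW UG Wsub(2) sTG])
      let ?X = "?W \<inter> M"
      have Y: "subgroup ?X G" using W(1) sM(1) by (rule subgroups_Inter_pair)
      have E_T: "E \<subseteq> normalizer G T"
      proof
        fix e assume e: "e \<in> E"
        have ce: "e \<in> carrier G" using e cE by auto
        obtain g where g: "g \<in> carrier G" "conj_by g ` T \<subseteq> U"
          using p_subgroup_conj_into[OF G0 q UG sTG] by auto
        have "conj_by e t = t" if t: "t \<in> T" for t
        proof -
          have ct: "t \<in> carrier G" using t sTG(2) by auto
          have "conj_by g t \<in> C" using g(2) t sU(2) by auto
          moreover have "conj_by g e \<in> E" using conj_by_normalizer[OF E(1) _ e] E(3) g(1) by auto
          ultimately have "conj_by (conj_by g t) (conj_by g e) = conj_by g e" by (rule cent)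
          moreover have "conj_by (conj_by g t) (conj_by g e) = conj_by g (conj_by t e)"
            using g(1) ct ce by (simp add: conj_by_def m_assoc inv_mult_group)
          ultimately have "conj_by (inv g) (conj_by g (conj_by t e)) = conj_by (inv g) (conj_by g e)" by simp
          then have "conj_by t e = e" using g(1) ct ce by simp
          then show ?thesis by (rule conj_by_eq_self_sym[OF ct ce])
        qed
        then show "e \<in> normalizer G T" using ce sT(1) by (simp add: mem_normalizer_iff)
      qed
      have ET: "subgroup (E <#> T) G" by (rule normalizer_mult_normal[OF E(1,3) sT(1)])
      note ETsub = subset_set_mult[OF E(1) sT(1)]
      have "E <#> T = ?X"
      proof (rule index_p_power_eq[OF p ET Y])
        have "E \<subseteq> ?X" using E(2) EM Wsub(1) by auto
        then show "E <#> T \<subseteq> ?X" using set_mult_subset[OF Y] TW sT(2) by auto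
        have "card ?X dvd card ?W" by (rule card_dvd[OF Y W(1)]) auto
        also have "card ?W dvd card P * card U" by (rule card_set_mult_dvd[OF sP(1) sU(1)])
        also have "card P * card U = card T * p ^ multiplicity p (card (carrier G))"
          using sP(3) p_sylowD(3)[OF UG] sTG(3) by simp
        also have "\<dots> dvd card (E <#> T) * p ^ multiplicity p (card (carrier G))"
          using card_dvd[OF sT(1) ET ETsub(2)] by (rule mult_dvd_mono) simp
        finally show "card ?X dvd card (E <#> T) * p ^ multiplicity p (card (carrier G))" .
        obtain V where V: "p_sylow p V ?X" using p_sylow_exists[OF Y p] by auto
        note sV = p_sylowD[OF V]
        have "V \<subseteq> E" using p_in[OF sV(1) _ sV(3)] sV(2) PME by auto
        then have "card V dvd card (E <#> T)" using ETsub(1) by (intro card_dvd[OF sV(1) ET]) auto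
        then show "p ^ multiplicity p (card ?X) dvd card (E <#> T)" using sV(3) by simp
      qed
      then have X_T: "?X \<subseteq> normalizer G T"
        using set_mult_subset[OF subgroup_normalizer[OF sT(1)] E_T subset_normalizer[OF sT(1)]] by simp
      have TX: "p_sylow q T ?X" using p_sylow_mono[OF Y sM(1) _ T _ q] TW sT(2) by auto
      show ?thesis
      proof
        fix m assume m: "m \<in> M"
        have cm: "m \<in> carrier G" using m cM by auto
        have "conj_by m x \<in> ?X" if "x \<in> T" for x
          using conj_by_normalizer[OF W(1), of m x] conj_by_subgroup_closed[OF sM(1) m, of x] nW cm that TW sT(2) by auto
        then have "conj_by m ` T \<subseteq> ?X" by auto
        then have "conj_by m ` T \<subseteq> T"
          using p_subgroup_subset_normal_sylow[OF Y q TX X_T subgroup_conj_by[OF cm sT(1)]]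
            card_conj_by[OF cm sTG(2)] sT(3) by simp
        then show "m \<in> normalizer G T" using cm sT(1) by (auto simp: mem_normalizer_iff)
      qed
    qed
  qed
qed

text \<open>
  \<open>C = AB\<close> satisfies the hypotheses of \<open>nonnormal_maximal_nilpotent\<close>: \<open>A\<close> commutes with the normal factor
  \<open>H\<close>, which contains \<open>B\<close> and \<open>E\<close>, while \<open>B\<close> commutes with \<open>E\<close> because they have coprime orders in the
  nilpotent group \<open>EB\<close>.
\<close>

lemma splitting_structure_imp_maximals:
  assumes splitting_structure
  shows maximals_nilpotent_or_normal
proof -
  obtain s t :: nat and PP QQ :: "nat \<Rightarrow> 'a set" and A B H E where st: "s \<ge> 1"
    and PP: "\<And>i. i \<in> {1..s} \<Longrightarrow> sylow_subgroup (PP i) G" "\<And>i. i \<in> {1..s} \<Longrightarrow> PP i \<lhd> G"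
    and A_prod: "internal_direct_product G {1..<s} PP A"
    and H_prod: "internal_semidirect_product G (PP s) B H"
    and G_prod: "internal_direct_product2 G A H (carrier G)"
    and E: "subgroup E (G\<lparr>carrier := PP s\<rparr>)" "E \<lhd> G" "nilpotent (E <#> B)"
      "maximal_subgroup (E <#> B) (G\<lparr>carrier := PP s <#> B\<rparr>)"
    using assms unfolding splitting_structure_def by blast
  define P where "P = PP s"
  have s: "s \<in> {1..s}" using st by simp
  obtain p where p: "Factorial_Ring.prime p" and P: "p_sylow p P (carrier G)"
    using PP(1)[OF s] by (auto simp: sylow_subgroup_iff P_def)
  note sP = p_sylowD[OF P]
  have nP: "normalizer G P = carrier G" using PP(2)[OF s] by (simp add: normal_iff_normalizer P_def)
  have A: "subgroup A G" "normalizer G A = carrier G" and H: "subgroup H G" "normalizer G H = carrier G"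
    and AHG: "A <#> H = carrier G" and AH: "A \<inter> H = {\<one>}"
    using G_prod by (auto simp: internal_direct_product2_def normal_iff_normalizer)
  have PH: "P \<subseteq> H" and B: "subgroup B G" "B \<subseteq> H" and HPB: "H = P <#> B" and PB: "P \<inter> B = {\<one>}"
    using H_prod H(1) by (auto simp: internal_semidirect_product_def normal_in_iff_normalizer subgroup_restrict_iff P_def)
  have E': "subgroup E G" "E \<subseteq> P" "normalizer G E = carrier G"
    using E(1,2) sP(1) by (auto simp: subgroup_restrict_iff normal_iff_normalizer P_def)
  have p_not_dvd: "\<not> p dvd card Y" if Y: "subgroup Y G" "P \<inter> Y = {\<one>}" for Y
  proof
    assume d: "p dvd card Y"
    obtain T where T: "p_sylow p T Y" using p_sylow_exists[OF Y(1) p] by auto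
    note sT = p_sylowD[OF T]
    have "T \<subseteq> P"
      using p_subgroup_subset_normal_sylow[OF subgroup_self p P _ sT(1) _ sT(3)] nP subgroup.subset[OF sT(1)] by auto
    then have "T \<subseteq> {\<one>}" using Y(2) sT(2) by auto
    then have "card T \<le> 1" using card_mono[of "{\<one>}" T] by simp
    moreover have "multiplicity p (card Y) > 0"
      using d p card_subgroup_pos[OF Y(1)] by (simp add: prime_multiplicity_gt_zero_iff)
    then have "p ^ 1 \<le> card T" using sT(3) p by (metis One_nat_def Suc_leI power_increasing prime_ge_1_nat)
    ultimately show False using prime_gt_1_nat[OF p] by simp
  qed
  have EB: "subgroup (E <#> B) G" by (rule normalizer_mult_normal[OF E'(1,3) B(1)])
  note EBsub = subset_set_mult[OF E'(1) B(1)]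
  have nilA: "nilpotent A" by (rule nilpotent_direct_product_of_sylows[OF A_prod]) (use PP(1) in auto)
  have nilB: "nilpotent B" by (rule nilpotent_subgroup[OF EB E(3) B(1) EBsub(2)])
  have A_comm: "conj_by a h = h" if "a \<in> A" "h \<in> H" for a h
    by (rule commute_if_normalize[OF A(1) H(1) _ _ AH that])
      (use A H subgroup.subset[OF A(1)] subgroup.subset[OF H(1)] in auto)
  let ?C = "A <#> B"
  have "A \<inter> B \<subseteq> {\<one>}" using AH B(2) by auto
  then have AB: "A \<inter> B = {\<one>}" using subgroup.one_closed[OF A(1)] subgroup.one_closed[OF B(1)] by auto
  have C: "subgroup ?C G" "nilpotent ?C"
    by (rule nilpotent_commuting_product[OF A(1) nilA B(1) nilB AB A_comm]; use B(2) in blast)+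
  note Csub = subset_set_mult[OF A(1) B(1)]
  have "P \<inter> A \<subseteq> {\<one>}" using AH PH by auto
  then have PA: "P \<inter> A = {\<one>}" using subgroup.one_closed[OF A(1)] subgroup.one_closed[OF sP(1)] by auto
  have pA: "\<not> p dvd card A" and pB: "\<not> p dvd card B" using p_not_dvd A(1) B(1) PA PB by auto
  have pC: "\<not> p dvd card ?C"
    using card_set_mult_dvd[OF A(1) B(1)] pA pB p dvd_trans prime_dvd_mult_iff by blast
  have PCs: "subgroup (P <#> ?C) G" by (rule normalizer_mult_normal[OF sP(1) nP C(1)])
  note PCsub = subset_set_mult[OF sP(1) C(1)]
  have "H \<subseteq> P <#> ?C" unfolding HPB using set_mult_subset[OF PCs] PCsub Csub by blast
  then have "A <#> H \<subseteq> P <#> ?C" using set_mult_subset[OF PCs] PCsub Csub by blast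
  then have PC: "P <#> ?C = carrier G" using AHG subgroup.subset[OF PCs] by auto
  obtain k where k: "card E = p ^ k" using p_subgroup_card[OF p sP(1,3) E'(1,2)] by auto
  have cent: "conj_by c e = e" if c: "c \<in> ?C" and e: "e \<in> E" for c e
  proof -
    obtain a b where ab: "a \<in> A" "b \<in> B" "c = a \<otimes> b" using c by (auto simp: set_mult_def)
    have cc: "a \<in> carrier G" "b \<in> carrier G" "e \<in> carrier G"
      using ab e A(1) B(1) E'(1) by (auto intro: subgroup.mem_carrier)
    have "conj_by b e = e" by (rule nilpotent_coprime_commute[OF EB E(3) p E'(1) EBsub(1) k B(1) EBsub(2) pB e ab(2)])
    moreover have "conj_by a e = e" using A_comm[OF ab(1)] e E'(2) PH by auto
    ultimately show ?thesis using ab(3) cc conj_by_conj_by[of a b e] by simp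
  qed
  have PBs: "subgroup (P <#> B) G" using H(1) HPB by simp
  \<comment> \<open>\<open>K\<close> is recovered from \<open>KB\<close> as its intersection with \<open>P\<close>, which is the content of \<open>cut\<close>\<close>
  have irred: "K = E \<or> K = P"
    if K: "subgroup K G" "E \<subseteq> K" "K \<subseteq> P" "?C \<subseteq> normalizer G K" for K
  proof -
    have KB: "subgroup (K <#> B) G" using subgroup_set_mult[OF K(1) B(1)] K(4) Csub by auto
    note KBsub = subset_set_mult[OF K(1) B(1)]
    have "K <#> B \<subseteq> P <#> B" "E <#> B \<subseteq> K <#> B"
      using K(2,3) by (auto simp: set_mult_def)
    then have two: "K <#> B = E <#> B \<or> K <#> B = P <#> B"
      using E(4) KB unfolding maximal_subgroup_def P_def[symmetric] subgroup_restrict_iff[OF PBs] by simp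
    have cut: "Y \<subseteq> Z" if YZ: "Y <#> B = Z <#> B" "subgroup Y G" "subgroup Z G" "Y \<subseteq> P" "Z \<subseteq> P" for Y Z
    proof
      fix y assume y: "y \<in> Y"
      then have "y \<in> Z <#> B" using subset_set_mult(1)[OF YZ(2) B(1)] YZ(1) by auto
      then obtain z b where zb: "z \<in> Z" "b \<in> B" "y = z \<otimes> b" by (auto simp: set_mult_def)
      have c: "z \<in> carrier G" "b \<in> carrier G" using zb YZ(3) B(1) by (auto intro: subgroup.mem_carrier)
      have "inv z \<otimes> y \<in> P" using zb(1) y YZ(4,5) sP(1) by (meson subgroup.m_closed subgroup.m_inv_closed subsetD)
      then have "b \<in> P \<inter> B" using zb c by simp
      then show "y \<in> Z" using PB zb c by auto
    qed
    have "K = E" if "K <#> B = E <#> B" using cut[OF that K(1) E'(1) K(3) E'(2)] K(2) by blast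
    moreover have "K = P" if "K <#> B = P <#> B" using cut[OF that[symmetric] sP(1) K(1) order_refl K(3)] K(3) by blast
    ultimately show ?thesis using two by blast
  qed
  show ?thesis unfolding maximals_nilpotent_or_normal_def
    using nonnormal_maximal_nilpotent[OF p P nP C pC PC E' cent irred] by blast
qed

end

theorem corollary1p10:
  fixes G :: "('a, 'b) monoid_scheme"
  assumes "group G"
    and "finite (carrier G)"
    and "\<not> nilpotent_group G"
  shows "(\<forall>M. maximal_subgroup M G \<and> \<not> nilpotent_group (G\<lparr>carrier := M\<rparr>) \<longrightarrow> M \<lhd> G) \<longleftrightarrow>
    (\<exists>(s::nat) (t::nat) (P :: nat \<Rightarrow> 'a set) (Q :: nat \<Rightarrow> 'a set) A B H.
       s \<ge> 1 \<and> t \<ge> 1 \<and>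
       (\<forall>i \<in> {1..s}. sylow_subgroup (P i) G \<and> P i \<lhd> G) \<and>
       (\<forall>j \<in> {1..t}. sylow_subgroup (Q j) G \<and> \<not> Q j \<lhd> G) \<and>
       internal_direct_product G {1..<s} P A \<and>
       internal_direct_product G {1..t} Q B \<and>
       internal_semidirect_product G (P s) B H \<and>
       internal_direct_product2 G A H (carrier G) \<and>
       (\<exists>E. subgroup E (G\<lparr>carrier := P s\<rparr>) \<and> E \<lhd> G \<and>
            nilpotent_group (G\<lparr>carrier := E <#>\<^bsub>G\<^esub> B\<rparr>) \<and>
            maximal_subgroup (E <#>\<^bsub>G\<^esub> B) (G\<lparr>carrier := P s <#>\<^bsub>G\<^esub> B\<rparr>)))"
proof -
  interpret finite_group G
    using assms(1,2) by (simp add: finite_group_def finite_group_axioms_def)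
  have "(\<forall>M. maximal_subgroup M G \<and> \<not> nilpotent M \<longrightarrow> M \<lhd> G) \<longleftrightarrow> maximals_nilpotent_or_normal"
    by (auto simp: maximals_nilpotent_or_normal_def normal_iff_normalizer maximal_subgroup_def)
  also have "\<dots> \<longleftrightarrow> splitting_structure"
    using exists_nilpotent_maximal[OF _ assms(3)] splitting_structure_of_nilpotent_maximal[OF assms(3)]
      splitting_structure_imp_maximals by metis
  finally show ?thesis unfolding splitting_structure_def .
qed

end
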